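(* Let $G$ be a finitely generated cancellative commutative semigroup and let $S$ be any finite system of generators of $G$. Then the absolute $\mathscr{A}_S(G)$ is homeomorphic to the closed disk whose dimension is one less than the rank of the group of fractions of $G$ if $G$ is a branching semigroup and $S$ is an admissible system of generators, and coincides with the rank of the group of fractions of $G$ otherwise. The main part of the absolute corresponds (under the homeomorphism) to the interior of the disk.
   Context: A finite system of generators $S$ of a commutative semigroup $G$ (written additively) is a finite nonempty family of elements of $G$, repetitions allowed (repeated elements being treated as distinct members of $S$), generating $G$ (if $G$ has an identity element, the identity need not be a sum of a nonempty sequence of members of $S$). $G$ is cancellative if $a+c=b+c$ implies $a=b$. Let $G^1=G$ if $G$ has an identity element, and otherwise let $G^1$ be $G$ with an identity element adjoined; denote the identity by $0$. The Cayley graph of $(G,S)$ has vertex set $G^1$ and, for every vertex $g$ and every $s\in S$, a directed edge marked by $s$ from $g$ to $g+s$; the distinguished vertex is $0$. The space $\mathscr{P}$ of infinite paths starting at $0$ is identified, via sequences of edge marks, with $S^{\mathbb{N}}$ with the product topology. The measure of a finite path starting at $0$ is the measure of the cylinder of all infinite paths beginning with it. A Borel probability measure $\nu$ on $\mathscr{P}$ is central if for every vertex $v$ and every positive integer $n$, $\nu$ takes the same value on all paths of length $n$ leading from $0$ to $v$. A central measure is ergodic if it is an extreme point of the convex compact set of central measures. The absolute $\mathscr{A}_S(G)$ is the set of all ergodic central measures, with the topology induced by the weak topology on Borel probability measures on $\mathscr{P}$. The main part of the absolute is the subset of nondegenerate measures, i.e. those ergodic central measures for which every finite path starting at $0$ has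 nonzero measure. The group of fractions of $G$ is the group with the same generators as $G$ in which the relations are all corollaries of the relations in $G$ (the Grothendieck group of $G$). The rank of a commutative group $A$ is $\dim_{\mathbb{Q}}(A\otimes\mathbb{Q})$. A graph with a distinguished vertex is a branching graph if for each vertex $v$ the set of paths from the distinguished vertex to $v$ is nonempty and all these paths have the same length. A branching monoid is a monoid whose Cayley graph with respect to some system of generators is a branching graph; a branching semigroup is a branching monoid or a semigroup obtained from a branching monoid by removing the identity element. In a branching semigroup there is a canonical generating set, consisting of all irreducible elements (non-identity elements that are not sums of two non-identity elements). A system of generators is admissible if it is built from this canonical set, i.e. each of its members is irreducible (each irreducible element occurring, possibly with multiplicity). The $0$-dimensional closed disk is a point and equals its own interior. *)

theory Defs
  imports
    "HOL-Probability.Probability"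
    "HOL-Algebra.Group"
    "HOL-Library.Poly_Mapping"
begin

section \<open>The group of fractions and its rank\<close>

text \<open>
  The group of fractions consists of the formal differences \<open>a - b\<close>. The sort contains
  cancellativity, so no auxiliary summand is needed in the equivalence.
\<close>

quotient_type (overloaded) 'g fraction_group =
  "'g :: {ab_semigroup_add, cancel_semigroup_add} \<times> 'g" /
  "\<lambda>p q. fst p + snd q = fst q + snd p"
proof (rule equivpI)
  show "reflp (\<lambda>p q. fst p + snd q = fst q + snd (p :: 'g \<times> 'g))"
    by (simp add: reflp_def)
  show "symp (\<lambda>p q. fst p + snd q = fst q + snd (p :: 'g \<times> 'g))"
    by (simp add: symp_def)
  show "transp (\<lambda>p q. fst p + snd q = fst q + snd (p :: 'g \<times> 'g))"
  proof (rule transpI)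
    fix p q r :: "'g \<times> 'g"
    assume pq: "fst p + snd q = fst q + snd p" and qr: "fst q + snd r = fst r + snd q"
    have "(fst p + snd r) + snd q = (fst p + snd q) + snd r"
      by (simp add: ac_simps)
    also have "\<dots> = (fst q + snd r) + snd p"
      unfolding pq by (simp add: ac_simps)
    also have "\<dots> = (fst r + snd p) + snd q"
      unfolding qr by (simp add: ac_simps)
    finally show "fst p + snd r = fst r + snd p"
      by simp
  qed
qed

instantiation fraction_group :: ("{ab_semigroup_add, cancel_semigroup_add}") ab_group_add
begin

text \<open>The zero is the class of \<open>(a, a)\<close> for any \<open>a\<close>; the choice of \<open>a\<close> is immaterial.\<close>

lift_definition zero_fraction_group :: "'a fraction_group" is "(undefined, undefined)" .

lift_definition plus_fraction_group ::
    "'a fraction_group \<Rightarrow> 'a fraction_group \<Rightarrow> 'a fraction_group"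
  is "\<lambda>p q. (fst p + fst q, snd p + snd q)"
proof -
  fix p p' q q' :: "'a \<times> 'a"
  assume p: "fst p + snd p' = fst p' + snd p" and q: "fst q + snd q' = fst q' + snd q"
  have "(fst p + fst q) + (snd p' + snd q') = (fst p + snd p') + (fst q + snd q')"
    by (simp add: ac_simps)
  also have "\<dots> = (fst p' + fst q') + (snd p + snd q)"
    unfolding p q by (simp add: ac_simps)
  finally show "fst (fst p + fst q, snd p + snd q) + snd (fst p' + fst q', snd p' + snd q') =
      fst (fst p' + fst q', snd p' + snd q') + snd (fst p + fst q, snd p + snd q)"
    by simp
qed

lift_definition uminus_fraction_group :: "'a fraction_group \<Rightarrow> 'a fraction_group"
  is "\<lambda>p. (snd p, fst p)"
  by (simp add: add.commute)

definition minus_fraction_group :: "'a fraction_group \<Rightarrow> 'a fraction_group \<Rightarrow> 'a fraction_group"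
  where "minus_fraction_group x y = x + - y"

instance
proof
  fix x y z :: "'a fraction_group"
  show "x + y + z = x + (y + z)" by transfer (simp add: ac_simps)
  show "x + y = y + x" by transfer (simp add: ac_simps)
  show "0 + x = x" by transfer (simp add: ac_simps)
  show "- x + x = 0" by transfer (simp add: ac_simps)
  show "x - y = x + - y" by (rule minus_fraction_group_def)
qed

end

text \<open>
  The tensor product of an abelian group with the rationals: the free abelian group on the
  pairs \<open>(a, r)\<close> modulo the subgroup generated by the bilinearity relations.
\<close>

inductive_set bilinear_relations :: "('a :: ab_group_add \<times> rat \<Rightarrow>\<^sub>0 int) set" where
  zero: "0 \<in> bilinear_relations"
| diff: "x \<in> bilinear_relations \<Longrightarrow> y \<in> bilinear_relations \<Longrightarrow> x - y \<in> bilinear_relations"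
| left: "frag_of (a + b, r) - frag_of (a, r) - frag_of (b, r) \<in> bilinear_relations"
| right: "frag_of (a, r + q) - frag_of (a, r) - frag_of (a, q) \<in> bilinear_relations"

lemma bilinear_relations_uminus:
  "x \<in> bilinear_relations \<Longrightarrow> - x \<in> bilinear_relations"
  using bilinear_relations.diff[OF bilinear_relations.zero, of x] by simp

lemma bilinear_relations_add:
  "x \<in> bilinear_relations \<Longrightarrow> y \<in> bilinear_relations \<Longrightarrow> x + y \<in> bilinear_relations"
  using bilinear_relations.diff[OF _ bilinear_relations_uminus, of x y] by simp

quotient_type (overloaded) 'a rat_tensor =
  "'a :: ab_group_add \<times> rat \<Rightarrow>\<^sub>0 int" / "\<lambda>x y. x - y \<in> bilinear_relations"
proof (rule equivpI)
  show "reflp (\<lambda>x y :: 'a \<times> rat \<Rightarrow>\<^sub>0 int. x - y \<in> bilinear_relations)"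
    by (simp add: reflp_def bilinear_relations.zero)
  show "symp (\<lambda>x y :: 'a \<times> rat \<Rightarrow>\<^sub>0 int. x - y \<in> bilinear_relations)"
  proof (rule sympI)
    fix x y :: "'a \<times> rat \<Rightarrow>\<^sub>0 int"
    assume "x - y \<in> bilinear_relations"
    from bilinear_relations_uminus[OF this] show "y - x \<in> bilinear_relations"
      by simp
  qed
  show "transp (\<lambda>x y :: 'a \<times> rat \<Rightarrow>\<^sub>0 int. x - y \<in> bilinear_relations)"
  proof (rule transpI)
    fix x y z :: "'a \<times> rat \<Rightarrow>\<^sub>0 int"
    assume "x - y \<in> bilinear_relations" "y - z \<in> bilinear_relations"
    from bilinear_relations_add[OF this] show "x - z \<in> bilinear_relations"
      by simp
  qed
qed

instantiation rat_tensor :: (ab_group_add) ab_group_add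
begin

lift_definition zero_rat_tensor :: "'a rat_tensor" is 0 .

lift_definition plus_rat_tensor :: "'a rat_tensor \<Rightarrow> 'a rat_tensor \<Rightarrow> 'a rat_tensor" is "(+)"
  by (simp only: add_diff_add bilinear_relations_add)

lift_definition uminus_rat_tensor :: "'a rat_tensor \<Rightarrow> 'a rat_tensor" is uminus
  by (simp only: minus_diff_minus bilinear_relations_uminus)

definition minus_rat_tensor :: "'a rat_tensor \<Rightarrow> 'a rat_tensor \<Rightarrow> 'a rat_tensor"
  where "minus_rat_tensor x y = x + - y"

instance
proof
  fix x y z :: "'a rat_tensor"
  show "x + y + z = x + (y + z)"
    by transfer (simp add: ac_simps bilinear_relations.zero)
  show "x + y = y + x"
    by transfer (simp add: ac_simps bilinear_relations.zero)
  show "0 + x = x"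
    by transfer (simp add: bilinear_relations.zero)
  show "- x + x = 0"
    by transfer (simp add: bilinear_relations.zero)
  show "x - y = x + - y"
    by (rule minus_rat_tensor_def)
qed

end

lift_definition rat_tensor_scale :: "rat \<Rightarrow> 'a :: ab_group_add rat_tensor \<Rightarrow> 'a rat_tensor"
  is "\<lambda>q. frag_extend (\<lambda>(a, r). frag_of (a, q * r))"
proof -
  fix q :: rat and x y :: "'a \<times> rat \<Rightarrow>\<^sub>0 int"
  let ?f = "frag_extend (\<lambda>(a :: 'a, r). frag_of (a, q * r))"
  have "?f z \<in> bilinear_relations" if "z \<in> bilinear_relations" for z
    using that
  proof induction
    case zero
    show ?case by (simp add: bilinear_relations.zero)
  next
    case (diff x y)
    then show ?case by (simp add: frag_extend_diff bilinear_relations.diff)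
  next
    case (left a b r)
    show ?case
      using bilinear_relations.left[of a b "q * r"] by (simp add: frag_extend_diff)
  next
    case (right a r r')
    show ?case
      using bilinear_relations.right[of a "q * r" "q * r'"]
      by (simp add: frag_extend_diff distrib_left)
  qed
  moreover assume "x - y \<in> bilinear_relations"
  ultimately show "?f x - ?f y \<in> bilinear_relations"
    by (metis frag_extend_diff)
qed

lemma frag_all_induct [case_names zero one diff]:
  fixes c :: "'b \<Rightarrow>\<^sub>0 int"
  assumes "P 0" "\<And>x. P (frag_of x)" "\<And>a b. P a \<Longrightarrow> P b \<Longrightarrow> P (a - b)"
  shows "P c"
  by (rule frag_induction[of c UNIV]) (use assms in auto)

interpretation rat_tensor: vector_space "rat_tensor_scale :: rat \<Rightarrow> 'a :: ab_group_add rat_tensor \<Rightarrow> _"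
proof
  fix p q :: rat and x y :: "'a rat_tensor"
  show "rat_tensor_scale p (x + y) = rat_tensor_scale p x + rat_tensor_scale p y"
    by transfer (simp add: frag_extend_add bilinear_relations.zero)
  show "rat_tensor_scale (p + q) x = rat_tensor_scale p x + rat_tensor_scale q x"
  proof transfer
    fix p q :: rat and x :: "'a \<times> rat \<Rightarrow>\<^sub>0 int"
    let ?f = "\<lambda>q. frag_extend (\<lambda>(a :: 'a, r). frag_of (a, q * r))"
    show "?f (p + q) x - (?f p x + ?f q x) \<in> bilinear_relations"
    proof (induction x rule: frag_all_induct)
      case zero
      then show ?case by (simp add: bilinear_relations.zero)
    next
      case (one x)
      obtain a r where "x = (a, r)" by (cases x)
      then show ?case
        using bilinear_relations.right[of a "p * r" "q * r"]
        by (simp add: distrib_right diff_diff_eq)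
    next
      case (diff a b)
      have "?f (p + q) (a - b) - (?f p (a - b) + ?f q (a - b)) =
          (?f (p + q) a - (?f p a + ?f q a)) - (?f (p + q) b - (?f p b + ?f q b))"
        by (simp add: frag_extend_diff)
      then show ?case
        using bilinear_relations.diff[OF diff] by (simp only:)
    qed
  qed
  show "rat_tensor_scale p (rat_tensor_scale q x) = rat_tensor_scale (p * q) x"
  proof transfer
    fix p q :: rat and x :: "'a \<times> rat \<Rightarrow>\<^sub>0 int"
    let ?f = "\<lambda>q. frag_extend (\<lambda>(a :: 'a, r). frag_of (a, q * r))"
    have "?f p (?f q x) = ?f (p * q) x"
      by (induction x rule: frag_all_induct)
        (auto simp: frag_extend_diff mult.assoc)
    then show "?f p (?f q x) - ?f (p * q) x \<in> bilinear_relations"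
      by (simp add: bilinear_relations.zero)
  qed
  show "rat_tensor_scale 1 x = x"
  proof transfer
    fix x :: "'a \<times> rat \<Rightarrow>\<^sub>0 int"
    have "frag_extend (\<lambda>(a :: 'a, r). frag_of (a, 1 * r)) x = x"
      by (induction x rule: frag_all_induct)
        (auto simp: frag_extend_diff)
    then show "frag_extend (\<lambda>(a :: 'a, r). frag_of (a, 1 * r)) x - x \<in> bilinear_relations"
      by (simp add: bilinear_relations.zero)
  qed
qed

definition group_rank :: "'a :: ab_group_add itself \<Rightarrow> nat"
  where "group_rank _ = vector_space.dim rat_tensor_scale (UNIV :: 'a rat_tensor set)"


section \<open>Semigroups, systems of generators and Cayley graphs\<close>

definition is_identity :: "'g :: ab_semigroup_add \<Rightarrow> bool"
  where "is_identity e \<longleftrightarrow> (\<forall>x. e + x = x)"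

fun option_add :: "'g :: ab_semigroup_add option \<Rightarrow> 'g option \<Rightarrow> 'g option" where
  "option_add None y = y"
| "option_add x None = x"
| "option_add (Some a) (Some b) = Some (a + b)"

definition adjoin_identity :: "'g :: ab_semigroup_add option monoid"
  where "adjoin_identity = \<lparr>carrier = UNIV, mult = option_add, one = None\<rparr>"

definition monoid_of_identity :: "'g :: ab_semigroup_add \<Rightarrow> 'g monoid"
  where "monoid_of_identity e = \<lparr>carrier = UNIV, mult = (+), one = e\<rparr>"

text \<open>
  The monoid \<open>G\<^sup>1\<close>, written with \<open>'g option\<close> in both cases; \<open>None\<close> belongs to the carrier only
  if the semigroup has no identity of its own.
\<close>

definition semigroup1 :: "'g :: ab_semigroup_add option monoid" where
  "semigroup1 =
    (if \<exists>e :: 'g. is_identity e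
     then \<lparr>carrier = range Some, mult = option_add, one = Some (THE e. is_identity e)\<rparr>
     else adjoin_identity)"

text \<open>
  A path of the Cayley graph starting at the identity is represented by the list of its edge
  marks. Marks are indices of the family of generators, so that repeated generators give
  different edges.
\<close>

definition path_end :: "('m, 'b) monoid_scheme \<Rightarrow> ('i \<Rightarrow> 'm) \<Rightarrow> 'i list \<Rightarrow> 'm"
  where "path_end M s w = foldl (\<lambda>v i. v \<otimes>\<^bsub>M\<^esub> s i) \<one>\<^bsub>M\<^esub> w"

definition paths_to :: "('m, 'b) monoid_scheme \<Rightarrow> 'i set \<Rightarrow> ('i \<Rightarrow> 'm) \<Rightarrow> 'm \<Rightarrow> 'i list set"
  where "paths_to M I s v = {w \<in> lists I. path_end M s w = v}"

text \<open>
  The empty word is allowed below, which expresses that the identity need not be a sum of a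
  nonempty sequence of generators.
\<close>

definition generating_system :: "('m, 'b) monoid_scheme \<Rightarrow> 'i set \<Rightarrow> ('i \<Rightarrow> 'm) \<Rightarrow> bool" where
  "generating_system M I s \<longleftrightarrow>
     finite I \<and> I \<noteq> {} \<and> s ` I \<subseteq> carrier M \<and> (\<forall>v\<in>carrier M. \<exists>w\<in>lists I. path_end M s w = v)"

definition branching_cayley_graph :: "('m, 'b) monoid_scheme \<Rightarrow> 'i set \<Rightarrow> ('i \<Rightarrow> 'm) \<Rightarrow> bool" where
  "branching_cayley_graph M I s \<longleftrightarrow>
     (\<forall>v\<in>carrier M. paths_to M I s v \<noteq> {} \<and>
        (\<forall>w\<in>paths_to M I s v. \<forall>w'\<in>paths_to M I s v. length w = length w'))"

text \<open>Every finite family can be reindexed by natural numbers.\<close>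

definition branching_monoid :: "('m, 'b) monoid_scheme \<Rightarrow> bool" where
  "branching_monoid M \<longleftrightarrow>
     monoid M \<and>
     (\<exists>(J :: nat set) t. generating_system M J t \<and> branching_cayley_graph M J t)"

text \<open>
  If \<open>G\<close> arises from a monoid by removing the identity, then that monoid is, up to
  isomorphism, \<open>G\<close> with a new identity adjoined; this is the second alternative.
\<close>

definition branching_semigroup :: "'g :: ab_semigroup_add itself \<Rightarrow> bool" where
  "branching_semigroup _ \<longleftrightarrow>
     (\<exists>e :: 'g. is_identity e \<and> branching_monoid (monoid_of_identity e)) \<or>
     branching_monoid (adjoin_identity :: 'g option monoid)"

definition irreducible_element :: "'g :: ab_semigroup_add \<Rightarrow> bool" where
  "irreducible_element x \<longleftrightarrow>
     \<not> is_identity x \<and> \<not> (\<exists>a b. \<not> is_identity a \<and> \<not> is_identity b \<and> x = a + b)"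

definition semigroup_generators :: "'i set \<Rightarrow> ('i \<Rightarrow> 'g :: ab_semigroup_add) \<Rightarrow> bool"
  where "semigroup_generators I s \<longleftrightarrow> generating_system semigroup1 I (Some \<circ> s)"

definition admissible_generators :: "'i set \<Rightarrow> ('i \<Rightarrow> 'g :: ab_semigroup_add) \<Rightarrow> bool"
  where "admissible_generators I s \<longleftrightarrow> s ` I = {x. irreducible_element x}"


section \<open>Borel probability measures and the weak topology\<close>

definition borel_probability_measures :: "'a topology \<Rightarrow> 'a measure set" where
  "borel_probability_measures X =
     {M. prob_space M \<and> space M = topspace X \<and> sets M = sigma_sets (topspace X) {U. openin X U}}"

text \<open>The coarsest topology making the integrals of bounded continuous functions continuous.\<close>

definition weak_topology :: "'a topology \<Rightarrow> 'a measure topology" where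
  "weak_topology X = topology_generated_by
     {{M \<in> borel_probability_measures X. (\<integral>x. f x \<partial>M) \<in> U} | (f :: 'a \<Rightarrow> real) U.
        continuous_map X euclideanreal f \<and> bounded (f ` topspace X) \<and> open U}"


section \<open>The absolute\<close>

definition path_space :: "'i set \<Rightarrow> (nat \<Rightarrow> 'i) topology"
  where "path_space I = product_topology (\<lambda>_. discrete_topology I) UNIV"

definition cylinder :: "'i set \<Rightarrow> 'i list \<Rightarrow> (nat \<Rightarrow> 'i) set"
  where "cylinder I w = {x \<in> topspace (path_space I). \<forall>k<length w. x k = w ! k}"

definition central_measures ::
    "'i set \<Rightarrow> ('i \<Rightarrow> 'g :: ab_semigroup_add) \<Rightarrow> (nat \<Rightarrow> 'i) measure set" where
  "central_measures I s =
     {\<nu> \<in> borel_probability_measures (path_space I).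
        \<forall>v\<in>carrier semigroup1. \<forall>n>0.
          \<forall>w\<in>paths_to semigroup1 I (Some \<circ> s) v. \<forall>w'\<in>paths_to semigroup1 I (Some \<circ> s) v.
            length w = n \<and> length w' = n \<longrightarrow>
              measure \<nu> (cylinder I w) = measure \<nu> (cylinder I w')}"

text \<open>
  The ergodic measures are the extreme points of the set of central measures. Since measures
  do not form a real vector space as a type, convex combinations are taken setwise.
\<close>

definition absolute :: "'i set \<Rightarrow> ('i \<Rightarrow> 'g :: ab_semigroup_add) \<Rightarrow> (nat \<Rightarrow> 'i) measure set" where
  "absolute I s =
     {\<nu> \<in> central_measures I s.
        \<forall>\<mu>\<^sub>1\<in>central_measures I s. \<forall>\<mu>\<^sub>2\<in>central_measures I s. \<forall>t. 0 < t \<and> t < 1 \<and>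
          (\<forall>A\<in>sets \<nu>. measure \<nu> A = t * measure \<mu>\<^sub>1 A + (1 - t) * measure \<mu>\<^sub>2 A) \<longrightarrow> \<mu>\<^sub>1 = \<mu>\<^sub>2}"

definition absolute_topology ::
    "'i set \<Rightarrow> ('i \<Rightarrow> 'g :: ab_semigroup_add) \<Rightarrow> (nat \<Rightarrow> 'i) measure topology"
  where "absolute_topology I s = subtopology (weak_topology (path_space I)) (absolute I s)"

definition absolute_main_part :: "'i set \<Rightarrow> ('i \<Rightarrow> 'g :: ab_semigroup_add) \<Rightarrow> (nat \<Rightarrow> 'i) measure set"
  where "absolute_main_part I s = {\<nu> \<in> absolute I s. \<forall>w\<in>lists I. measure \<nu> (cylinder I w) \<noteq> 0}"


section \<open>Disks\<close>

definition closed_disk :: "nat \<Rightarrow> (nat \<Rightarrow> real) set"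
  where "closed_disk n = {x \<in> topspace (Euclidean_space n). (\<Sum>i<n. (x i)\<^sup>2) \<le> 1}"

text \<open>The interior is taken in the \<open>n\<close>-dimensional space; for \<open>n = 0\<close> it is the whole point.\<close>

definition disk_interior :: "nat \<Rightarrow> (nat \<Rightarrow> real) set"
  where "disk_interior n = Euclidean_space n interior_of closed_disk n"

end

theory Submission
  imports
    Defs
    "HOL-Real_Asymp.Real_Asymp"
begin

text \<open>
  Commutativity makes a central measure \<open>\<nu>\<close> exchangeable, hence shift invariant, and the law of the
  path after its first edge, conditioned on that edge, is again central. So if \<open>\<nu>\<close> is ergodic, these
  conditional laws all equal \<open>\<nu>\<close>, and \<open>\<nu>\<close> is the Bernoulli measure of a point \<open>p\<close> of the simplex that
  satisfies the binomial equations coming from the relations between sums of equal length.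
  Conversely such a Bernoulli measure is ergodic: the density on cylinders of a central measure
  dominated by it is a bounded harmonic function, hence constant.

  These points \<open>p\<close> form the nonnegative part of a toric variety. Modulo the real span of the
  homogeneous relations every fibre of the simplex contains exactly one of them, namely the point
  of maximal entropy; thus the linear projection (the moment map) is a homeomorphism onto a
  convex polytope, and the positive points correspond to its interior. The dimension of the
  polytope is that of the span of the differences \<open>s i - s j\<close> in the rationalized group of
  fractions. This is the rank, or one less if some linear functional is \<open>1\<close> on all generators, i.e.
  if the length of a sum of generators is determined by its value.
\<close>

section \<open>Convex bodies and disks\<close>

text \<open>The binomial equations are indexed by integer vectors, whereas two points of a fibre
  differ by a real vector in the same rationally defined subspace. Uniqueness requires testing
  \<open>ln p\<close> against that real difference, and on the boundary of the simplex
  \<open>ln p\<close> does not exist. Diophantine approximation closes both gaps: some multiple of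
  the difference is close to an integer vector that satisfies the linear equations exactly. This
  shows that a solution has the largest support in its fibre, and that \<open>ln p\<close> is
  orthogonal to the difference. Existence meets the same boundary problem, and there the entropy is
  differentiated at a perturbed point instead of at the maximum. Torsion in the group of fractions
  does no harm: a relation that holds after tensoring with the rationals holds in the group after
  multiplication by some \<open>N > 0\<close>, and nonnegative reals have unique \<open>N\<close>-th
  roots.\<close>

lemma tendsto_componentwise:
  fixes f :: "'a \<Rightarrow> 'b \<Rightarrow> 'c :: topological_space"
  assumes "\<And>i. ((\<lambda>a. f a i) \<longlongrightarrow> l i) F"
  shows "(f \<longlongrightarrow> l) F"
proof -
  have "limitin (product_topology (\<lambda>_. euclidean) UNIV) f l F"
    unfolding limitin_componentwise using assms by simp
  then show ?thesis by (simp add: euclidean_product_topology)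
qed

lemma continuous_on_apply [continuous_intros]:
  fixes i :: 'a
  shows "continuous_on S (\<lambda>x :: 'a \<Rightarrow> 'b :: topological_space. x i)"
  by (rule continuous_on_subset[OF continuous_on_product_coordinates]) simp

text \<open>A point of norm 1 is not interior, since pushing it outwards along its ray leaves the
  disk at once. For \<open>d = 0\<close> the empty sum is 0 and the whole point survives.\<close>

lemma disk_interior_eq:
  "disk_interior d = {x \<in> topspace (Euclidean_space d). (\<Sum>i<d. (x i)\<^sup>2) < 1}"
proof
  show "disk_interior d \<subseteq> {x \<in> topspace (Euclidean_space d). (\<Sum>i<d. (x i)\<^sup>2) < 1}"
  proof
    fix x assume "x \<in> disk_interior d"
    then obtain U where U: "openin (Euclidean_space d) U" "x \<in> U" "U \<subseteq> closed_disk d"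
      by (auto simp: disk_interior_def interior_of_def)
    then have x: "\<forall>i\<ge>d. x i = 0" "(\<Sum>i<d. (x i)\<^sup>2) \<le> 1"
      by (auto simp: closed_disk_def topspace_Euclidean_space)
    have cm: "continuous_map euclideanreal (Euclidean_space d) (\<lambda>t i. if i < d then t * x i else 0)"
      unfolding continuous_map_componentwise_Euclidean_space
      by (auto intro!: continuous_intros)
    have "openin euclideanreal {t \<in> topspace euclideanreal. (\<lambda>i. if i < d then t * x i else 0) \<in> U}"
      using cm U(1) by (rule openin_continuous_map_preimage)
    then have "open {t. (\<lambda>i. if i < d then t * x i else 0) \<in> U}" by simp
    moreover have "(\<lambda>i. if i < d then 1 * x i else 0) = x"
      using x by (auto simp: fun_eq_iff not_less)
    then have "1 \<in> {t. (\<lambda>i. if i < d then t * x i else 0) \<in> U}" using U by simp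
    ultimately obtain e where e: "e > 0"
      "\<And>t. \<bar>t - 1\<bar> < e \<Longrightarrow> (\<lambda>i. if i < d then t * x i else 0) \<in> U"
      unfolding open_dist dist_real_def by auto
    then have "(\<lambda>i. if i < d then (1 + e/2) * x i else 0) \<in> U" by auto
    then have "(\<Sum>i<d. ((1 + e/2) * x i)\<^sup>2) \<le> 1"
      using U(3) by (auto simp: closed_disk_def)
    then have *: "(1 + e/2)\<^sup>2 * (\<Sum>i<d. (x i)\<^sup>2) \<le> 1"
      by (simp add: power_mult_distrib sum_distrib_left)
    have "(1 + e/2)\<^sup>2 > 1"
      using e(1) by (simp add: one_less_power)
    with * have "(\<Sum>i<d. (x i)\<^sup>2) \<noteq> 1" by auto
    with x show "x \<in> {x \<in> topspace (Euclidean_space d). (\<Sum>i<d. (x i)\<^sup>2) < 1}"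
      by (auto simp: topspace_Euclidean_space)
  qed
  have cm: "continuous_map (Euclidean_space d) euclideanreal (\<lambda>x. (\<Sum>i<d. (x i)\<^sup>2))"
    unfolding Euclidean_space_def euclidean_product_topology
    by (auto intro!: continuous_intros continuous_on_product_coordinates)
  have "openin (Euclidean_space d)
      {x \<in> topspace (Euclidean_space d). (\<Sum>i<d. (x i)\<^sup>2) \<in> {..<1}}"
    using cm by (rule openin_continuous_map_preimage) auto
  then show "{x \<in> topspace (Euclidean_space d). (\<Sum>i<d. (x i)\<^sup>2) < 1} \<subseteq> disk_interior d"
    unfolding disk_interior_def
    by (intro interior_of_maximal) (auto simp: closed_disk_def)
qed

text \<open>\<open>\<epsilon>\<close> and \<open>R\<close> are an inner and an outer radius: the
  origin is an interior point of \<open>C\<close> in \<open>d\<close>-dimensional space. The value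
  \<open>d = 0\<close> is allowed, for the absolute may be a single point.\<close>

locale convex_body =
  fixes d :: nat and C :: "(nat \<Rightarrow> real) set" and \<epsilon> R :: real
  assumes zero_above: "x \<in> C \<Longrightarrow> d \<le> i \<Longrightarrow> x i = 0"
    and convex: "x \<in> C \<Longrightarrow> y \<in> C \<Longrightarrow> 0 \<le> t \<Longrightarrow> t \<le> 1 \<Longrightarrow> (\<lambda>i. (1 - t) * x i + t * y i) \<in> C"
    and closed: "closed C"
    and R_pos: "0 < R" and bounded: "x \<in> C \<Longrightarrow> L2_set x {..<d} \<le> R"
    and \<epsilon>_pos: "0 < \<epsilon>"
    and ball: "(\<And>i. d \<le> i \<Longrightarrow> x i = 0) \<Longrightarrow> L2_set x {..<d} \<le> \<epsilon> \<Longrightarrow> x \<in> C"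
begin

section \<open>The Minkowski functional of a convex body\<close>

definition ambient :: "(nat \<Rightarrow> real) set"
  where "ambient = {x. \<forall>i\<ge>d. x i = 0}"

lemma ambient_closure [simp]:
  "(\<lambda>_. 0) \<in> ambient" "x \<in> ambient \<Longrightarrow> (\<lambda>i. c * x i) \<in> ambient" "x \<in> ambient \<Longrightarrow> (\<lambda>i. x i / c) \<in> ambient"
  "x \<in> ambient \<Longrightarrow> y \<in> ambient \<Longrightarrow> (\<lambda>i. x i + y i) \<in> ambient" "x \<in> ambient \<Longrightarrow> y \<in> ambient \<Longrightarrow> (\<lambda>i. x i - y i) \<in> ambient"
  by (auto simp: ambient_def)

lemma C_subset: "x \<in> C \<Longrightarrow> x \<in> ambient"
  using zero_above by (auto simp: ambient_def)

lemma ball': "x \<in> ambient \<Longrightarrow> L2_set x {..<d} \<le> \<epsilon> \<Longrightarrow> x \<in> C"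
  using ball by (auto simp: ambient_def)

definition gauge :: "(nat \<Rightarrow> real) \<Rightarrow> real"
  where "gauge x = Inf {t. 0 < t \<and> (\<lambda>i. x i / t) \<in> C}"

lemma zero_mem: "(\<lambda>_. 0) \<in> C"
  using \<epsilon>_pos by (intro ball') (auto simp: L2_set_def)

lemma scale_mem: "x \<in> C \<Longrightarrow> 0 \<le> t \<Longrightarrow> t \<le> 1 \<Longrightarrow> (\<lambda>i. t * x i) \<in> C"
  using convex[OF zero_mem, of x t] by simp

lemma L2_set_divide: "t > 0 \<Longrightarrow> L2_set (\<lambda>i. x i / t) A = L2_set x A / t"
  using L2_set_left_distrib[of "inverse t" x A] by (simp add: divide_inverse)

lemma gauge_set_ball:
  assumes "x \<in> ambient" "L2_set x {..<d} / \<epsilon> \<le> t" "0 < t"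
  shows "(\<lambda>i. x i / t) \<in> C"
  using assms \<epsilon>_pos by (intro ball') (auto simp: L2_set_divide field_simps)

lemma gauge_bdd_below: "bdd_below {t. 0 < t \<and> (\<lambda>i. x i / t) \<in> C}"
  by (rule bdd_belowI[of _ 0]) auto

lemma gauge_set_nonempty:
  assumes "x \<in> ambient"
  shows "{t. 0 < t \<and> (\<lambda>i. x i / t) \<in> C} \<noteq> {}"
proof -
  have "0 < L2_set x {..<d} / \<epsilon> + 1"
    using \<epsilon>_pos by (intro add_nonneg_pos) auto
  then have "L2_set x {..<d} / \<epsilon> + 1 \<in> {t. 0 < t \<and> (\<lambda>i. x i / t) \<in> C}"
    using gauge_set_ball[of x "L2_set x {..<d} / \<epsilon> + 1"] assms by auto
  then show ?thesis by blast
qed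

lemma gauge_le: "0 < t \<Longrightarrow> (\<lambda>i. x i / t) \<in> C \<Longrightarrow> gauge x \<le> t"
  unfolding gauge_def by (rule cInf_lower[OF _ gauge_bdd_below]) auto

lemma gauge_nonneg:
  assumes "x \<in> ambient"
  shows "0 \<le> gauge x"
  unfolding gauge_def using gauge_set_nonempty[OF assms] by (intro cInf_greatest) auto

lemma mem_of_gauge_less:
  assumes "x \<in> ambient" "gauge x < t"
  shows "(\<lambda>i. x i / t) \<in> C"
proof -
  obtain u where u: "0 < u" "(\<lambda>i. x i / u) \<in> C" "u < t"
    using assms(2) unfolding gauge_def
    by (subst (asm) cInf_less_iff[OF gauge_set_nonempty[OF assms(1)] gauge_bdd_below]) auto
  have "(\<lambda>i. u / t * (x i / u)) \<in> C"
    using u by (intro scale_mem) auto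
  then show ?thesis using u by simp
qed

text \<open>Closedness of \<open>C\<close> settles the boundary case: \<open>x / t\<close> is the
  limit of the points \<open>x / (t + 1 / Suc n)\<close>, which lie in \<open>C\<close>.\<close>

lemma gauge_le_iff:
  assumes "x \<in> ambient" "0 < t"
  shows "gauge x \<le> t \<longleftrightarrow> (\<lambda>i. x i / t) \<in> C"
proof
  assume le: "gauge x \<le> t"
  have "(\<lambda>n. t + 1 / real (Suc n)) \<longlonglongrightarrow> t + 0"
    by (intro tendsto_intros LIMSEQ_Suc[OF lim_1_over_n])
  then have lim: "(\<lambda>n i. x i / (t + 1 / real (Suc n))) \<longlonglongrightarrow> (\<lambda>i. x i / t)"
    using assms(2) by (intro tendsto_componentwise tendsto_divide tendsto_const) auto
  have "(\<lambda>i. x i / (t + 1 / real (Suc n))) \<in> C" for n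
  proof -
    have "0 < 1 / real (Suc n)" by simp
    then have "gauge x < t + 1 / real (Suc n)" using le by linarith
    then show ?thesis by (rule mem_of_gauge_less[OF assms(1)])
  qed
  from closed_sequentially[OF closed this lim] show "(\<lambda>i. x i / t) \<in> C" .
qed (use assms in \<open>auto intro: gauge_le\<close>)

lemma gauge_le_L2:
  assumes "x \<in> ambient"
  shows "gauge x \<le> L2_set x {..<d} / \<epsilon>"
proof (rule field_le_epsilon)
  fix e :: real assume "e > 0"
  then show "gauge x \<le> L2_set x {..<d} / \<epsilon> + e"
    using \<epsilon>_pos by (intro gauge_le gauge_set_ball assms) (auto intro!: add_nonneg_pos)
qed

lemma L2_le_gauge:
  assumes "x \<in> ambient"
  shows "L2_set x {..<d} \<le> R * gauge x"
proof (rule field_le_epsilon)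
  fix e :: real assume e: "e > 0"
  define t where "t = gauge x + e / R"
  have t: "t > gauge x" "t > 0"
    using e R_pos gauge_nonneg[of x] assms by (auto simp: t_def intro!: add_nonneg_pos)
  have "L2_set (\<lambda>i. x i / t) {..<d} \<le> R"
    using t assms by (intro bounded mem_of_gauge_less)
  then show "L2_set x {..<d} \<le> R * gauge x + e"
    using t R_pos by (simp add: L2_set_divide divide_le_eq) (simp add: t_def distrib_left)
qed

lemma L2_eq_0:
  assumes "x \<in> ambient" "L2_set x {..<d} = 0"
  shows "x = (\<lambda>_. 0)"
proof
  fix i show "x i = 0"
    using assms by (cases "i < d") (auto simp: L2_set_eq_0_iff ambient_def)
qed

lemma gauge_pos:
  assumes "x \<in> ambient" "x \<noteq> (\<lambda>_. 0)"
  shows "0 < gauge x" "0 < L2_set x {..<d}"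
proof -
  show "0 < L2_set x {..<d}"
    using L2_eq_0[of x] assms L2_set_nonneg[of x "{..<d}"] by (auto simp: less_le)
  moreover have "L2_set x {..<d} \<le> R * gauge x"
    using assms(1) by (rule L2_le_gauge)
  moreover have "0 \<le> gauge x"
    using assms(1) by (rule gauge_nonneg)
  ultimately show "0 < gauge x"
    by (cases "gauge x = 0") auto
qed

lemma gauge_scale_le:
  assumes "x \<in> ambient" "0 < c"
  shows "gauge (\<lambda>i. c * x i) \<le> c * gauge x"
proof (rule field_le_epsilon)
  fix e :: real assume e: "e > 0"
  define t where "t = gauge x + e / c"
  have t: "t > gauge x" "t > 0"
    using e assms(2) gauge_nonneg[of x] assms by (auto simp: t_def intro!: add_nonneg_pos)
  have "gauge (\<lambda>i. c * x i) \<le> c * t"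
    using t assms(2) mem_of_gauge_less[OF assms(1) t(1)] by (intro gauge_le) auto
  also have "c * t = c * gauge x + e"
    using assms(2) by (simp add: t_def field_simps)
  finally show "gauge (\<lambda>i. c * x i) \<le> c * gauge x + e" .
qed

lemma gauge_scale:
  assumes "x \<in> ambient" "0 < c"
  shows "gauge (\<lambda>i. c * x i) = c * gauge x"
proof (rule antisym)
  show "gauge (\<lambda>i. c * x i) \<le> c * gauge x" by (rule gauge_scale_le) fact+
  have "gauge (\<lambda>i. inverse c * (c * x i)) \<le> inverse c * gauge (\<lambda>i. c * x i)"
    using assms by (intro gauge_scale_le) auto
  moreover have "(\<lambda>i. inverse c * (c * x i)) = x"
    using assms(2) by auto
  ultimately have "gauge x \<le> inverse c * gauge (\<lambda>i. c * x i)" by simp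
  then show "c * gauge x \<le> gauge (\<lambda>i. c * x i)"
    using assms(2) by (simp add: field_simps)
qed

lemma gauge_triangle:
  assumes x: "x \<in> ambient" and y: "y \<in> ambient"
  shows "gauge (\<lambda>i. x i + y i) \<le> gauge x + gauge y"
proof (rule field_le_epsilon)
  fix e :: real assume e: "e > 0"
  define t u where "t = gauge x + e / 2" and "u = gauge y + e / 2"
  have t: "t > gauge x" "t > 0" and u: "u > gauge y" "u > 0"
    using e gauge_nonneg[of x] gauge_nonneg[of y] x y by (auto simp: t_def u_def add_nonneg_pos)
  \<comment> \<open>The weights are \<open>t / (t + u)\<close> and \<open>u / (t + u)\<close>,
    chosen so that the combination of \<open>x / t\<close> and \<open>y / u\<close> is
    \<open>(x + y) / (t + u)\<close>.\<close>
  have "(\<lambda>i. (1 - u / (t + u)) * (x i / t) + u / (t + u) * (y i / u)) \<in> C"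
    using t u by (intro convex mem_of_gauge_less x y) auto
  also have "(\<lambda>i. (1 - u / (t + u)) * (x i / t) + u / (t + u) * (y i / u)) =
      (\<lambda>i. (x i + y i) / (t + u))"
  proof
    fix i
    have "1 - u / (t + u) = t / (t + u)" using t u by (simp add: field_simps)
    then show "(1 - u / (t + u)) * (x i / t) + u / (t + u) * (y i / u) = (x i + y i) / (t + u)"
      using t u by (simp add: add_divide_distrib)
  qed
  finally have "gauge (\<lambda>i. x i + y i) \<le> t + u"
    using t u by (intro gauge_le) auto
  then show "gauge (\<lambda>i. x i + y i) \<le> gauge x + gauge y + e"
    by (simp add: t_def u_def)
qed

lemma gauge_diff_le:
  assumes x: "x \<in> ambient" and y: "y \<in> ambient"
  shows "\<bar>gauge x - gauge y\<bar> \<le> L2_set (\<lambda>i. x i - y i) {..<d} / \<epsilon>"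
proof -
  have *: "gauge x - gauge y \<le> L2_set (\<lambda>i. x i - y i) {..<d} / \<epsilon>"
    if "x \<in> ambient" "y \<in> ambient" for x y
    using gauge_triangle[of "\<lambda>i. x i - y i" y] gauge_le_L2[of "\<lambda>i. x i - y i"] that by simp
  have "L2_set (\<lambda>i. x i - y i) {..<d} = L2_set (\<lambda>i. y i - x i) {..<d}"
    by (simp add: L2_set_def power2_commute)
  then show ?thesis
    using *[OF x y] *[OF y x] by (simp add: abs_le_iff)
qed

lemma continuous_on_L2 [continuous_intros]: "continuous_on S (\<lambda>x. L2_set x {..<d})"
  unfolding L2_set_def by (intro continuous_intros)

lemma continuous_on_gauge: "continuous_on ambient gauge"
  unfolding continuous_on_def
proof
  fix x :: "nat \<Rightarrow> real" assume x: "x \<in> ambient"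
  have "continuous_on ambient (\<lambda>y. L2_set (\<lambda>i. y i - x i) {..<d} / \<epsilon>)"
    unfolding L2_set_def using \<epsilon>_pos by (intro continuous_intros) auto
  then have "((\<lambda>y. L2_set (\<lambda>i. y i - x i) {..<d} / \<epsilon>) \<longlongrightarrow> L2_set (\<lambda>i. x i - x i) {..<d} / \<epsilon>)
      (at x within ambient)"
    using x unfolding continuous_on_def by blast
  then have "((\<lambda>y. L2_set (\<lambda>i. y i - x i) {..<d} / \<epsilon>) \<longlongrightarrow> 0) (at x within ambient)"
    by (simp add: L2_set_def)
  then have "((\<lambda>y. gauge y - gauge x) \<longlongrightarrow> 0) (at x within ambient)"
    by (rule Lim_null_comparison[rotated])
      (use x in \<open>auto simp: eventually_at_filter intro!: always_eventually gauge_diff_le\<close>)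
  then show "(gauge \<longlongrightarrow> gauge x) (at x within ambient)"
    by (simp add: LIM_zero_iff)
qed

text \<open>Stretches every ray until the gauge of \<open>C\<close> becomes the Euclidean norm, so
  that \<open>C\<close> goes to the unit disk. At the origin, division by 0 gives 0, which is the
  right value.\<close>

definition radial :: "(nat \<Rightarrow> real) \<Rightarrow> nat \<Rightarrow> real"
  where "radial x = (\<lambda>i. gauge x / L2_set x {..<d} * x i)"

lemma radial_ambient: "x \<in> ambient \<Longrightarrow> radial x \<in> ambient"
  by (simp add: radial_def)

lemma gauge_zero: "gauge (\<lambda>_. 0) = 0"
  using gauge_le_L2[of "\<lambda>_. 0"] gauge_nonneg[of "\<lambda>_. 0"] by (simp add: L2_set_def)

lemma L2_scale: "0 \<le> c \<Longrightarrow> L2_set (\<lambda>i. c * x i) A = c * L2_set x A"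
  using L2_set_right_distrib[of c x A] by simp

lemma L2_radial:
  assumes "x \<in> ambient"
  shows "L2_set (radial x) {..<d} = gauge x"
proof (cases "x = (\<lambda>_. 0)")
  case True
  then show ?thesis by (simp add: radial_def gauge_zero) (simp add: L2_set_def)
next
  case False
  then show ?thesis
    using gauge_pos[OF assms False] unfolding radial_def by (subst L2_scale) auto
qed

lemma radial_inverse:
  assumes "x \<in> ambient"
  shows "(\<lambda>i. L2_set (radial x) {..<d} / gauge (radial x) * radial x i) = x"
proof (cases "x = (\<lambda>_. 0)")
  case True
  then show ?thesis by (simp add: radial_def)
next
  case False
  have "gauge (radial x) = gauge x / L2_set x {..<d} * gauge x"
    unfolding radial_def using gauge_pos[OF assms False] by (intro gauge_scale assms) auto
  then show ?thesis
    using gauge_pos[OF assms False] by (simp add: L2_radial[OF assms]) (simp add: radial_def)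
qed

lemma radial_onto:
  assumes "y \<in> ambient"
  obtains x where "radial x = y" "gauge x = L2_set y {..<d}" "x \<in> ambient"
proof (cases "y = (\<lambda>_. 0)")
  case True
  then show ?thesis
    by (intro that[of "\<lambda>_. 0"]) (auto simp: radial_def gauge_zero L2_set_def)
next
  case False
  define x where "x = (\<lambda>i. L2_set y {..<d} / gauge y * y i)"
  note pos = gauge_pos[OF assms False]
  have m: "gauge x = L2_set y {..<d}"
    unfolding x_def using pos by (subst gauge_scale[OF assms]) auto
  have l: "L2_set x {..<d} = L2_set y {..<d} / gauge y * L2_set y {..<d}"
    unfolding x_def using pos by (subst L2_scale) auto
  have "radial x = y"
    using pos by (simp add: radial_def m l) (simp add: x_def)
  with m assms show ?thesis by (intro that[of x]) (auto simp: x_def)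
qed

lemma mem_iff_gauge:
  assumes "x \<in> ambient"
  shows "x \<in> C \<longleftrightarrow> gauge x \<le> 1"
  using gauge_le_iff[OF assms, of 1] by simp

lemma L2_le_1_iff: "L2_set x {..<d} \<le> 1 \<longleftrightarrow> (\<Sum>i<d. (x i)\<^sup>2) \<le> 1"
  and L2_less_1_iff: "L2_set x {..<d} < 1 \<longleftrightarrow> (\<Sum>i<d. (x i)\<^sup>2) < 1"
  by (simp_all add: L2_set_def)

text \<open>Only the origin is delicate, where the quotient of gauge and norm need not converge.
  There the coordinates of \<open>radial y\<close> are bounded by its norm \<open>gauge y\<close>,
  which tends to 0.\<close>

lemma continuous_on_radial: "continuous_on C radial"
proof (rule continuous_on_coordinatewise_then_product)
  fix i
  have C: "C \<subseteq> ambient" using C_subset by auto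
  have mC: "continuous_on C gauge"
    by (rule continuous_on_subset[OF continuous_on_gauge C])
  show "continuous_on C (\<lambda>x. radial x i)"
    unfolding continuous_on_def
  proof
    fix x assume x: "x \<in> C"
    note x0 = C_subset[OF x]
    have m: "(gauge \<longlongrightarrow> gauge x) (at x within C)"
      using mC x unfolding continuous_on_def by blast
    have l: "((\<lambda>x. L2_set x {..<d}) \<longlongrightarrow> L2_set x {..<d}) (at x within C)"
      using continuous_on_L2[of C] x unfolding continuous_on_def by blast
    have c: "((\<lambda>x. x i) \<longlongrightarrow> x i) (at x within C)"
      using continuous_on_apply[of C i] x unfolding continuous_on_def by blast
    show "((\<lambda>x. radial x i) \<longlongrightarrow> radial x i) (at x within C)"
    proof (cases "x = (\<lambda>_. 0)")
      case False
      then have "L2_set x {..<d} \<noteq> 0" using gauge_pos[OF x0 False] by simp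
      then show ?thesis
        unfolding radial_def by (intro tendsto_intros m l c)
    next
      case True
      have "norm (radial y i) \<le> gauge y" if "y \<in> C" for y
      proof (cases "i < d")
        case True
        have "\<bar>radial y i\<bar> \<le> L2_set (radial y) {..<d}"
          using member_le_L2_set[of "{..<d}" i "\<lambda>i. \<bar>radial y i\<bar>"] True
          by (simp add: L2_set_def)
        then show ?thesis using L2_radial[of y] C_subset[OF that] by simp
      next
        case False
        then show ?thesis
          using radial_ambient[of y] C_subset[OF that] gauge_nonneg[of y] by (simp add: ambient_def)
      qed
      then have "\<forall>\<^sub>F y in at x within C. norm (radial y i) \<le> gauge y"
        by (auto simp: eventually_at_filter intro!: always_eventually)
      moreover have "(gauge \<longlongrightarrow> 0) (at x within C)"
        using m True by (simp add: gauge_zero)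
      ultimately have "((\<lambda>y. radial y i) \<longlongrightarrow> 0) (at x within C)"
        by (rule Lim_null_comparison)
      then show ?thesis using True by (simp add: radial_def)
    qed
  qed
qed

lemma inj_on_radial: "inj_on radial C"
proof (rule inj_onI)
  fix x y assume *: "x \<in> C" "y \<in> C" "radial x = radial y"
  show "x = y"
    using radial_inverse[OF C_subset[OF *(1)]] radial_inverse[OF C_subset[OF *(2)]]
    unfolding *(3) by (rule trans[OF sym])
qed

lemma radial_image: "radial ` C = closed_disk d"
proof
  show "radial ` C \<subseteq> closed_disk d"
  proof
    fix y assume "y \<in> radial ` C"
    then obtain x where x: "x \<in> C" "y = radial x" by blast
    have "L2_set y {..<d} \<le> 1"
      using x L2_radial[OF C_subset[OF x(1)]] mem_iff_gauge[OF C_subset[OF x(1)]] by simp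
    then show "y \<in> closed_disk d"
      using x radial_ambient[OF C_subset[OF x(1)]]
      by (auto simp: closed_disk_def topspace_Euclidean_space L2_le_1_iff ambient_def)
  qed
  show "closed_disk d \<subseteq> radial ` C"
  proof
    fix y assume "y \<in> closed_disk d"
    then have y: "y \<in> ambient" "L2_set y {..<d} \<le> 1"
      by (auto simp: closed_disk_def topspace_Euclidean_space L2_le_1_iff ambient_def)
    obtain x where "radial x = y" "gauge x = L2_set y {..<d}" "x \<in> ambient"
      using radial_onto[OF y(1)] .
    with y show "y \<in> radial ` C"
      using mem_iff_gauge[of x] by auto
  qed
qed

text \<open>Being interior is phrased as room for an enlargement \<open>x / t\<close> inside
  \<open>C\<close>; for a polytope given as an image, this can be tested on preimages without
  computing the gauge.\<close>

lemma radial_interior_iff: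
  assumes "x \<in> C"
  shows "radial x \<in> disk_interior d \<longleftrightarrow> (\<exists>t. 0 < t \<and> t < 1 \<and> (\<lambda>i. x i / t) \<in> C)"
proof -
  note x0 = C_subset[OF assms]
  have "radial x \<in> disk_interior d \<longleftrightarrow> gauge x < 1"
    using radial_ambient[OF x0] L2_radial[OF x0] L2_less_1_iff[of "radial x"]
    by (auto simp: disk_interior_eq topspace_Euclidean_space ambient_def)
  also have "\<dots> \<longleftrightarrow> (\<exists>t. 0 < t \<and> t < 1 \<and> (\<lambda>i. x i / t) \<in> C)"
  proof
    assume *: "gauge x < 1"
    with gauge_nonneg[OF x0] obtain t where "gauge x < t" "t < 1"
      using dense by blast
    with gauge_nonneg[OF x0] show "\<exists>t. 0 < t \<and> t < 1 \<and> (\<lambda>i. x i / t) \<in> C"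
      by (intro exI[of _ t] conjI mem_of_gauge_less x0) auto
  qed (use gauge_le in \<open>force\<close>)
  finally show ?thesis .
qed

end

section \<open>The nonnegative real part of a toric variety\<close>

text \<open>Fixing the values outside \<open>I\<close> makes a point of the simplex a single
  function, so that injectivity and compactness can be stated in the full function space.\<close>

definition prob_simplex :: "'i set \<Rightarrow> ('i \<Rightarrow> real) set"
  where "prob_simplex I = {p. (\<forall>i. i \<notin> I \<longrightarrow> p i = 0) \<and> (\<forall>i\<in>I. 0 \<le> p i) \<and> sum p I = 1}"

lemma compact_prob_simplex:
  assumes "finite I"
  shows "compact (prob_simplex I :: ('i \<Rightarrow> real) set)"
proof -
  have "compactin (product_topology (\<lambda>_ :: 'i. euclideanreal) UNIV) (PiE UNIV (\<lambda>_. {0..1}))"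
    by (subst compactin_PiE) auto
  then have K: "compact (PiE UNIV (\<lambda>_ :: 'i. {0..1 :: real}))"
    by (simp add: euclidean_product_topology)
  have "closed ({p :: 'i \<Rightarrow> real. sum p I = 1} \<inter> (\<Inter>i\<in>-I. {p. p i = 0}))"
    by (intro closed_Int closed_INT ballI closed_Collect_eq continuous_intros)
  then have "compact (PiE UNIV (\<lambda>_ :: 'i. {0..1 :: real}) \<inter>
      ({p. sum p I = 1} \<inter> (\<Inter>i\<in>-I. {p. p i = 0})))"
    by (rule compact_Int_closed[OF K])
  also have "\<dots> = prob_simplex I"
  proof -
    have "0 \<le> p i \<and> p i \<le> 1"
      if "\<forall>i\<in>I. 0 \<le> p i" "sum p I = 1" "\<forall>i. i \<notin> I \<longrightarrow> p i = 0" for p :: "'i \<Rightarrow> real" and i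
      using member_le_sum[of i I p] that assms by (cases "i \<in> I") auto
    then show ?thesis
      unfolding prob_simplex_def PiE_def by (auto simp: Pi_iff)
  qed
  finally show ?thesis .
qed

lemma prob_simplex_nonneg: "p \<in> prob_simplex I \<Longrightarrow> 0 \<le> p i"
  by (cases "i \<in> I") (auto simp: prob_simplex_def)

text \<open>The tangent of the convex function \<open>x * ln x\<close> at \<open>q\<close> lies
  below its graph. The point \<open>p = 0\<close> is included, with \<open>0 * ln 0 = 0\<close>; it
  occurs when the entropy is maximal at a boundary point.\<close>

lemma tangent_xlnx:
  fixes p q :: real
  assumes "0 \<le> p" "0 < q"
  shows "p - q \<le> p * ln p - p * ln q"
proof (cases "p = 0")
  case False
  then have p: "p > 0" using assms by simp
  have "ln (q / p) \<le> q / p - 1"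
    using p assms by (intro ln_le_minus_one) auto
  then have "p * ln (q / p) \<le> p * (q / p - 1)"
    using p by (intro mult_left_mono) auto
  then show ?thesis using p assms by (simp add: ln_div algebra_simps)
qed (use assms in simp)

lemma continuous_on_xlnx: "continuous_on {0..} (\<lambda>x :: real. x * ln x)"
  unfolding continuous_on_def
proof
  fix x :: real assume "x \<in> {0..}"
  then consider "x = 0" | "x > 0" by fastforce
  then show "((\<lambda>x. x * ln x) \<longlongrightarrow> x * ln x) (at x within {0..})"
  proof cases
    case 1
    have "((\<lambda>x :: real. x * ln x) \<longlongrightarrow> 0) (at_right 0)" by real_asymp
    then show ?thesis using 1 by (simp add: at_within_Ici_at_right)
  next
    case 2
    then show ?thesis by (auto intro!: tendsto_intros)
  qed
qed

text \<open>Turns a binomial equation into a linear one in the logarithms. Positivity is demanded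
  only where \<open>u\<close> is nonzero, so that points on the boundary of the simplex are covered
  as well.\<close>

lemma sum_ln_eq_ln_prod:
  fixes u :: "'i \<Rightarrow> int" and q :: "'i \<Rightarrow> real"
  assumes "finite I" "\<And>i. i \<in> I \<Longrightarrow> u i \<noteq> 0 \<Longrightarrow> 0 < q i"
  shows "0 < (\<Prod>i\<in>I. q i ^ nat (u i))" "0 < (\<Prod>i\<in>I. q i ^ nat (- u i))"
    "(\<Sum>i\<in>I. of_int (u i) * ln (q i)) = ln (\<Prod>i\<in>I. q i ^ nat (u i)) - ln (\<Prod>i\<in>I. q i ^ nat (- u i))"
proof -
  have pos: "0 < q i ^ nat (u i)" "0 < q i ^ nat (- u i)" if "i \<in> I" for i
    using assms(2)[OF that] by (cases "u i = 0"; simp)+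
  show "0 < (\<Prod>i\<in>I. q i ^ nat (u i))" "0 < (\<Prod>i\<in>I. q i ^ nat (- u i))"
    using pos by (auto intro!: prod_pos)
  have "ln (\<Prod>i\<in>I. q i ^ nat (u i)) = (\<Sum>i\<in>I. ln (q i ^ nat (u i)))"
    by (rule ln_prod) (use pos assms in force)+
  moreover have "ln (\<Prod>i\<in>I. q i ^ nat (- u i)) = (\<Sum>i\<in>I. ln (q i ^ nat (- u i)))"
    by (rule ln_prod) (use pos assms in force)+
  moreover have "of_int (u i) * ln (q i) = ln (q i ^ nat (u i)) - ln (q i ^ nat (- u i))"
    if "i \<in> I" for i
    using assms(2)[OF that] by (cases "u i" "0 :: int" rule: linorder_cases) (auto simp: ln_realpow)
  ultimately show "(\<Sum>i\<in>I. of_int (u i) * ln (q i)) =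
      ln (\<Prod>i\<in>I. q i ^ nat (u i)) - ln (\<Prod>i\<in>I. q i ^ nat (- u i))"
    by (simp add: sum_subtractf)
qed

text \<open>In the application \<open>\<beta> k i\<close> is the \<open>k\<close>-th coordinate of
  \<open>e i - e i0\<close> in a basis consisting of the vectors \<open>e (j k) - e i0\<close>; this
  explains the prescribed values at \<open>i0\<close> and at the \<open>j l\<close>.\<close>

locale simplex_projection =
  fixes I :: "'i set" and d :: nat and \<beta> :: "nat \<Rightarrow> 'i \<Rightarrow> rat" and i0 :: 'i and j :: "nat \<Rightarrow> 'i"
  assumes fin: "finite I" and i0: "i0 \<in> I" and \<beta>_i0: "k < d \<Longrightarrow> \<beta> k i0 = 0"
    and j: "k < d \<Longrightarrow> j k \<in> I"
    and \<beta>_j: "k < d \<Longrightarrow> l < d \<Longrightarrow> \<beta> k (j l) = (if k = l then 1 else 0)"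
begin

text \<open>The directions of the fibres of \<open>proj\<close>. In the application, the integer
  vectors among them are those with a positive multiple of the form: letter counts of
  \<open>v\<close> minus letter counts of \<open>w\<close>, for words of equal length and equal
  sum.\<close>

definition null :: "('i \<Rightarrow> real) \<Rightarrow> bool"
  where "null u \<longleftrightarrow> sum u I = 0 \<and> (\<forall>k<d. (\<Sum>i\<in>I. of_rat (\<beta> k i) * u i) = 0)"

text \<open>Moving the negative exponents to the other side gives the equation
  \<open>\<Prod>i\<in>I. p i ^ u i = 1\<close> a meaning when coordinates vanish.\<close>

definition toric :: "('i \<Rightarrow> real) set" where
  "toric = {p \<in> prob_simplex I. \<forall>u :: 'i \<Rightarrow> int. null (\<lambda>i. of_int (u i)) \<longrightarrow>
     (\<Prod>i\<in>I. p i ^ nat (u i)) = (\<Prod>i\<in>I. p i ^ nat (- u i))}"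

lemma null_minus: "null u \<Longrightarrow> null (\<lambda>i. - u i)"
  by (auto simp: null_def sum_negf)

lemma common_denominator:
  obtains D :: int and b :: "nat \<Rightarrow> 'i \<Rightarrow> int" where "D > 0"
    "\<And>k i. k < d \<Longrightarrow> i \<in> I \<Longrightarrow> of_int D * (of_rat (\<beta> k i) :: real) = of_int (b k i)"
proof -
  define den where "den = (\<lambda>x. snd (quotient_of (\<beta> (fst x) (snd x))))"
  define D where "D = prod den ({..<d} \<times> I)"
  have den: "den x > 0" for x
    by (simp add: den_def quotient_of_denom_pos')
  have "\<exists>b. of_int D * (of_rat (\<beta> k i) :: real) = of_int b" if "k < d" "i \<in> I" for k i
  proof -
    have "den (k, i) dvd D"
      unfolding D_def using that fin by (intro dvd_prodI) auto
    then obtain e where e: "D = den (k, i) * e" by (elim dvdE)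
    have "\<beta> k i = of_int (fst (quotient_of (\<beta> k i))) / of_int (den (k, i))"
      unfolding den_def fst_conv snd_conv by (rule quotient_of_div) simp
    then have "of_int (den (k, i)) * \<beta> k i = of_int (fst (quotient_of (\<beta> k i)))"
      using den[of "(k, i)"] by (simp add: field_simps)
    then have "(of_rat (of_int (den (k, i)) * \<beta> k i) :: real) = of_rat (of_int (fst (quotient_of (\<beta> k i))))"
      by (rule arg_cong)
    then have "of_int (den (k, i)) * (of_rat (\<beta> k i) :: real) = of_int (fst (quotient_of (\<beta> k i)))"
      by (simp add: of_rat_mult)
    then have "of_int D * (of_rat (\<beta> k i) :: real) = of_int (e * fst (quotient_of (\<beta> k i)))"
      by (simp add: e algebra_simps)
    then show ?thesis by blast
  qed
  then obtain b where "\<And>k i. k < d \<Longrightarrow> i \<in> I \<Longrightarrow> of_int D * (of_rat (\<beta> k i) :: real) = of_int (b k i)"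
    by metis
  then show ?thesis using den by (intro that[of D b]) (auto simp: D_def intro!: prod_pos)
qed

text \<open>
  Simultaneous Dirichlet approximation: the defining equations of \<open>null\<close> take integer values on
  integer vectors (up to a common denominator), so they hold exactly for good approximations.
\<close>

lemma null_approx:
  assumes "null v" "0 < \<delta>"
  obtains N :: int and u :: "'i \<Rightarrow> int" where "N > 0" "null (\<lambda>i. of_int (u i))"
    "\<And>i. i \<in> I \<Longrightarrow> \<bar>of_int N * v i - of_int (u i)\<bar> < \<delta>"
proof -
  obtain D b where D: "D > 0"
    "\<And>k i. k < d \<Longrightarrow> i \<in> I \<Longrightarrow> of_int D * (of_rat (\<beta> k i) :: real) = of_int (b k i)"
    using common_denominator by blast
  \<comment> \<open>Each coordinate will be off by less than \<open>1 / N0\<close>, where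
    \<open>N0 > B\<close>. The summands of \<open>B\<close> make the errors in the equation for the
    total and in the \<open>d\<close> other equations less than 1, and the coordinate errors less
    than \<open>\<delta>\<close>.\<close>
  define B :: real where "B = 1 + of_nat (card I) + (\<Sum>k<d. \<Sum>i\<in>I. \<bar>of_int (b k i)\<bar>) + 1 / \<delta>"
  obtain N0 :: nat where N0: "B < of_nat N0" using reals_Archimedean2 by blast
  have Bpos: "B \<ge> 1 / \<delta>" "B > of_nat (card I)" "B \<ge> 1"
  proof -
    have "0 \<le> (\<Sum>k<d. \<Sum>i\<in>I. \<bar>real_of_int (b k i)\<bar>)" by (intro sum_nonneg) auto
    moreover have "0 < 1 / \<delta>" using assms(2) by simp
    moreover have "0 \<le> real (card I)" by simp
    ultimately show "B \<ge> 1 / \<delta>" "B > of_nat (card I)" "B \<ge> 1"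
      unfolding B_def by linarith+
  qed
  have bB: "(\<Sum>i\<in>I. \<bar>real_of_int (b k i)\<bar>) < B" if "k < d" for k
  proof -
    have "(\<Sum>i\<in>I. \<bar>real_of_int (b k i)\<bar>) \<le> (\<Sum>k<d. \<Sum>i\<in>I. \<bar>real_of_int (b k i)\<bar>)"
      using that by (intro member_le_sum) (auto intro!: sum_nonneg)
    moreover have "0 < 1 / \<delta>" using assms(2) by simp
    moreover have "0 \<le> real (card I)" by simp
    ultimately show ?thesis unfolding B_def by linarith
  qed
  have N0pos: "N0 > 0" using N0 Bpos by (cases N0) auto
  obtain h where h: "bij_betw h {0..<card I} I"
    using ex_bij_betw_nat_finite[OF fin] by blast
  obtain N :: int and m where N: "0 < N"
    "\<And>l. l < card I \<Longrightarrow> \<bar>of_int N * v (h l) - of_int (m l)\<bar> < 1 / N0"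
    using Dirichlet_approx_simult[OF N0pos, where n = "card I" and \<theta> = "\<lambda>l. v (h l)"] by metis
  define u where "u = (\<lambda>i. m (the_inv_into {0..<card I} h i))"
  have u: "\<bar>of_int N * v i - of_int (u i)\<bar> < 1 / N0" if "i \<in> I" for i
  proof -
    have "i \<in> h ` {0..<card I}" using h that by (simp add: bij_betw_def)
    then obtain l where l: "l < card I" "i = h l" by auto
    have "the_inv_into {0..<card I} h i = l"
      using l h unfolding bij_betw_def by (simp add: the_inv_into_f_f)
    then show ?thesis using N(2)[OF l(1)] l by (simp add: u_def)
  qed
  have *: "(\<Sum>i\<in>I. c i * u i) = 0"
    if "(\<Sum>i\<in>I. of_int (c i) * v i) = 0" "(\<Sum>i\<in>I. \<bar>real_of_int (c i)\<bar>) < B" for c :: "'i \<Rightarrow> int"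
  proof -
    have "real_of_int (\<Sum>i\<in>I. c i * u i) = (\<Sum>i\<in>I. of_int (c i) * of_int (u i))" by simp
    also have "\<dots> = (\<Sum>i\<in>I. of_int (c i) * of_int (u i)) - of_int N * (\<Sum>i\<in>I. of_int (c i) * v i)"
      using that by simp
    also have "\<dots> = - (\<Sum>i\<in>I. of_int (c i) * (of_int N * v i - of_int (u i)))"
      by (simp add: sum_distrib_left sum_subtractf algebra_simps)
    finally have "\<bar>real_of_int (\<Sum>i\<in>I. c i * u i)\<bar> \<le> (\<Sum>i\<in>I. \<bar>of_int (c i) * (of_int N * v i - of_int (u i))\<bar>)"
      by simp
    also have "\<dots> \<le> (\<Sum>i\<in>I. \<bar>of_int (c i)\<bar> * (1 / N0))"
      by (intro sum_mono) (auto simp only: abs_mult intro!: mult_left_mono less_imp_le[OF u])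
    also have "\<dots> = (\<Sum>i\<in>I. \<bar>of_int (c i)\<bar>) / N0"
      by (simp add: sum_divide_distrib)
    also have "\<dots> < 1"
      using that(2) N0 N0pos by simp
    \<comment> \<open>An integer of absolute value less than 1 is 0.\<close>
    finally show ?thesis by linarith
  qed
  have "null (\<lambda>i. of_int (u i))"
    unfolding null_def
  proof (intro conjI allI impI)
    have "(\<Sum>i\<in>I. 1 * u i) = 0"
      using assms(1) Bpos by (intro *) (auto simp: null_def)
    from this[THEN arg_cong[where f = real_of_int]] show "(\<Sum>i\<in>I. real_of_int (u i)) = 0"
      by simp
    fix k assume k: "k < d"
    have "(\<Sum>i\<in>I. of_int (b k i) * v i) = of_int D * (\<Sum>i\<in>I. of_rat (\<beta> k i) * v i)"
      using D(2)[OF k, symmetric] by (simp add: sum_distrib_left mult.assoc cong: sum.cong)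
    also have "\<dots> = 0" using assms(1) k by (simp add: null_def)
    finally have "(\<Sum>i\<in>I. b k i * u i) = 0"
      using bB[OF k] by (intro *) auto
    from this[THEN arg_cong[where f = real_of_int]]
    have "(\<Sum>i\<in>I. of_int (b k i) * real_of_int (u i)) = 0"
      by simp
    moreover have "(\<Sum>i\<in>I. of_int (b k i) * real_of_int (u i)) = of_int D * (\<Sum>i\<in>I. of_rat (\<beta> k i) * real_of_int (u i))"
      using D(2)[OF k, symmetric] by (simp add: sum_distrib_left mult.assoc cong: sum.cong)
    ultimately show "(\<Sum>i\<in>I. of_rat (\<beta> k i) * real_of_int (u i)) = 0"
      using D(1) by simp
  qed
  moreover have "\<bar>of_int N * v i - of_int (u i)\<bar> < \<delta>" if "i \<in> I" for i
  proof -
    have "1 / N0 < \<delta>"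
      using Bpos N0 N0pos assms(2) by (simp add: field_simps order_le_less_trans)
    then show ?thesis using u[OF that] by simp
  qed
  ultimately show ?thesis using that[of N u] N(1) by blast
qed

text \<open>Integer approximation of a multiple of \<open>q - p\<close> gives an exponent vector
  \<open>u\<close> that is nonnegative where \<open>p\<close> vanishes and positive at
  \<open>i\<close>. Its positive monomial then vanishes at \<open>p\<close> while its negative one
  does not, against the binomial equation.\<close>

lemma toric_support:
  assumes p: "p \<in> toric" and q: "q \<in> prob_simplex I" and n: "null (\<lambda>i. q i - p i)" and "p i = 0"
  shows "q i = 0"
proof (rule ccontr)
  assume "q i \<noteq> 0"
  then have i: "i \<in> I" "q i > 0"
    using q by (auto simp: prob_simplex_def less_le)
  have pS: "p \<in> prob_simplex I" using p by (simp add: toric_def)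
  \<comment> \<open>Tolerance 1 forces \<open>u l > - 1\<close>, hence \<open>u l \<ge> 0\<close>,
    where \<open>p l = 0\<close>; tolerance \<open>q i\<close> forces \<open>u i > 0\<close>. Both
    use \<open>N \<ge> 1\<close>.\<close>
  obtain N u where u: "N > 0" "null (\<lambda>i. of_int (u i))"
    "\<And>l. l \<in> I \<Longrightarrow> \<bar>of_int N * (q l - p l) - of_int (u l)\<bar> < min 1 (q i)"
    using null_approx[OF n, of "min 1 (q i)"] i by auto
  have N1: "of_int N * q l \<ge> q l" for l
    using u(1) prob_simplex_nonneg[OF q, of l] by (simp add: mult_le_cancel_right1)
  have nn: "u l \<ge> 0" if "l \<in> I" "p l = 0" for l
  proof -
    have "of_int (u l) > (-1 :: real)"
      using u(3)[OF that(1)] that N1[of l] prob_simplex_nonneg[OF q, of l] by auto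
    then show ?thesis by linarith
  qed
  have "of_int (u i) > (0 :: real)"
    using u(3)[OF i(1)] \<open>p i = 0\<close> N1[of i] by auto
  then have ui: "u i > 0" by simp
  have "(\<Prod>l\<in>I. p l ^ nat (u l)) = 0"
    using fin i ui \<open>p i = 0\<close> by (intro prod_zero) (auto intro!: bexI[of _ i])
  moreover have "(\<Prod>l\<in>I. p l ^ nat (- u l)) > 0"
  proof (intro prod_pos ballI)
    fix l assume "l \<in> I"
    then show "0 < p l ^ nat (- u l)"
      using nn[of l] prob_simplex_nonneg[OF pS, of l] by (cases "p l = 0") auto
  qed
  ultimately show False
    using p u(2) by (auto simp: toric_def)
qed

text \<open>\<open>ln p\<close> is orthogonal to integer fibre directions by the binomial equations,
  and for every \<open>\<delta>\<close> some multiple \<open>N * (q - p)\<close> with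
  \<open>N \<ge> 1\<close> is within \<open>\<delta>\<close> of such a direction.\<close>

lemma toric_orthogonal:
  assumes p: "p \<in> toric" and q: "q \<in> prob_simplex I" and n: "null (\<lambda>i. q i - p i)"
  shows "(\<Sum>i\<in>I. (q i - p i) * ln (p i)) = 0"
proof -
  have pS: "p \<in> prob_simplex I" using p by (simp add: toric_def)
  define B where "B = (\<Sum>i\<in>I. \<bar>ln (p i)\<bar>)"
  define \<phi> where "\<phi> = (\<Sum>i\<in>I. (q i - p i) * ln (p i))"
  have B0: "B \<ge> 0" by (auto simp: B_def intro!: sum_nonneg)
  have bound: "\<bar>\<phi>\<bar> \<le> \<delta> * B" if "0 < \<delta>" "\<delta> \<le> 1" for \<delta>
  proof -
    obtain N u where u: "N > 0" "null (\<lambda>i. of_int (u i))"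
      "\<And>i. i \<in> I \<Longrightarrow> \<bar>of_int N * (q i - p i) - of_int (u i)\<bar> < \<delta>"
      using null_approx[OF n \<open>0 < \<delta>\<close>] by blast
    \<comment> \<open>Where \<open>p\<close> vanishes so does \<open>q\<close>, so the approximated
      coordinate is 0; since \<open>\<delta> \<le> 1\<close>, the integer \<open>u i\<close> is 0
      and no \<open>ln 0\<close> enters the equation.\<close>
    have "0 < p i" if "i \<in> I" "u i \<noteq> 0" for i
    proof (rule ccontr)
      assume "\<not> 0 < p i"
      then have "p i = 0" using prob_simplex_nonneg[OF pS, of i] by simp
      then have "\<bar>of_int (u i)\<bar> < (1 :: real)"
        using u(3)[OF that(1)] toric_support[OF p q n] \<open>\<delta> \<le> 1\<close> by auto
      with that show False by linarith
    qed
    from sum_ln_eq_ln_prod(3)[OF fin, of u p, OF this]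
    have 0: "(\<Sum>i\<in>I. of_int (u i) * ln (p i)) = 0"
      using p u(2) by (auto simp: toric_def)
    have "\<bar>\<phi>\<bar> \<le> of_int N * \<bar>\<phi>\<bar>"
      using u(1) by (simp add: mult_le_cancel_right1)
    also have "\<dots> = \<bar>of_int N * \<phi>\<bar>"
      using u(1) by (simp add: abs_mult)
    also have "of_int N * \<phi> = (\<Sum>i\<in>I. (of_int N * (q i - p i) - of_int (u i)) * ln (p i))"
      using 0 by (simp add: \<phi>_def sum_distrib_left algebra_simps sum_subtractf sum.distrib)
    also have "\<bar>\<dots>\<bar> \<le> (\<Sum>i\<in>I. \<bar>(of_int N * (q i - p i) - of_int (u i)) * ln (p i)\<bar>)"
      by (rule sum_abs)
    also have "\<dots> \<le> (\<Sum>i\<in>I. \<delta> * \<bar>ln (p i)\<bar>)"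
      by (intro sum_mono) (auto simp only: abs_mult intro!: mult_right_mono less_imp_le[OF u(3)])
    also have "\<dots> = \<delta> * B" by (simp add: B_def sum_distrib_left)
    finally show ?thesis .
  qed
  have "\<bar>\<phi>\<bar> \<le> 0 + e" if "e > 0" for e
  proof -
    have "\<bar>\<phi>\<bar> \<le> min 1 (e / (B + 1)) * B"
      using that B0 by (intro bound) auto
    also have "\<dots> \<le> e / (B + 1) * (B + 1)"
      using that B0 by (intro mult_mono) auto
    finally show ?thesis using B0 by simp
  qed
  then have "\<bar>\<phi>\<bar> \<le> 0" by (rule field_le_epsilon)
  then show ?thesis by (simp add: \<phi>_def)
qed

text \<open>Orthogonality at \<open>p\<close> and at \<open>q\<close> makes the sum of
  \<open>(q i - p i) * (ln (q i) - ln (p i))\<close> vanish. As \<open>ln\<close> is strictly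
  increasing, no term is negative, and a zero term means \<open>p i = q i\<close>. By
  \<open>toric_support\<close> both points have the same zeros.\<close>

lemma toric_unique:
  assumes p: "p \<in> toric" and q: "q \<in> toric" and n: "null (\<lambda>i. q i - p i)"
  shows "p = q"
proof
  fix i
  have pS: "p \<in> prob_simplex I" and qS: "q \<in> prob_simplex I"
    using p q by (auto simp: toric_def)
  have n': "null (\<lambda>i. p i - q i)" using null_minus[OF n] by simp
  have "(\<Sum>i\<in>I. (q i - p i) * ln (q i)) = - (\<Sum>i\<in>I. (p i - q i) * ln (q i))"
    by (simp add: sum_negf[symmetric] algebra_simps)
  then have 0: "(\<Sum>i\<in>I. (q i - p i) * (ln (q i) - ln (p i))) = 0"
    using toric_orthogonal[OF p qS n] toric_orthogonal[OF q pS n']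
    by (simp add: right_diff_distrib sum_subtractf)
  have *: "(q i - p i) * (ln (q i) - ln (p i)) \<ge> 0 \<and>
      ((q i - p i) * (ln (q i) - ln (p i)) = 0 \<longrightarrow> p i = q i)" for i
  proof (cases "p i = 0")
    case True
    then show ?thesis using toric_support[OF p qS n True] by simp
  next
    case False
    then have "q i \<noteq> 0" using toric_support[OF q pS n'] by blast
    then have pos: "p i > 0" "q i > 0"
      using False prob_simplex_nonneg[OF pS, of i] prob_simplex_nonneg[OF qS, of i] by auto
    then show ?thesis
      by (cases "p i" "q i" rule: linorder_cases)
        (auto intro!: mult_nonneg_nonneg mult_nonpos_nonpos)
  qed
  show "p i = q i"
  proof (cases "i \<in> I")
    case True
    then have "(q i - p i) * (ln (q i) - ln (p i)) = 0"
      using 0 * fin by (subst (asm) sum_nonneg_eq_0_iff) auto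
    then show ?thesis using * by blast
  next
    case False
    then show ?thesis using pS qS by (simp add: prob_simplex_def)
  qed
qed

text \<open>The point of \<open>toric\<close> in a fibre is the one of maximal entropy.\<close>

lemma toric_exists:
  assumes q: "q \<in> prob_simplex I"
  obtains p where "p \<in> toric" "null (\<lambda>i. p i - q i)"
proof -
  define K where "K = {p \<in> prob_simplex I. null (\<lambda>i. p i - q i)}"
  define H where "H = (\<lambda>p :: 'i \<Rightarrow> real. \<Sum>i\<in>I. - (p i * ln (p i)))"
  have "closed ({p. (\<Sum>i\<in>I. p i - q i) = 0} \<inter>
      (\<Inter>k\<in>{..<d}. {p. (\<Sum>i\<in>I. of_rat (\<beta> k i) * (p i - q i)) = 0}))"
    by (intro closed_Int closed_INT ballI closed_Collect_eq continuous_intros)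
  then have "compact (prob_simplex I \<inter> ({p. (\<Sum>i\<in>I. p i - q i) = 0} \<inter>
      (\<Inter>k\<in>{..<d}. {p. (\<Sum>i\<in>I. of_rat (\<beta> k i) * (p i - q i)) = 0})))"
    by (rule compact_Int_closed[OF compact_prob_simplex[OF fin]])
  also have "\<dots> = K" by (auto simp: K_def null_def)
  finally have "compact K" .
  moreover have "q \<in> K" using q by (auto simp: K_def null_def)
  moreover have "continuous_on K H"
    unfolding H_def
    by (intro continuous_on_sum continuous_on_minus continuous_on_compose2[OF continuous_on_xlnx]
        continuous_intros) (auto simp: K_def prob_simplex_nonneg)
  ultimately obtain p where p: "p \<in> K" and max: "\<And>x. x \<in> K \<Longrightarrow> H x \<le> H p"
    using continuous_attains_sup[of K H] by blast
  have pS: "p \<in> prob_simplex I" and pn: "null (\<lambda>i. p i - q i)" using p by (auto simp: K_def)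
  \<comment> \<open>The derivative of the entropy in a direction \<open>u\<close> of total 0 is
    minus the sum of \<open>u i * ln (p i)\<close>. If the positive monomial were smaller than the
    negative one, this would be positive, and moving along \<open>u\<close> would increase the
    entropy.\<close>
  have not_less: False if u: "null (\<lambda>i. of_int (u i))"
    and less: "(\<Prod>i\<in>I. p i ^ nat (u i)) < (\<Prod>i\<in>I. p i ^ nat (- u i))" for u :: "'i \<Rightarrow> int"
  proof -
    define r where "r = (\<lambda>t i. if i \<in> I then p i + t * of_int (u i) else 0)"
    \<comment> \<open>The negative monomial exceeds a nonnegative number, so none of its factors is
      0.\<close>
    have ppos: "0 < p i" if "i \<in> I" "u i < 0" for i
    proof (rule ccontr)
      assume "\<not> 0 < p i"
      then have "p i ^ nat (- u i) = 0"
        using that prob_simplex_nonneg[OF pS, of i] by simp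
      then have "(\<Prod>i\<in>I. p i ^ nat (- u i)) = 0"
        using fin that by (intro prod_zero) auto
      moreover have "(\<Prod>i\<in>I. p i ^ nat (u i)) \<ge> 0"
        using prob_simplex_nonneg[OF pS] by (intro prod_nonneg) auto
      ultimately show False using less by simp
    qed
    have e1: "\<forall>\<^sub>F t in at_right 0. (\<Prod>i\<in>I. r t i ^ nat (u i)) < (\<Prod>i\<in>I. r t i ^ nat (- u i))"
    proof -
      have "((\<lambda>t. \<Prod>i\<in>I. r t i ^ nat (c i)) \<longlongrightarrow> (\<Prod>i\<in>I. p i ^ nat (c i))) (at_right 0)" for c
        unfolding r_def
        by (intro tendsto_prod) (auto intro!: tendsto_eq_intros)
      from tendsto_diff[OF this[of "\<lambda>i. - u i"] this[of u]]
      have "\<forall>\<^sub>F t in at_right 0. 0 < (\<Prod>i\<in>I. r t i ^ nat (- u i)) - (\<Prod>i\<in>I. r t i ^ nat (u i))"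
        by (rule order_tendstoD(1)) (use less in simp)
      then show ?thesis by simp
    qed
    have e2: "\<forall>\<^sub>F t in at_right 0. \<forall>i\<in>I. u i \<noteq> 0 \<longrightarrow> 0 < r t i"
    proof (rule eventually_ball_finite[OF fin], rule ballI)
      fix i assume i: "i \<in> I"
      consider "u i = 0" | "u i > 0" | "u i < 0" by linarith
      then show "\<forall>\<^sub>F t in at_right 0. u i \<noteq> 0 \<longrightarrow> 0 < r t i"
      proof cases
        case 1
        then show ?thesis by simp
      next
        case 2
        then show ?thesis
          using i prob_simplex_nonneg[OF pS, of i]
          by (auto simp: eventually_at_filter r_def intro!: always_eventually add_nonneg_pos)
      next
        case 3
        have "((\<lambda>t. r t i) \<longlongrightarrow> p i) (at_right 0)"
          using i unfolding r_def by (auto intro!: tendsto_eq_intros)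
        then have "\<forall>\<^sub>F t in at_right 0. 0 < r t i"
          by (rule order_tendstoD(1)) (use ppos 3 i in auto)
        then show ?thesis by (rule eventually_mono) auto
      qed
    qed
    have "\<forall>\<^sub>F t in at_right 0. (0 :: real) < t"
      by (simp add: eventually_at_right_less)
    from eventually_conj[OF this eventually_conj[OF e1 e2]]
    have "\<exists>t>0. (\<Prod>i\<in>I. r t i ^ nat (u i)) < (\<Prod>i\<in>I. r t i ^ nat (- u i)) \<and>
        (\<forall>i\<in>I. u i \<noteq> 0 \<longrightarrow> 0 < r t i)"
      by (rule eventually_happens'[rotated]) simp
    then obtain t where t: "t > 0" and t1: "(\<Prod>i\<in>I. r t i ^ nat (u i)) < (\<Prod>i\<in>I. r t i ^ nat (- u i))"
      and t2: "\<And>i. i \<in> I \<Longrightarrow> u i \<noteq> 0 \<Longrightarrow> 0 < r t i"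
      by blast
    have su: "(\<Sum>i\<in>I. of_int (u i)) = (0 :: real)" using u by (simp add: null_def)
    have "r t \<in> prob_simplex I"
      using pS t2 su
      by (auto simp: prob_simplex_def r_def sum.distrib sum_distrib_left[symmetric] less_imp_le)
         (metis add.right_neutral less_imp_le mult_zero_right of_int_0)
    moreover have "null (\<lambda>i. r t i - q i)"
      unfolding null_def
    proof (intro conjI allI impI)
      have "(\<Sum>i\<in>I. r t i - q i) = (\<Sum>i\<in>I. p i - q i) + t * (\<Sum>i\<in>I. of_int (u i))"
        by (simp add: r_def sum_distrib_left sum.distrib sum_subtractf)
      then show "(\<Sum>i\<in>I. r t i - q i) = 0" using pn su by (simp add: null_def)
      fix k assume k: "k < d"
      have "(\<Sum>i\<in>I. of_rat (\<beta> k i) * (r t i - q i)) =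
          (\<Sum>i\<in>I. of_rat (\<beta> k i) * (p i - q i)) + t * (\<Sum>i\<in>I. of_rat (\<beta> k i) * of_int (u i))"
        by (simp add: r_def sum_distrib_left sum.distrib[symmetric] algebra_simps cong: sum.cong)
      then show "(\<Sum>i\<in>I. of_rat (\<beta> k i) * (r t i - q i)) = 0"
        using pn u k by (simp add: null_def)
    qed
    ultimately have "H (r t) \<le> H p" by (intro max) (simp add: K_def)
    \<comment> \<open>Concavity is used with the tangent at the perturbed point \<open>r t\<close>,
      not at \<open>p\<close>: there the logarithms exist even if \<open>p i = 0\<close>. The strict
      inequality between the monomials persists at \<open>r t\<close> for small
      \<open>t\<close>.\<close>
    have "- (t * of_int (u i)) - t * (of_int (u i) * ln (r t i)) \<le> p i * ln (p i) - r t i * ln (r t i)"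
      if i: "i \<in> I" for i
    proof (cases "u i = 0")
      case True
      then show ?thesis using i by (simp add: r_def)
    next
      case False
      have "p i - r t i \<le> p i * ln (p i) - p i * ln (r t i)"
        using t2[OF i False] prob_simplex_nonneg[OF pS] by (intro tangent_xlnx) auto
      moreover have diff: "p i - r t i = - (t * of_int (u i))" using i by (simp add: r_def)
      moreover have "p i * ln (r t i) = (p i - r t i) * ln (r t i) + r t i * ln (r t i)"
        by (simp add: left_diff_distrib)
      ultimately show ?thesis unfolding diff by simp
    qed
    then have "(\<Sum>i\<in>I. - (t * of_int (u i)) - t * (of_int (u i) * ln (r t i))) \<le>
        (\<Sum>i\<in>I. p i * ln (p i) - r t i * ln (r t i))"
      by (rule sum_mono)
    also have "\<dots> = H (r t) - H p" by (simp add: H_def sum_subtractf sum_negf)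
    also have "\<dots> \<le> 0" using \<open>H (r t) \<le> H p\<close> by simp
    finally have "0 \<le> t * (\<Sum>i\<in>I. of_int (u i)) + t * (\<Sum>i\<in>I. of_int (u i) * ln (r t i))"
      by (simp add: sum_subtractf sum_negf sum_distrib_left)
    then have "0 \<le> (\<Sum>i\<in>I. of_int (u i) * ln (r t i))"
      using su t by (simp add: zero_le_mult_iff)
    moreover have "(\<Sum>i\<in>I. of_int (u i) * ln (r t i)) < 0"
      using sum_ln_eq_ln_prod[OF fin, of u "r t", OF t2] t1 by simp
    ultimately show False by simp
  qed
  have "p \<in> toric"
    unfolding toric_def
  proof (intro CollectI conjI allI impI pS)
    fix u :: "'i \<Rightarrow> int" assume u: "null (\<lambda>i. of_int (u i))"
    show "(\<Prod>i\<in>I. p i ^ nat (u i)) = (\<Prod>i\<in>I. p i ^ nat (- u i))"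
      using not_less[OF u] not_less[of "\<lambda>i. - u i"] null_minus[OF u]
      by (cases "\<Prod>i\<in>I. p i ^ nat (u i)" "\<Prod>i\<in>I. p i ^ nat (- u i)" rule: linorder_cases) auto
  qed
  with pn show ?thesis by (intro that)
qed

section \<open>The moment map and its polytope\<close>

definition proj :: "('i \<Rightarrow> real) \<Rightarrow> nat \<Rightarrow> real" where
  "proj p = (\<lambda>k. if k < d then (\<Sum>i\<in>I. of_rat (\<beta> k i) * (p i - 1 / card I)) else 0)"

definition uniform :: "'i \<Rightarrow> real"
  where "uniform = (\<lambda>i. if i \<in> I then 1 / card I else 0)"

lemma card_I: "0 < card I"
  using fin i0 by (auto simp: card_gt_0_iff)

lemma proj_uniform_add: "k < d \<Longrightarrow> proj (\<lambda>i. uniform i + z i) k = (\<Sum>i\<in>I. of_rat (\<beta> k i) * z i)"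
  by (simp add: proj_def uniform_def cong: sum.cong)

lemma proj_eq_iff:
  assumes "p \<in> prob_simplex I" "q \<in> prob_simplex I"
  shows "proj p = proj q \<longleftrightarrow> null (\<lambda>i. q i - p i)"
proof -
  have *: "(\<Sum>i\<in>I. of_rat (\<beta> k i) * (q i - p i)) = proj q k - proj p k" if "k < d" for k
    using that by (simp add: proj_def sum_subtractf[symmetric] algebra_simps)
  have "(\<Sum>i\<in>I. q i - p i) = 0"
    using assms by (simp add: prob_simplex_def sum_subtractf)
  then have "null (\<lambda>i. q i - p i) \<longleftrightarrow> (\<forall>k<d. proj p k = proj q k)"
    unfolding null_def using * by auto
  also have "\<dots> \<longleftrightarrow> proj p = proj q"
    by (auto simp: fun_eq_iff) (metis proj_def)
  finally show ?thesis by simp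
qed

lemma proj_convex:
  assumes "k < d"
  shows "proj (\<lambda>i. (1 - t) * p i + t * q i) k = (1 - t) * proj p k + t * proj q k"
proof -
  define c where "c = 1 / real (card I)"
  have "(1 - t) * p i + t * q i - c = (1 - t) * (p i - c) + t * (q i - c)" for i
    by (simp add: algebra_simps)
  then show ?thesis
    using assms
    by (simp add: proj_def c_def[symmetric] sum_distrib_left sum.distrib[symmetric] algebra_simps
        cong: sum.cong)
qed

lemma prob_simplex_convex:
  assumes "p \<in> prob_simplex I" "q \<in> prob_simplex I" "0 \<le> t" "t \<le> 1"
  shows "(\<lambda>i. (1 - t) * p i + t * q i) \<in> prob_simplex I"
  using assms by (auto simp: prob_simplex_def sum.distrib sum_distrib_left[symmetric])

lemma uniform_simplex: "uniform \<in> prob_simplex I"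
  using card_I by (auto simp: prob_simplex_def uniform_def)

text \<open>The subtraction of \<open>1 / card I\<close> in \<open>proj\<close> is made for this:
  the origin becomes an interior point of the polytope.\<close>

lemma proj_uniform: "proj uniform k = 0"
  by (simp add: proj_def uniform_def)

lemma continuous_on_proj: "continuous_on S proj"
proof (rule continuous_on_coordinatewise_then_product)
  fix k show "continuous_on S (\<lambda>p. proj p k)"
    by (cases "k < d") (auto simp: proj_def intro!: continuous_intros)
qed

text \<open>The uniform distribution leaves room \<open>1 / card I\<close> at each of its
  coordinates for a perturbation \<open>z\<close>. Each of the \<open>d\<close> summands of
  \<open>z i\<close> is at most \<open>1 / (card I * (d + 1))\<close>; taking \<open>d + 1\<close>
  rather than \<open>d\<close> keeps the radius positive when \<open>d = 0\<close>.\<close>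

lemma proj_onto_ball:
  assumes x: "\<And>k. d \<le> k \<Longrightarrow> x k = 0" and le: "L2_set x {..<d} \<le> 1 / (card I * (d + 1))"
  shows "x \<in> proj ` prob_simplex I"
proof -
  \<comment> \<open>Mass \<open>x k\<close> is put on \<open>j k\<close> and taken from
    \<open>i0\<close>: the total is 0, and the normalization of \<open>\<beta>\<close> at
    \<open>j\<close> and \<open>i0\<close> makes \<open>x\<close> the image.\<close>
  define z :: "'i \<Rightarrow> real" where "z = (\<lambda>i. \<Sum>k<d. x k * (of_bool (i = j k) - of_bool (i = i0)))"
  have xk: "\<bar>x k\<bar> \<le> 1 / (card I * (d + 1))" if "k < d" for k
  proof -
    have "\<bar>x k\<bar> \<le> L2_set x {..<d}"
      using member_le_L2_set[of "{..<d}" k "\<lambda>k. \<bar>x k\<bar>"] that by (simp add: L2_set_def)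
    with le show ?thesis by simp
  qed
  have z_bound: "\<bar>z i\<bar> \<le> 1 / card I" for i
  proof -
    have "\<bar>z i\<bar> \<le> (\<Sum>k<d. \<bar>x k * (of_bool (i = j k) - of_bool (i = i0))\<bar>)"
      unfolding z_def by (rule sum_abs)
    also have "\<dots> \<le> (\<Sum>k<d. 1 / (card I * (d + 1)))"
    proof (rule sum_mono)
      fix k assume "k \<in> {..<d}"
      then have "\<bar>x k\<bar> \<le> 1 / (card I * (d + 1))" using xk by auto
      moreover have "\<bar>x k * (of_bool (i = j k) - of_bool (i = i0))\<bar> \<le> \<bar>x k\<bar>"
        by (auto simp: abs_mult)
      ultimately show "\<bar>x k * (of_bool (i = j k) - of_bool (i = i0))\<bar> \<le> 1 / (card I * (d + 1))"
        by linarith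
    qed
    also have "\<dots> = (d / (d + 1)) * (1 / card I)" by (simp add: algebra_simps)
    also have "\<dots> \<le> 1 * (1 / card I)" by (intro mult_right_mono) auto
    finally show ?thesis by simp
  qed
  have delta: "(\<Sum>i\<in>I. c i * z i) = (\<Sum>k<d. x k * (c (j k) - c i0))" for c :: "'i \<Rightarrow> real"
  proof -
    have "(\<Sum>i\<in>I. c i * z i) = (\<Sum>k<d. \<Sum>i\<in>I. c i * (x k * (of_bool (i = j k) - of_bool (i = i0))))"
      unfolding z_def sum_distrib_left by (rule sum.swap)
    also have "\<dots> = (\<Sum>k<d. x k * (c (j k) - c i0))"
    proof (rule sum.cong[OF refl])
      fix k assume k: "k \<in> {..<d}"
      have "c i * (x k * (of_bool (i = j k) - of_bool (i = i0))) =
          (if i = j k then x k * c i else 0) - (if i = i0 then x k * c i else 0)" for i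
        by auto
      then show "(\<Sum>i\<in>I. c i * (x k * (of_bool (i = j k) - of_bool (i = i0)))) = x k * (c (j k) - c i0)"
        using k j i0 fin by (simp add: sum_subtractf right_diff_distrib)
    qed
    finally show ?thesis .
  qed
  have z0: "z i = 0" if "i \<notin> I" for i
  proof -
    have "x k * (of_bool (i = j k) - of_bool (i = i0)) = 0" if "k < d" for k
      using that \<open>i \<notin> I\<close> j i0 by auto
    then show ?thesis unfolding z_def by (intro sum.neutral ballI) simp_all
  qed
  have "sum z I = 0" using delta[of "\<lambda>_. 1"] by simp
  then have "sum (\<lambda>i. uniform i + z i) I = 1"
    using uniform_simplex by (simp add: prob_simplex_def sum.distrib)
  moreover have "0 \<le> uniform i + z i" if "i \<in> I" for i
    using z_bound[of i] that by (simp add: uniform_def)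
  ultimately have "(\<lambda>i. uniform i + z i) \<in> prob_simplex I"
    using z0 by (simp add: prob_simplex_def uniform_def)
  moreover have "proj (\<lambda>i. uniform i + z i) = x"
  proof
    fix k
    show "proj (\<lambda>i. uniform i + z i) k = x k"
    proof (cases "k < d")
      case True
      then have "proj (\<lambda>i. uniform i + z i) k = (\<Sum>l<d. x l * (of_rat (\<beta> k (j l)) - of_rat (\<beta> k i0)))"
        by (simp add: proj_uniform_add delta)
      also have "\<dots> = (\<Sum>l<d. if l = k then x l else 0)"
        using True by (intro sum.cong) (auto simp: \<beta>_j \<beta>_i0)
      finally show ?thesis using True by simp
    next
      case False
      then show ?thesis using x by (simp add: proj_def)
    qed
  qed
  ultimately show ?thesis by (metis imageI)
qed

lemma disk_parametrization:
  obtains F where "continuous_on toric F" "inj_on F toric" "F ` toric = closed_disk d"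
    "\<And>p. p \<in> toric \<Longrightarrow> F p \<in> disk_interior d \<longleftrightarrow> (\<forall>i\<in>I. 0 < p i)"
proof -
  define C where "C = proj ` prob_simplex I"
  have "compact C"
    unfolding C_def using continuous_on_proj compact_prob_simplex[OF fin]
    by (rule compact_continuous_image)
  then obtain R where R: "\<And>x. x \<in> C \<Longrightarrow> L2_set x {..<d} \<le> R"
  proof -
    have "C \<noteq> {}" using uniform_simplex by (auto simp: C_def)
    moreover have "continuous_on C (\<lambda>x. L2_set x {..<d})"
      unfolding L2_set_def by (intro continuous_intros)
    ultimately obtain x where "\<forall>y\<in>C. L2_set y {..<d} \<le> L2_set x {..<d}"
      using continuous_attains_sup[OF \<open>compact C\<close>] by blast
    then show ?thesis using that by blast
  qed
  interpret C: convex_body d C "1 / (card I * (d + 1))" "max 1 R"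
  proof
    show "x k = 0" if "x \<in> C" "d \<le> k" for x k
      using that by (auto simp: C_def proj_def)
    show "(\<lambda>k. (1 - t) * x k + t * y k) \<in> C" if xy: "x \<in> C" "y \<in> C" and t: "0 \<le> t" "t \<le> 1" for x y t
    proof -
      obtain p q where p: "p \<in> prob_simplex I" "x = proj p" and q: "q \<in> prob_simplex I" "y = proj q"
        using xy by (auto simp: C_def)
      have "(\<lambda>k. (1 - t) * x k + t * y k) = proj (\<lambda>i. (1 - t) * p i + t * q i)"
      proof
        fix k show "(1 - t) * x k + t * y k = proj (\<lambda>i. (1 - t) * p i + t * q i) k"
          using proj_convex[of k t p q] p q by (cases "k < d") (auto simp: proj_def)
      qed
      then show ?thesis
        using prob_simplex_convex[OF p(1) q(1) t] by (simp add: C_def)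
    qed
    show "closed C" using \<open>compact C\<close> by (rule compact_imp_closed)
    show "0 < max 1 R" by simp
    show "L2_set x {..<d} \<le> max 1 R" if "x \<in> C" for x using R[OF that] by simp
    show "0 < 1 / real (card I * (d + 1))"
      using card_I by (simp only: zero_less_divide_1_iff of_nat_0_less_iff) simp
    show "x \<in> C" if "\<And>i. d \<le> i \<Longrightarrow> x i = 0" "L2_set x {..<d} \<le> 1 / (card I * (d + 1))" for x
      unfolding C_def using that by (rule proj_onto_ball)
  qed
  have toricS: "p \<in> prob_simplex I" if "p \<in> toric" for p using that by (simp add: toric_def)
  have projC: "proj ` toric = C"
  proof
    show "proj ` toric \<subseteq> C" using toricS by (auto simp: C_def)
    show "C \<subseteq> proj ` toric"
    proof
      fix x assume "x \<in> C"
      then obtain q where q: "q \<in> prob_simplex I" "x = proj q" by (auto simp: C_def)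
      obtain p where p: "p \<in> toric" "null (\<lambda>i. p i - q i)" using toric_exists[OF q(1)] .
      then have "proj q = proj p" using proj_eq_iff[OF q(1) toricS[OF p(1)]] by simp
      then show "x \<in> proj ` toric" using p q by auto
    qed
  qed
  have inj: "inj_on proj toric"
    using toric_unique proj_eq_iff toricS by (intro inj_onI) blast
  show ?thesis
  proof (rule that[of "C.radial \<circ> proj"])
    show "continuous_on toric (C.radial \<circ> proj)"
      using C.continuous_on_radial projC continuous_on_proj by (intro continuous_on_compose) auto
    show "inj_on (C.radial \<circ> proj) toric"
      using inj C.inj_on_radial projC by (intro comp_inj_on) auto
    show "(C.radial \<circ> proj) ` toric = closed_disk d"
      unfolding image_comp[symmetric] projC by (rule C.radial_image)
    fix p assume p: "p \<in> toric"
    note pS = toricS[OF p]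
    have "(\<exists>t. 0 < t \<and> t < 1 \<and> (\<lambda>k. proj p k / t) \<in> C) \<longleftrightarrow> (\<forall>i\<in>I. 0 < p i)"
    proof
      assume "\<exists>t. 0 < t \<and> t < 1 \<and> (\<lambda>k. proj p k / t) \<in> C"
      then obtain t q where t: "0 < t" "t < 1" and q: "q \<in> prob_simplex I" "(\<lambda>k. proj p k / t) = proj q"
        by (auto simp: C_def)
      \<comment> \<open>Mixing with the uniform distribution returns to the fibre of
        \<open>p\<close>, since \<open>proj uniform\<close> is 0, and gives full support. By
        \<open>toric_support\<close>, \<open>p\<close> has full support as well.\<close>
      define r where "r = (\<lambda>i. (1 - t) * uniform i + t * q i)"
      have r: "r \<in> prob_simplex I"
        unfolding r_def using uniform_simplex q t by (intro prob_simplex_convex) auto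
      have "proj p = proj r"
      proof
        fix k
        have "proj q k = proj p k / t" using q(2) by (metis (full_types))
        then show "proj p k = proj r k"
          using proj_convex[of k t uniform q] t
          by (cases "k < d") (auto simp: r_def proj_uniform, auto simp: proj_def)
      qed
      then have n: "null (\<lambda>i. r i - p i)" using proj_eq_iff[OF pS r] by simp
      show "\<forall>i\<in>I. 0 < p i"
      proof
        fix i assume i: "i \<in> I"
        have "r i > 0"
          using t i card_I prob_simplex_nonneg[OF q(1), of i]
          by (auto simp: r_def uniform_def intro!: add_pos_nonneg)
        then have "p i \<noteq> 0" using toric_support[OF p r n] by force
        then show "0 < p i" using prob_simplex_nonneg[OF pS, of i] by simp
      qed
    next
      assume pos: "\<forall>i\<in>I. 0 < p i"
      define m where "m = Min (p ` I)"
      have m: "0 < m" "\<And>i. i \<in> I \<Longrightarrow> m \<le> p i"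
      proof -
        have "m \<in> p ` I" unfolding m_def using fin i0 by (intro Min_in) auto
        then show "0 < m" using pos by auto
        show "m \<le> p i" if "i \<in> I" for i using fin that by (simp add: m_def)
      qed
      have "m \<le> 1"
        using m(2)[OF i0] member_le_sum[of i0 I p] pS i0 fin by (auto simp: prob_simplex_def)
      \<comment> \<open>The point \<open>q\<close> below solves
        \<open>p = (1 - t) * uniform + t * q\<close>; it stays nonnegative because
        \<open>(1 - t) / card I \<le> m / 2 \<le> p i\<close> on \<open>I\<close>.\<close>
      define t where "t = 1 - m / 2"
      have t: "0 < t" "t < 1" using m(1) \<open>m \<le> 1\<close> by (auto simp: t_def)
      define q where "q = (\<lambda>i. (1 - 1 / t) * uniform i + (1 / t) * p i)"
      have "0 \<le> q i" if i: "i \<in> I" for i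
      proof -
        have "(1 - t) / card I \<le> (1 - t) / 1"
          using t card_I by (intro divide_left_mono) auto
        also have "\<dots> \<le> p i" using m(1) m(2)[OF i] by (simp add: t_def)
        finally have "0 \<le> (p i - (1 - t) / card I) / t" using t by simp
        also have "\<dots> = q i"
          using t i by (simp add: q_def uniform_def field_simps) (simp flip: add_divide_distrib)
        finally show ?thesis .
      qed
      moreover have "sum q I = 1"
        using uniform_simplex pS
        by (simp add: q_def prob_simplex_def sum.distrib sum_distrib_left[symmetric] sum_divide_distrib[symmetric])
      moreover have "q i = 0" if "i \<notin> I" for i
        using that uniform_simplex pS by (simp add: q_def prob_simplex_def)
      ultimately have "q \<in> prob_simplex I" by (simp add: prob_simplex_def)
      moreover have "proj q = (\<lambda>k. proj p k / t)"
      proof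
        fix k show "proj q k = proj p k / t"
          using proj_convex[of k "1 / t" uniform p]
          by (cases "k < d") (simp add: q_def proj_uniform, simp add: proj_def)
      qed
      ultimately have "(\<lambda>k. proj p k / t) \<in> C" by (metis C_def imageI)
      with t show "\<exists>t. 0 < t \<and> t < 1 \<and> (\<lambda>k. proj p k / t) \<in> C" by blast
    qed
    then show "(C.radial \<circ> proj) p \<in> disk_interior d \<longleftrightarrow> (\<forall>i\<in>I. 0 < p i)"
      using C.radial_interior_iff[of "proj p"] projC p by auto
  qed
qed

end

section \<open>Cylinders\<close>

lemma topspace_path_space: "topspace (path_space I) = {x. \<forall>k. x k \<in> I}"
  by (auto simp: path_space_def PiE_def)

lemma cylinder_eq: "cylinder I w = {x. (\<forall>k. x k \<in> I) \<and> (\<forall>k<length w. x k = w ! k)}"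
  by (simp add: cylinder_def topspace_path_space)

lemma cylinder_subset: "cylinder I w \<subseteq> topspace (path_space I)"
  by (auto simp: cylinder_def)

lemma cylinder_Nil: "cylinder I [] = topspace (path_space I)"
  by (simp add: cylinder_def)

lemma cylinder_map_upt: "(\<forall>k. x k \<in> I) \<Longrightarrow> x \<in> cylinder I (map x [0..<n])"
  by (simp add: cylinder_eq)

lemma continuous_map_path_space_apply:
  "continuous_map (path_space I) (discrete_topology I) (\<lambda>x. x k)"
  using continuous_map_product_projection[of k UNIV "\<lambda>_. discrete_topology I"]
  by (simp add: path_space_def)

lemma openin_cylinder: "openin (path_space I) (cylinder I w)"
proof -
  have "openin (path_space I) {x \<in> topspace (path_space I). x k \<in> {w ! k} \<inter> I}" for k
    by (rule openin_continuous_map_preimage[where Y = "discrete_topology I"])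
      (auto intro: continuous_map_path_space_apply)
  then have "openin (path_space I)
      (topspace (path_space I) \<inter> (\<Inter>k<length w. {x \<in> topspace (path_space I). x k \<in> {w ! k} \<inter> I}))"
    by (cases "length w = 0") (auto intro!: openin_Int openin_Inter)
  also have "topspace (path_space I) \<inter> (\<Inter>k<length w. {x \<in> topspace (path_space I). x k \<in> {w ! k} \<inter> I})
      = cylinder I w"
    by (auto simp: cylinder_eq topspace_path_space)
  finally show ?thesis .
qed

lemma open_contains_cylinder:
  assumes "openin (path_space I) U" "x \<in> U"
  obtains n where "cylinder I (map x [0..<n]) \<subseteq> U"
proof -
  obtain X where X: "finite {k. X k \<noteq> I}" "x \<in> Pi\<^sub>E UNIV X" "Pi\<^sub>E UNIV X \<subseteq> U"
    using assms unfolding path_space_def openin_product_topology_alt by force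
  define n where "n = Suc (Max (insert 0 {k. X k \<noteq> I}))"
  have "X k = I" if "n \<le> k" for k
  proof (rule ccontr)
    assume "X k \<noteq> I"
    then have "k \<le> Max (insert 0 {k. X k \<noteq> I})" using X(1) by (intro Max_ge) auto
    with that show False by (simp add: n_def)
  qed
  then have "y k \<in> X k" if "y \<in> cylinder I (map x [0..<n])" for y k
    using X(2) that by (cases "k < n") (auto simp: cylinder_eq)
  then have "cylinder I (map x [0..<n]) \<subseteq> Pi\<^sub>E UNIV X" by auto
  with X(3) show ?thesis by (intro that) auto
qed

lemma cylinder_Int:
  assumes "length v \<le> length w"
  shows "cylinder I v \<inter> cylinder I w = (if take (length v) w = v then cylinder I w else {})"
proof (cases "take (length v) w = v")
  case True
  then have "v ! k = w ! k" if "k < length v" for k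
    using that by (metis nth_take)
  with assms True show ?thesis by (auto simp: cylinder_eq)
next
  case False
  have "\<exists>k<length v. v ! k \<noteq> w ! k"
  proof (rule ccontr)
    assume "\<not> ?thesis"
    then have "take (length v) w = v" using assms by (intro nth_equalityI) auto
    with False show False by simp
  qed
  then obtain k where "k < length v" "v ! k \<noteq> w ! k" by blast
  with assms False show ?thesis by (force simp: cylinder_eq)
qed

lemma cylinder_snoc_Union: "cylinder I w = (\<Union>i\<in>I. cylinder I (w @ [i]))"
  by (auto simp: cylinder_eq nth_append less_Suc_eq)

lemma cylinder_Cons_Union: "{x \<in> topspace (path_space I). (\<lambda>k. x (Suc k)) \<in> cylinder I w} =
    (\<Union>i\<in>I. cylinder I (i # w))"
  by (auto simp: cylinder_eq topspace_path_space nth_Cons less_Suc_eq_0_disj)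

lemma disjoint_cylinders:
  assumes "v \<noteq> w" "length v = length w"
  shows "cylinder I v \<inter> cylinder I w = {}"
  using cylinder_Int[of v w I] assms by simp

text \<open>\<open>lists I\<close> is countable, so every open set is a countable union of the
  cylinders contained in it.\<close>

lemma sigma_sets_cylinders:
  assumes "finite I"
  shows "sigma_sets (topspace (path_space I)) {U. openin (path_space I) U} =
    sigma_sets (topspace (path_space I)) (cylinder I ` lists I)" (is "_ = sigma_sets ?\<Omega> ?C")
proof (rule sigma_sets_eqI)
  fix U assume "U \<in> {U. openin (path_space I) U}"
  then have U: "openin (path_space I) U" by simp
  have "U = (\<Union>w\<in>{w\<in>lists I. cylinder I w \<subseteq> U}. cylinder I w)"
  proof
    show "U \<subseteq> (\<Union>w\<in>{w\<in>lists I. cylinder I w \<subseteq> U}. cylinder I w)"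
    proof
      fix x assume x: "x \<in> U"
      then obtain n where n: "cylinder I (map x [0..<n]) \<subseteq> U"
        using open_contains_cylinder[OF U] by blast
      have "\<forall>k. x k \<in> I" using x openin_subset[OF U] by (auto simp: topspace_path_space)
      then show "x \<in> (\<Union>w\<in>{w\<in>lists I. cylinder I w \<subseteq> U}. cylinder I w)"
        using n cylinder_map_upt[of x I n] by (intro UN_I[of "map x [0..<n]"]) auto
    qed
  qed auto
  moreover have "countable {w\<in>lists I. cylinder I w \<subseteq> U}"
    by (rule countable_subset[of _ "lists I"]) (use assms in \<open>auto intro: countable_lists countable_finite\<close>)
  ultimately show "U \<in> sigma_sets ?\<Omega> ?C"
    by (subst \<open>U = _\<close>) (rule sigma_sets_UNION, auto)
next
  fix A assume "A \<in> ?C"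
  then show "A \<in> sigma_sets ?\<Omega> {U. openin (path_space I) U}"
    using openin_cylinder by auto
qed

lemma
  assumes "M \<in> borel_probability_measures (path_space I)"
  shows bpm_prob_space: "prob_space M"
    and bpm_space: "space M = topspace (path_space I)"
    and bpm_sets: "sets M = sigma_sets (topspace (path_space I)) {U. openin (path_space I) U}"
    and bpm_cylinder: "cylinder I w \<in> sets M"
  using assms openin_cylinder by (auto simp: borel_probability_measures_def)

lemma bpm_eqI:
  assumes "finite I"
    and M: "M \<in> borel_probability_measures (path_space I)"
    and N: "N \<in> borel_probability_measures (path_space I)"
    and eq: "\<And>w. w \<in> lists I \<Longrightarrow> measure M (cylinder I w) = measure N (cylinder I w)"
  shows "M = N"
proof (rule measure_eqI_generator_eq)
  interpret M: prob_space M using bpm_prob_space[OF M] .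
  interpret N: prob_space N using bpm_prob_space[OF N] .
  \<comment> \<open>Two cylinders are nested or disjoint; with the empty set added they form a
    system closed under intersections.\<close>
  let ?E = "insert {} (cylinder I ` lists I)"
  have *: "cylinder I v \<inter> cylinder I w \<in> ?E" if "v \<in> lists I" "w \<in> lists I" for v w
    using that cylinder_Int[of v w I] cylinder_Int[of w v I]
    by (cases "length v \<le> length w") (auto simp: Int_commute)
  show "Int_stable ?E"
    using * by (auto simp: Int_stable_def)
  show "?E \<subseteq> Pow (topspace (path_space I))"
    using cylinder_subset[of I] by auto
  show "emeasure M X = emeasure N X" if "X \<in> ?E" for X
    using that eq by (auto simp: M.emeasure_eq_measure N.emeasure_eq_measure)
  have "sigma_sets (topspace (path_space I)) ?E = sigma_sets (topspace (path_space I)) (cylinder I ` lists I)"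
    by (rule sigma_sets_eqI) (auto intro: sigma_sets.Empty)
  then show "sets M = sigma_sets (topspace (path_space I)) ?E"
    "sets N = sigma_sets (topspace (path_space I)) ?E"
    using bpm_sets[OF M] bpm_sets[OF N] sigma_sets_cylinders[OF assms(1)] by auto
  show "range (\<lambda>_ :: nat. topspace (path_space I)) \<subseteq> ?E"
    using cylinder_Nil[of I] by (auto intro!: image_eqI[of _ _ "[]"])
  show "(\<Union>n :: nat. topspace (path_space I)) = topspace (path_space I)" by simp
  show "emeasure M (topspace (path_space I)) \<noteq> \<infinity>" by simp
qed

lemma measure_cylinder_snoc:
  assumes "finite I" and M: "M \<in> borel_probability_measures (path_space I)"
  shows "measure M (cylinder I w) = (\<Sum>i\<in>I. measure M (cylinder I (w @ [i])))"
proof -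
  interpret prob_space M using bpm_prob_space[OF M] .
  show ?thesis
    unfolding cylinder_snoc_Union[of I w] using bpm_cylinder[OF M] assms(1) disjoint_cylinders[of _ _ I]
    by (intro finite_measure_finite_Union) (auto simp: disjoint_family_on_def)
qed

lemma measure_shift_cylinder:
  assumes "finite I" and M: "M \<in> borel_probability_measures (path_space I)"
  shows "measure M {x \<in> topspace (path_space I). (\<lambda>k. x (Suc k)) \<in> cylinder I w} =
    (\<Sum>i\<in>I. measure M (cylinder I (i # w)))"
proof -
  interpret prob_space M using bpm_prob_space[OF M] .
  show ?thesis
    unfolding cylinder_Cons_Union using bpm_cylinder[OF M] assms(1) disjoint_cylinders[of _ _ I]
    by (intro finite_measure_finite_Union) (auto simp: disjoint_family_on_def)
qed

lemma shift_measurable: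
  assumes "finite I" and M: "M \<in> borel_probability_measures (path_space I)"
    and N: "N \<in> borel_probability_measures (path_space I)"
  shows "(\<lambda>x k. x (Suc k)) \<in> measurable M N"
proof (rule measurable_sigma_sets)
  show "sets N = sigma_sets (topspace (path_space I)) (cylinder I ` lists I)"
    using bpm_sets[OF N] sigma_sets_cylinders[OF assms(1)] by simp
  show "cylinder I ` lists I \<subseteq> Pow (topspace (path_space I))"
    using cylinder_subset[of I] by auto
  show "(\<lambda>x k. x (Suc k)) \<in> space M \<rightarrow> topspace (path_space I)"
    using bpm_space[OF M] by (auto simp: topspace_path_space)
  fix A assume "A \<in> cylinder I ` lists I"
  then obtain w where w: "A = cylinder I w" by blast
  have "(\<lambda>x k. x (Suc k)) -` A \<inter> space M =
      {x \<in> topspace (path_space I). (\<lambda>k. x (Suc k)) \<in> cylinder I w}"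
    using bpm_space[OF M] w by auto
  also have "\<dots> \<in> sets M"
    unfolding cylinder_Cons_Union using bpm_cylinder[OF M] assms(1)
    by (intro sets.finite_UN) auto
  finally show "(\<lambda>x k. x (Suc k)) -` A \<inter> space M \<in> sets M" .
qed

section \<open>Bernoulli measures\<close>

definition bernoulli :: "'i set \<Rightarrow> ('i \<Rightarrow> real) \<Rightarrow> (nat \<Rightarrow> 'i) measure"
  where "bernoulli I p = (\<Pi>\<^sub>M k\<in>UNIV. point_measure I (\<lambda>i. ennreal (p i)))"

text \<open>The product \<sigma>-algebra of the discrete factors is the Borel one: sets given by one
  coordinate are open, and the cylinders, which generate the Borel sets, are finite-dimensional
  product sets.\<close>

lemma
  assumes "finite I" and p: "p \<in> prob_simplex I"
  shows bernoulli_bpm: "bernoulli I p \<in> borel_probability_measures (path_space I)"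
    and bernoulli_cylinder: "w \<in> lists I \<Longrightarrow>
      measure (bernoulli I p) (cylinder I w) = prod_list (map p w)"
proof -
  let ?P = "point_measure I (\<lambda>i. ennreal (p i))"
  have "prob_space ?P"
    using p assms(1) by (intro prob_space_point_measure) (auto simp: prob_simplex_def)
  then interpret product_prob_space "\<lambda>_ :: nat. ?P" UNIV
    unfolding product_prob_space_def product_prob_space_axioms_def product_sigma_finite_def
    by (auto intro: prob_space_imp_sigma_finite)
  have sp: "space (bernoulli I p) = topspace (path_space I)"
    by (auto simp: bernoulli_def space_PiM space_point_measure topspace_path_space PiE_def)
  have cyl: "cylinder I w = prod_emb UNIV (\<lambda>_. ?P) {..<length w} (Pi\<^sub>E {..<length w} (\<lambda>k. {w ! k}))" for w
    by (auto simp: cylinder_eq prod_emb_def space_point_measure PiE_iff)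
  let ?B = "sigma_sets (topspace (path_space I)) {U. openin (path_space I) U}"
  have "sets (bernoulli I p) = ?B"
  proof
    have "sets (bernoulli I p) = sigma_sets (topspace (path_space I))
        {{f \<in> topspace (path_space I). f k \<in> A} |k A. A \<in> Pow I}"
      unfolding bernoulli_def sets_PiM_single
      by (simp add: space_point_measure sets_point_measure topspace_path_space PiE_def Pi_def)
    also have "\<dots> \<subseteq> ?B"
    proof (rule sigma_sets_mono)
      have "openin (path_space I) {f \<in> topspace (path_space I). f k \<in> A}" if "A \<subseteq> I" for k A
        by (rule openin_continuous_map_preimage[where Y = "discrete_topology I"])
          (use that in \<open>auto intro: continuous_map_path_space_apply\<close>)
      then show "{{f \<in> topspace (path_space I). f k \<in> A} |k A. A \<in> Pow I} \<subseteq>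
          ?B"
        by auto
    qed
    finally show "sets (bernoulli I p) \<subseteq> ?B" .
    have "cylinder I w \<in> sets (bernoulli I p)" if "w \<in> lists I" for w
      unfolding cyl bernoulli_def using that
      by (intro sets_PiM_I) (auto simp: sets_point_measure)
    then show "?B \<subseteq> sets (bernoulli I p)"
      unfolding sigma_sets_cylinders[OF assms(1)] unfolding sp[symmetric] by (intro sets.sigma_sets_subset) auto
  qed
  then show "bernoulli I p \<in> borel_probability_measures (path_space I)"
    using sp P.prob_space_axioms by (simp add: borel_probability_measures_def bernoulli_def)
  assume w: "w \<in> lists I"
  then have wk: "w ! k \<in> I" if "k < length w" for k using that by auto
  have "emeasure (bernoulli I p) (cylinder I w) = (\<Prod>k<length w. emeasure ?P {w ! k})"
    unfolding cyl bernoulli_def using wk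
    by (intro emeasure_PiM_emb) (auto simp: sets_point_measure)
  also have "\<dots> = (\<Prod>k<length w. ennreal (p (w ! k)))"
    using wk assms(1) by (intro prod.cong) (auto simp: emeasure_point_measure_finite)
  also have "\<dots> = ennreal (\<Prod>k<length w. p (w ! k))"
    using prob_simplex_nonneg[OF p] by (intro prod_ennreal) auto
  finally have "measure (bernoulli I p) (cylinder I w) = (\<Prod>k<length w. p (w ! k))"
    using prob_simplex_nonneg[OF p] by (simp add: measure_def prod_nonneg)
  also have "\<dots> = prod_list (map p w)"
    by (simp add: prod.list_conv_set_nth atLeast0LessThan)
  finally show "measure (bernoulli I p) (cylinder I w) = prod_list (map p w)" .
qed

section \<open>Bounded harmonic functions\<close>

definition words :: "'i set \<Rightarrow> nat \<Rightarrow> 'i list set"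
  where "words I n = {w \<in> lists I. length w = n}"

lemma words_0: "words I 0 = {[]}"
  by (auto simp: words_def)

lemma finite_words: "finite I \<Longrightarrow> finite (words I n)"
  using finite_lists_length_eq[of I n] by (simp add: words_def lists_eq_set conj_commute)

lemma sum_words_Suc:
  assumes "finite I"
  shows "(\<Sum>w\<in>words I (Suc n). f w) = (\<Sum>w\<in>words I n. \<Sum>i\<in>I. f (w @ [i]))"
proof -
  have "words I (Suc n) = (\<lambda>(w, i). w @ [i]) ` (words I n \<times> I)"
  proof
    show "words I (Suc n) \<subseteq> (\<lambda>(w, i). w @ [i]) ` (words I n \<times> I)"
    proof
      fix w assume w: "w \<in> words I (Suc n)"
      then obtain v i where "w = v @ [i]"
        by (cases w rule: rev_cases) (auto simp: words_def)
      with w show "w \<in> (\<lambda>(w, i). w @ [i]) ` (words I n \<times> I)"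
        by (intro image_eqI[of _ _ "(v, i)"]) (auto simp: words_def)
    qed
  qed (auto simp: words_def)
  moreover have "inj_on (\<lambda>(w, i). w @ [i]) (words I n \<times> I)"
    by (auto simp: inj_on_def)
  ultimately have "(\<Sum>w\<in>words I (Suc n). f w) = (\<Sum>(w, i)\<in>words I n \<times> I. f (w @ [i]))"
    by (simp add: sum.reindex case_prod_unfold)
  then show ?thesis by (simp add: sum.cartesian_product)
qed

locale weights =
  fixes I :: "'i set" and p :: "'i \<Rightarrow> real"
  assumes fin: "finite I" and p: "p \<in> prob_simplex I"
begin

abbreviation weight :: "'i list \<Rightarrow> real"
  where "weight w \<equiv> prod_list (map p w)"

text \<open>For harmonic \<open>f\<close> this is the second moment at time \<open>n\<close> of the
  martingale that \<open>f\<close> defines along a Bernoulli path.\<close>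

definition energy :: "('i list \<Rightarrow> real) \<Rightarrow> nat \<Rightarrow> real"
  where "energy f n = (\<Sum>w\<in>words I n. weight w * (f w)\<^sup>2)"

definition harmonic :: "('i list \<Rightarrow> real) \<Rightarrow> bool"
  where "harmonic f \<longleftrightarrow> (\<forall>w\<in>lists I. f w = (\<Sum>i\<in>I. p i * f (w @ [i])))"

lemma weight_nonneg: "0 \<le> weight w"
  by (induction w) (auto simp: prob_simplex_nonneg[OF p])

lemma sum_p: "sum p I = 1" using p by (simp add: prob_simplex_def)

text \<open>Pythagoras for martingales: given the past, the increment has mean 0, so the cross term
  disappears and the squares of the increments add up.\<close>

lemma energy_Suc:
  assumes "harmonic f"
  shows "energy f (Suc n) = energy f n +
    (\<Sum>w\<in>words I n. weight w * (\<Sum>i\<in>I. p i * (f (w @ [i]) - f w)\<^sup>2))"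
proof -
  have "(\<Sum>i\<in>I. p i * (f (w @ [i]))\<^sup>2) = (f w)\<^sup>2 + (\<Sum>i\<in>I. p i * (f (w @ [i]) - f w)\<^sup>2)"
    if "w \<in> words I n" for w
  proof -
    have "w \<in> lists I" using that by (simp add: words_def)
    then have *: "(\<Sum>i\<in>I. p i * f (w @ [i])) = f w" using assms by (simp add: harmonic_def)
    have "(\<Sum>i\<in>I. p i * (f (w @ [i]) - f w)\<^sup>2) =
        (\<Sum>i\<in>I. p i * (f (w @ [i]))\<^sup>2 - 2 * f w * (p i * f (w @ [i])) + (f w)\<^sup>2 * p i)"
      by (simp add: power2_eq_square algebra_simps)
    also have "\<dots> = (\<Sum>i\<in>I. p i * (f (w @ [i]))\<^sup>2) - 2 * f w * f w + (f w)\<^sup>2 * 1"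
      by (simp add: sum.distrib sum_subtractf * sum_p flip: sum_distrib_left)
    finally show ?thesis by (simp add: power2_eq_square)
  qed
  then have "(\<Sum>w\<in>words I n. weight w * (\<Sum>i\<in>I. p i * (f (w @ [i]))\<^sup>2)) =
      (\<Sum>w\<in>words I n. weight w * ((f w)\<^sup>2 + (\<Sum>i\<in>I. p i * (f (w @ [i]) - f w)\<^sup>2)))"
    by (intro sum.cong) auto
  then show ?thesis
    unfolding energy_def sum_words_Suc[OF fin]
    by (simp add: sum_distrib_left sum.distrib distrib_left mult.assoc)
qed

lemma energy_mono:
  assumes "harmonic f" "m \<le> n"
  shows "energy f m \<le> energy f n"
  using assms(2)
proof (induction n rule: dec_induct)
  case (step n)
  have "0 \<le> (\<Sum>w\<in>words I n. weight w * (\<Sum>i\<in>I. p i * (f (w @ [i]) - f w)\<^sup>2))"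
    using weight_nonneg prob_simplex_nonneg[OF p] by (intro sum_nonneg mult_nonneg_nonneg) auto
  then show ?case using step energy_Suc[OF assms(1), of n] by simp
qed simp

lemma energy_bounded:
  assumes "\<And>w. w \<in> lists I \<Longrightarrow> \<bar>f w\<bar> \<le> K"
  shows "energy f n \<le> K\<^sup>2"
proof -
  have "(\<Sum>w\<in>words I n. weight w) = 1"
  proof (induction n)
    case (Suc n)
    then show ?case
      by (simp add: sum_words_Suc[OF fin] sum_p flip: sum_distrib_left)
  qed (simp add: words_0)
  moreover have "energy f n \<le> (\<Sum>w\<in>words I n. weight w * K\<^sup>2)"
    unfolding energy_def
  proof (intro sum_mono mult_left_mono weight_nonneg)
    fix w assume "w \<in> words I n"
    then have "\<bar>f w\<bar> \<le> K" using assms by (simp add: words_def)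
    then have "\<bar>f w\<bar>\<^sup>2 \<le> K\<^sup>2" by (intro power_mono) auto
    then show "(f w)\<^sup>2 \<le> K\<^sup>2" by simp
  qed
  ultimately show ?thesis by (simp flip: sum_distrib_right)
qed

text \<open>
  The increments \<open>f (w @ [i]) - f w\<close> are again harmonic, so their energy is nondecreasing; being
  summable, it vanishes.
\<close>

lemma bounded_harmonic_const:
  assumes f: "harmonic f" and bdd: "\<And>w. w \<in> lists I \<Longrightarrow> \<bar>f w\<bar> \<le> K"
    and swap: "\<And>w i j. w \<in> lists I \<Longrightarrow> i \<in> I \<Longrightarrow> j \<in> I \<Longrightarrow> f (w @ [i, j]) = f (w @ [j, i])"
    and "w \<in> lists I" "0 < weight w"
  shows "f w = f []"
  using assms(4,5)
proof (induction w rule: rev_induct)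
  case (snoc i w)
  then have w: "w \<in> lists I" "i \<in> I" by auto
  have pos: "0 < p i" "0 < weight w"
    using snoc.prems(2) weight_nonneg[of w] prob_simplex_nonneg[OF p, of i] by (auto simp: zero_less_mult_iff)
  define h where "h = (\<lambda>w. f (w @ [i]) - f w)"
  have h: "harmonic h"
    unfolding harmonic_def
  proof
    fix v assume v: "v \<in> lists I"
    \<comment> \<open>Exchanging the last two letters lets the average over \<open>j\<close> pass
      under the appended \<open>i\<close>. This is where commutativity enters.\<close>
    have "(\<Sum>j\<in>I. p j * h (v @ [j])) = (\<Sum>j\<in>I. p j * f ((v @ [i]) @ [j])) - (\<Sum>j\<in>I. p j * f (v @ [j]))"
      using swap[OF v w(2)] by (simp add: h_def right_diff_distrib sum_subtractf)
    also have "\<dots> = h v"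
      using f v w by (simp add: harmonic_def h_def del: append_assoc)
    finally show "h v = (\<Sum>j\<in>I. p j * h (v @ [j]))" by simp
  qed
  have step: "p i * energy h n \<le> energy f (Suc n) - energy f n" for n
  proof -
    have "p i * energy h n = (\<Sum>w\<in>words I n. weight w * (p i * (f (w @ [i]) - f w)\<^sup>2))"
      by (simp add: energy_def h_def sum_distrib_left algebra_simps)
    also have "\<dots> \<le> (\<Sum>w\<in>words I n. weight w * (\<Sum>i\<in>I. p i * (f (w @ [i]) - f w)\<^sup>2))"
      using w(2) fin prob_simplex_nonneg[OF p]
      by (intro sum_mono mult_left_mono weight_nonneg member_le_sum) auto
    also have "\<dots> = energy f (Suc n) - energy f n"
      using energy_Suc[OF f, of n] by simp
    finally show ?thesis .
  qed
  define m where "m = length w"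
  \<comment> \<open>Each of the \<open>N\<close> steps after time \<open>m\<close> raises the
    bounded energy of \<open>f\<close> by at least \<open>p i * energy h m\<close>.\<close>
  have "real N * (p i * energy h m) \<le> K\<^sup>2" for N
  proof -
    have "real N * (p i * energy h m) = (\<Sum>n<N. p i * energy h m)" by simp
    also have "\<dots> \<le> (\<Sum>n<N. energy f (Suc (m + n)) - energy f (m + n))"
    proof (rule sum_mono)
      fix n
      have "p i * energy h m \<le> p i * energy h (m + n)"
        using energy_mono[OF h, of m "m + n"] pos by simp
      then show "p i * energy h m \<le> energy f (Suc (m + n)) - energy f (m + n)"
        using step[of "m + n"] by simp
    qed
    also have "\<dots> = energy f (m + N) - energy f m"
      using sum_lessThan_telescope[of "\<lambda>n. energy f (m + n)" N] by simp
    also have "\<dots> \<le> K\<^sup>2"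
    proof -
      have "0 \<le> energy f m"
        unfolding energy_def using weight_nonneg by (intro sum_nonneg) auto
      then show ?thesis using energy_bounded[of f K "m + N", OF bdd] by simp
    qed
    finally show ?thesis .
  qed
  then have "p i * energy h m \<le> 0"
    using reals_Archimedean3[of "p i * energy h m"] by (meson not_le)
  then have "energy h m \<le> 0" using pos by (simp add: mult_le_0_iff)
  moreover have "weight w * (h w)\<^sup>2 \<le> energy h m"
    unfolding energy_def using w(1) weight_nonneg finite_words[OF fin]
    by (intro member_le_sum) (auto simp: m_def words_def)
  ultimately have "weight w * (h w)\<^sup>2 \<le> 0" by linarith
  then have "h w = 0" using pos(2) by (simp add: mult_le_0_iff)
  then show ?case using snoc.IH w pos by (simp add: h_def)
qed simp

lemma dominated_exchangeable:
  fixes \<nu> :: "'i list \<Rightarrow> real"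
  assumes nn: "\<And>w. w \<in> lists I \<Longrightarrow> 0 \<le> \<nu> w" and add: "\<And>w. w \<in> lists I \<Longrightarrow> \<nu> w = (\<Sum>i\<in>I. \<nu> (w @ [i]))"
    and swap: "\<And>w i j. w \<in> lists I \<Longrightarrow> i \<in> I \<Longrightarrow> j \<in> I \<Longrightarrow> \<nu> (w @ [i, j]) = \<nu> (w @ [j, i])"
    and dom: "\<And>w. w \<in> lists I \<Longrightarrow> \<nu> w \<le> K * weight w"
    and w: "w \<in> lists I"
  shows "\<nu> w = \<nu> [] * weight w"
proof (cases "weight w = 0")
  case True
  then show ?thesis using nn[OF w] dom[OF w] by simp
next
  case False
  define f where "f = (\<lambda>w. \<nu> w / weight w)"
  have "harmonic f"
    unfolding harmonic_def
  proof
    fix v assume v: "v \<in> lists I"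
    \<comment> \<open>For \<open>p i = 0\<close> the division by the weight of
      \<open>v @ [i]\<close> is void, but domination gives
      \<open>\<nu> (v @ [i]) = 0\<close>.\<close>
    have "p i * f (v @ [i]) = \<nu> (v @ [i]) / weight v" if "i \<in> I" for i
      using nn[of "v @ [i]"] dom[of "v @ [i]"] that v by (cases "p i = 0") (auto simp: f_def)
    then have "(\<Sum>i\<in>I. p i * f (v @ [i])) = (\<Sum>i\<in>I. \<nu> (v @ [i])) / weight v"
      by (simp add: sum_divide_distrib)
    then show "f v = (\<Sum>i\<in>I. p i * f (v @ [i]))"
      using add[OF v] by (simp add: f_def)
  qed
  moreover have "\<bar>f v\<bar> \<le> \<bar>K\<bar>" if "v \<in> lists I" for v
    using nn[OF that] dom[OF that] weight_nonneg[of v]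
    by (cases "weight v = 0") (auto simp: f_def divide_le_eq intro: order_trans[OF _ mult_right_mono])
  moreover have "f (v @ [i, j]) = f (v @ [j, i])" if "v \<in> lists I" "i \<in> I" "j \<in> I" for v i j
    using swap[OF that] by (simp add: f_def mult.commute)
  ultimately have "f w = f []"
    using w False weight_nonneg[of w] by (intro bounded_harmonic_const) auto
  then show ?thesis using False by (simp add: f_def field_simps)
qed

end

section \<open>Ergodic central measures\<close>

lemma continuous_on_weight [continuous_intros]:
  "continuous_on S (\<lambda>p :: 'i \<Rightarrow> real. prod_list (map p w))"
  by (induction w) (auto intro!: continuous_intros)

locale exchangeable =
  fixes I :: "'i set" and \<sigma> :: "'i \<Rightarrow> 'a :: ab_group_add"
  assumes fin: "finite I"
begin

definition homogeneous_relation :: "'i list \<Rightarrow> 'i list \<Rightarrow> bool" where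
  "homogeneous_relation v w \<longleftrightarrow> v \<in> lists I \<and> w \<in> lists I \<and> length v = length w \<and>
     sum_list (map \<sigma> v) = sum_list (map \<sigma> w)"

text \<open>With \<open>\<sigma> = frac \<circ> s\<close> these are the central measures: two paths
  from the identity lead to the same vertex iff their marks have the same sum in the group of
  fractions.\<close>

definition exch :: "(nat \<Rightarrow> 'i) measure set" where
  "exch = {\<nu> \<in> borel_probability_measures (path_space I).
     \<forall>v w. homogeneous_relation v w \<longrightarrow> measure \<nu> (cylinder I v) = measure \<nu> (cylinder I w)}"

definition ergodic :: "(nat \<Rightarrow> 'i) measure set" where
  "ergodic =
     {\<nu> \<in> exch.
        \<forall>\<mu>\<^sub>1\<in>exch. \<forall>\<mu>\<^sub>2\<in>exch. \<forall>t. 0 < t \<and> t < 1 \<and>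
          (\<forall>A\<in>sets \<nu>. measure \<nu> A = t * measure \<mu>\<^sub>1 A + (1 - t) * measure \<mu>\<^sub>2 A) \<longrightarrow> \<mu>\<^sub>1 = \<mu>\<^sub>2}"

text \<open>The parameters in the simplex whose Bernoulli measure lies in \<open>exch\<close>;
  eventually shown to be the same set as \<open>toric\<close>.\<close>

definition variety :: "('i \<Rightarrow> real) set" where
  "variety = {p \<in> prob_simplex I.
     \<forall>v w. homogeneous_relation v w \<longrightarrow> prod_list (map p v) = prod_list (map p w)}"

lemma exch_bpm: "\<nu> \<in> exch \<Longrightarrow> \<nu> \<in> borel_probability_measures (path_space I)"
  by (simp add: exch_def)

lemma exch_prob_space: "\<nu> \<in> exch \<Longrightarrow> prob_space \<nu>"
  by (rule bpm_prob_space[OF exch_bpm])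

lemma exchD:
  "\<nu> \<in> exch \<Longrightarrow> v \<in> lists I \<Longrightarrow> w \<in> lists I \<Longrightarrow> length v = length w \<Longrightarrow>
    sum_list (map \<sigma> v) = sum_list (map \<sigma> w) \<Longrightarrow> measure \<nu> (cylinder I v) = measure \<nu> (cylinder I w)"
  unfolding exch_def homogeneous_relation_def by blast

lemma exch_Cons_snoc:
  "\<nu> \<in> exch \<Longrightarrow> w \<in> lists I \<Longrightarrow> i \<in> I \<Longrightarrow>
    measure \<nu> (cylinder I (i # w)) = measure \<nu> (cylinder I (w @ [i]))"
  by (rule exchD) (auto simp: add.commute)

lemma measure_cylinder_Nil: "\<nu> \<in> exch \<Longrightarrow> measure \<nu> (cylinder I []) = 1"
  using prob_space.prob_space[OF exch_prob_space] bpm_space[OF exch_bpm] by (simp add: cylinder_Nil)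

lemma bernoulli_ergodic:
  assumes pV: "p \<in> variety"
  shows "bernoulli I p \<in> ergodic"
proof -
  have pS: "p \<in> prob_simplex I" using pV by (simp add: variety_def)
  note bpm = bernoulli_bpm[OF fin pS] and cyl = bernoulli_cylinder[OF fin pS]
  interpret weights I p by unfold_locales (use fin pS in auto)
  have exch: "bernoulli I p \<in> exch"
  proof -
    have "measure (bernoulli I p) (cylinder I v) = measure (bernoulli I p) (cylinder I w)"
      if "homogeneous_relation v w" for v w
    proof -
      have "weight v = weight w" using pV that by (simp add: variety_def)
      with that cyl[of v] cyl[of w] show ?thesis by (simp add: homogeneous_relation_def)
    qed
    with bpm show ?thesis by (simp add: exch_def)
  qed
  have dominated: "measure \<mu> (cylinder I w) = weight w"
    if \<mu>: "\<mu> \<in> exch" and K: "\<And>w. w \<in> lists I \<Longrightarrow> measure \<mu> (cylinder I w) \<le> K * weight w"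
      and w: "w \<in> lists I" for \<mu> K w
  proof -
    have "measure \<mu> (cylinder I w) = measure \<mu> (cylinder I []) * weight w"
    proof (rule dominated_exchangeable[OF _ _ _ K w])
      show "measure \<mu> (cylinder I v) = (\<Sum>i\<in>I. measure \<mu> (cylinder I (v @ [i])))" for v
        by (rule measure_cylinder_snoc[OF fin exch_bpm[OF \<mu>]])
      show "measure \<mu> (cylinder I (v @ [i, j])) = measure \<mu> (cylinder I (v @ [j, i]))"
        if "v \<in> lists I" "i \<in> I" "j \<in> I" for v i j
        using that by (intro exchD[OF \<mu>]) (auto simp: add.commute)
    qed auto
    then show ?thesis by (simp add: measure_cylinder_Nil[OF \<mu>])
  qed
  have "\<mu>\<^sub>1 = \<mu>\<^sub>2"
    if \<mu>: "\<mu>\<^sub>1 \<in> exch" "\<mu>\<^sub>2 \<in> exch" and t: "0 < t" "t < 1"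
      and comb: "\<forall>A\<in>sets (bernoulli I p). measure (bernoulli I p) A = t * measure \<mu>\<^sub>1 A + (1 - t) * measure \<mu>\<^sub>2 A"
    for \<mu>\<^sub>1 \<mu>\<^sub>2 t
  proof (rule bpm_eqI[OF fin exch_bpm[OF \<mu>(1)] exch_bpm[OF \<mu>(2)]])
    have eq: "weight w = t * measure \<mu>\<^sub>1 (cylinder I w) + (1 - t) * measure \<mu>\<^sub>2 (cylinder I w)"
      if "w \<in> lists I" for w
      using comb cyl[OF that] bpm_cylinder[OF bpm] by auto
    \<comment> \<open>A component of weight \<open>t\<close> is at most \<open>1 / t\<close> times
      the whole measure; this is the domination used for both components.\<close>
    have "measure \<mu>\<^sub>1 (cylinder I w) \<le> (1 / t) * weight w" if "w \<in> lists I" for w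
    proof -
      have "0 \<le> (1 - t) * measure \<mu>\<^sub>2 (cylinder I w)" using t by simp
      then have "t * measure \<mu>\<^sub>1 (cylinder I w) \<le> weight w"
        using eq[OF that] by linarith
      then show ?thesis using t by (simp add: pos_le_divide_eq mult.commute)
    qed
    moreover have "measure \<mu>\<^sub>2 (cylinder I w) \<le> (1 / (1 - t)) * weight w" if "w \<in> lists I" for w
    proof -
      have "0 \<le> t * measure \<mu>\<^sub>1 (cylinder I w)" using t by simp
      then have "(1 - t) * measure \<mu>\<^sub>2 (cylinder I w) \<le> weight w"
        using eq[OF that] by linarith
      then show ?thesis using t by (simp add: pos_le_divide_eq mult.commute)
    qed
    ultimately show "measure \<mu>\<^sub>1 (cylinder I w) = measure \<mu>\<^sub>2 (cylinder I w)" if "w \<in> lists I" for w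
      using dominated[OF \<mu>(1) _ that] dominated[OF \<mu>(2) _ that] by metis
  qed
  with exch show ?thesis unfolding ergodic_def by blast
qed

section \<open>Ergodic measures are Bernoulli\<close>

definition shifted_conditional :: "(nat \<Rightarrow> 'i) measure \<Rightarrow> (nat \<Rightarrow> 'i) set \<Rightarrow> (nat \<Rightarrow> 'i) measure" where
  "shifted_conditional \<nu> D = distr (uniform_measure \<nu> D) \<nu> (\<lambda>x k. x (Suc k))"

lemma
  assumes \<nu>: "\<nu> \<in> borel_probability_measures (path_space I)" and D: "D \<in> sets \<nu>" "measure \<nu> D \<noteq> 0"
  shows shifted_conditional_bpm: "shifted_conditional \<nu> D \<in> borel_probability_measures (path_space I)"
    and shifted_conditional_measure: "A \<in> sets \<nu> \<Longrightarrow> measure (shifted_conditional \<nu> D) A =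
      measure \<nu> (D \<inter> ((\<lambda>x k. x (Suc k)) -` A \<inter> space \<nu>)) / measure \<nu> D"
proof -
  interpret prob_space \<nu> using bpm_prob_space[OF \<nu>] .
  have D0: "emeasure \<nu> D \<noteq> 0" "emeasure \<nu> D \<noteq> \<infinity>"
    using D by (auto simp: emeasure_eq_measure)
  have sh: "(\<lambda>x k. x (Suc k)) \<in> measurable \<nu> \<nu>"
    by (rule shift_measurable[OF fin \<nu> \<nu>])
  then have sh': "(\<lambda>x k. x (Suc k)) \<in> measurable (uniform_measure \<nu> D) \<nu>"
    by (simp cong: measurable_cong_sets)
  interpret U: prob_space "uniform_measure \<nu> D"
    using D0 by (rule prob_space_uniform_measure)
  have "prob_space (shifted_conditional \<nu> D)"
    unfolding shifted_conditional_def using sh' by (rule U.prob_space_distr)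
  then show "shifted_conditional \<nu> D \<in> borel_probability_measures (path_space I)"
    using \<nu> by (simp add: borel_probability_measures_def shifted_conditional_def)
  assume A: "A \<in> sets \<nu>"
  then show "measure (shifted_conditional \<nu> D) A =
      measure \<nu> (D \<inter> ((\<lambda>x k. x (Suc k)) -` A \<inter> space \<nu>)) / measure \<nu> D"
    unfolding shifted_conditional_def using sh measurable_sets[OF sh A] D0
    by (subst measure_distr[OF sh' A]) (simp add: measure_uniform_measure)
qed

text \<open>\<open>i # w\<close> and \<open>w @ [i]\<close> have equal length and sum, so summing
  over a prepended letter equals summing over an appended one, which by additivity gives the measure
  of the cylinder of \<open>w\<close>. Cylinders determine the measure.\<close>

lemma exch_shift_invariant:
  assumes \<nu>: "\<nu> \<in> exch" and A: "A \<in> sets \<nu>"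
  shows "measure \<nu> ((\<lambda>x k. x (Suc k)) -` A \<inter> space \<nu>) = measure \<nu> A"
proof -
  note bpm = exch_bpm[OF \<nu>]
  interpret prob_space \<nu> using bpm_prob_space[OF bpm] .
  have sh: "(\<lambda>x k. x (Suc k)) \<in> measurable \<nu> \<nu>"
    by (rule shift_measurable[OF fin bpm bpm])
  have "distr \<nu> \<nu> (\<lambda>x k. x (Suc k)) = \<nu>"
  proof (rule bpm_eqI[OF fin _ bpm])
    show "distr \<nu> \<nu> (\<lambda>x k. x (Suc k)) \<in> borel_probability_measures (path_space I)"
      using bpm prob_space_distr[OF sh] by (simp add: borel_probability_measures_def)
    fix w assume w: "w \<in> lists I"
    have "measure (distr \<nu> \<nu> (\<lambda>x k. x (Suc k))) (cylinder I w) =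
        measure \<nu> {x \<in> topspace (path_space I). (\<lambda>k. x (Suc k)) \<in> cylinder I w}"
      by (subst measure_distr[OF sh bpm_cylinder[OF bpm]])
        (auto simp: bpm_space[OF bpm] intro!: arg_cong[where f = "measure \<nu>"])
    also have "\<dots> = (\<Sum>i\<in>I. measure \<nu> (cylinder I (i # w)))"
      by (rule measure_shift_cylinder[OF fin bpm])
    also have "\<dots> = (\<Sum>i\<in>I. measure \<nu> (cylinder I (w @ [i])))"
      using exch_Cons_snoc[OF \<nu> w] by (intro sum.cong) auto
    also have "\<dots> = measure \<nu> (cylinder I w)"
      by (rule measure_cylinder_snoc[OF fin bpm, symmetric])
    finally show "measure (distr \<nu> \<nu> (\<lambda>x k. x (Suc k))) (cylinder I w) = measure \<nu> (cylinder I w)" .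
  qed
  then show ?thesis
    using measure_distr[OF sh A] by simp
qed

definition marginal :: "(nat \<Rightarrow> 'i) measure \<Rightarrow> 'i \<Rightarrow> real"
  where "marginal \<nu> = (\<lambda>i. if i \<in> I then measure \<nu> (cylinder I [i]) else 0)"

lemma marginal_simplex:
  assumes "\<nu> \<in> exch"
  shows "marginal \<nu> \<in> prob_simplex I"
  using measure_cylinder_snoc[OF fin exch_bpm[OF assms], of "[]"] measure_cylinder_Nil[OF assms]
  by (simp add: prob_simplex_def marginal_def)

text \<open>
  An ergodic measure is the convex combination of its conditional laws given that the first edge
  is, respectively is not, \<open>i\<close>; both are central by commutativity.
\<close>

lemma ergodic_Cons:
  assumes \<nu>: "\<nu> \<in> ergodic" and i: "i \<in> I" and w: "w \<in> lists I"
  shows "measure \<nu> (cylinder I (i # w)) = marginal \<nu> i * measure \<nu> (cylinder I w)"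
proof -
  have ex: "\<nu> \<in> exch" using \<nu> by (simp add: ergodic_def)
  note bpm = exch_bpm[OF ex]
  interpret prob_space \<nu> using bpm_prob_space[OF bpm] .
  define m where "m = marginal \<nu> i"
  have mC: "m = measure \<nu> (cylinder I [i])" using i by (simp add: m_def marginal_def)
  have null_Cons: "measure \<nu> (cylinder I (j # v)) = 0" if "marginal \<nu> j = 0" "j \<in> I" for j v
  proof -
    have "cylinder I (j # v) \<subseteq> cylinder I [j]" by (auto simp: cylinder_eq)
    then have "measure \<nu> (cylinder I (j # v)) \<le> measure \<nu> (cylinder I [j])"
      using bpm_cylinder[OF bpm] by (intro finite_measure_mono) auto
    with that show ?thesis by (simp add: marginal_def measure_le_0_iff)
  qed
  have "0 \<le> m" "m \<le> 1" by (auto simp: mC)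
  \<comment> \<open>Both conditional laws exist only for \<open>0 < m < 1\<close>; otherwise the
    first mark is almost surely different from \<open>i\<close> or almost surely equal to
    \<open>i\<close>.\<close>
  then consider "m = 0" | "m = 1" | "0 < m" "m < 1" by linarith
  then have "measure \<nu> (cylinder I (i # w)) = m * measure \<nu> (cylinder I w)"
  proof cases
    case 1
    then show ?thesis using null_Cons[of i w] i by (simp add: m_def)
  next
    case 2
    have "sum (marginal \<nu>) (I - {i}) = 0"
      using marginal_simplex[OF ex] 2 i fin by (simp add: prob_simplex_def m_def sum.remove)
    then have "marginal \<nu> j = 0" if "j \<in> I - {i}" for j
      using that fin marginal_simplex[OF ex] by (subst (asm) sum_nonneg_eq_0_iff) (auto simp: prob_simplex_nonneg)
    then have "(\<Sum>j\<in>I - {i}. measure \<nu> (cylinder I (j # w))) = 0"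
      using null_Cons by (intro sum.neutral) auto
    then have "measure \<nu> (cylinder I (i # w)) = (\<Sum>j\<in>I. measure \<nu> (cylinder I (j # w)))"
      using i fin by (simp add: sum.remove)
    also have "\<dots> = (\<Sum>j\<in>I. measure \<nu> (cylinder I (w @ [j])))"
      using exch_Cons_snoc[OF ex w] by (intro sum.cong) auto
    finally show ?thesis using 2 measure_cylinder_snoc[OF fin bpm, of w] by simp
  next
    case 3
    let ?sh = "\<lambda>x k. x (Suc k)"
    define D where "D = cylinder I [i]"
    define D' where "D' = space \<nu> - D"
    have D: "D \<in> sets \<nu>" "D' \<in> sets \<nu>" using bpm_cylinder[OF bpm] by (auto simp: D_def D'_def)
    have mD: "measure \<nu> D = m" "measure \<nu> D' = 1 - m"
      using D(1) prob_compl[of D] by (auto simp: mC D_def D'_def)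
    have sh: "?sh \<in> measurable \<nu> \<nu>" by (rule shift_measurable[OF fin bpm bpm])
    note nz = mD 3
    \<comment> \<open>By shift invariance, the tails split according to the first mark recombine to
      \<open>\<nu>\<close> itself.\<close>
    have split: "measure \<nu> (D \<inter> (?sh -` A \<inter> space \<nu>)) + measure \<nu> (D' \<inter> (?sh -` A \<inter> space \<nu>)) = measure \<nu> A"
      if A: "A \<in> sets \<nu>" for A
    proof -
      have "?sh -` A \<inter> space \<nu> = (D \<inter> (?sh -` A \<inter> space \<nu>)) \<union> (D' \<inter> (?sh -` A \<inter> space \<nu>))"
        by (auto simp: D'_def)
      then have "measure \<nu> (?sh -` A \<inter> space \<nu>) =
          measure \<nu> (D \<inter> (?sh -` A \<inter> space \<nu>)) + measure \<nu> (D' \<inter> (?sh -` A \<inter> space \<nu>))"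
        using D measurable_sets[OF sh A]
        by (subst finite_measure_Union[symmetric]) (auto simp: D'_def)
      then show ?thesis using exch_shift_invariant[OF ex A] by simp
    qed
    have cylD: "D \<inter> (?sh -` cylinder I v \<inter> space \<nu>) = cylinder I (i # v)" for v
      using i by (auto simp: D_def cylinder_eq bpm_space[OF bpm] topspace_path_space nth_Cons' less_Suc_eq_0_disj)
    have \<mu>1: "measure (shifted_conditional \<nu> D) (cylinder I v) = measure \<nu> (cylinder I (i # v)) / m" for v
      using shifted_conditional_measure[OF bpm D(1) _ bpm_cylinder[OF bpm]] nz cylD by simp
    have \<mu>2: "measure (shifted_conditional \<nu> D') (cylinder I v) =
        (measure \<nu> (cylinder I v) - measure \<nu> (cylinder I (i # v))) / (1 - m)" for v
      using shifted_conditional_measure[OF bpm D(2) _ bpm_cylinder[OF bpm], of v] nz cylD[of v]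
        split[OF bpm_cylinder[OF bpm], of v] by simp
    have exch_i: "measure \<nu> (cylinder I (i # v)) = measure \<nu> (cylinder I (i # v'))"
      "measure \<nu> (cylinder I v) = measure \<nu> (cylinder I v')" if "homogeneous_relation v v'" for v v'
      using that i by (auto simp: homogeneous_relation_def intro!: exchD[OF ex])
    have "shifted_conditional \<nu> D \<in> exch"
      using shifted_conditional_bpm[OF bpm D(1)] nz exch_i by (simp add: exch_def \<mu>1)
    moreover have "shifted_conditional \<nu> D' \<in> exch"
    proof -
      have "measure (shifted_conditional \<nu> D') (cylinder I v) = measure (shifted_conditional \<nu> D') (cylinder I v')"
        if "homogeneous_relation v v'" for v v'
        using exch_i[OF that] by (simp add: \<mu>2)
      then show ?thesis
        using shifted_conditional_bpm[OF bpm D(2)] nz by (simp add: exch_def)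
    qed
    moreover have "measure \<nu> A = m * measure (shifted_conditional \<nu> D) A + (1 - m) * measure (shifted_conditional \<nu> D') A"
      if "A \<in> sets \<nu>" for A
      using shifted_conditional_measure[OF bpm D(1) _ that] shifted_conditional_measure[OF bpm D(2) _ that]
        split[OF that] nz by simp
    ultimately have "shifted_conditional \<nu> D = shifted_conditional \<nu> D'"
      using \<nu> 3 unfolding ergodic_def by blast
    then have "measure \<nu> (cylinder I (i # w)) / m =
        (measure \<nu> (cylinder I w) - measure \<nu> (cylinder I (i # w))) / (1 - m)"
      using \<mu>1[of w] \<mu>2[of w] by simp
    then show ?thesis using 3 by (simp add: field_simps)
  qed
  then show ?thesis by (simp add: m_def)
qed

lemma ergodic_cylinder:
  assumes \<nu>: "\<nu> \<in> ergodic" and "w \<in> lists I"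
  shows "measure \<nu> (cylinder I w) = prod_list (map (marginal \<nu>) w)"
  using assms(2)
proof (induction w)
  case Nil
  then show ?case using measure_cylinder_Nil[of \<nu>] \<nu> by (simp add: ergodic_def)
next
  case (Cons i w)
  then show ?case using ergodic_Cons[OF \<nu>, of i w] by simp
qed

lemma
  assumes \<nu>: "\<nu> \<in> ergodic"
  shows marginal_variety: "marginal \<nu> \<in> variety"
    and bernoulli_marginal: "bernoulli I (marginal \<nu>) = \<nu>"
proof -
  have ex: "\<nu> \<in> exch" using \<nu> by (simp add: ergodic_def)
  note S = marginal_simplex[OF ex]
  show "marginal \<nu> \<in> variety"
  proof -
    have "prod_list (map (marginal \<nu>) v) = prod_list (map (marginal \<nu>) w)"
      if "homogeneous_relation v w" for v w
      using that ergodic_cylinder[OF \<nu>, of v] ergodic_cylinder[OF \<nu>, of w] exchD[OF ex, of v w]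
      by (simp add: homogeneous_relation_def)
    with S show ?thesis by (simp add: variety_def)
  qed
  show "bernoulli I (marginal \<nu>) = \<nu>"
    using ergodic_cylinder[OF \<nu>] bernoulli_cylinder[OF fin S]
    by (intro bpm_eqI[OF fin bernoulli_bpm[OF fin S] exch_bpm[OF ex]]) auto
qed

lemma marginal_bernoulli:
  assumes "p \<in> variety"
  shows "marginal (bernoulli I p) = p"
proof
  fix i
  have "p \<in> prob_simplex I" using assms by (simp add: variety_def)
  then show "marginal (bernoulli I p) i = p i"
    using bernoulli_cylinder[OF fin, of p "[i]"] by (auto simp: marginal_def prob_simplex_def)
qed

section \<open>The weak topology\<close>

lemma compact_path_space: "compact_space (path_space I)"
  using fin by (simp add: path_space_def compact_space_product_topology compact_space_discrete_topology)

text \<open>Compactness yields a finite cover by cylinders on which \<open>f\<close> differs by less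
  than \<open>e / 2\<close> from its value at a centre; \<open>N\<close> is the largest length that
  occurs.\<close>

lemma path_space_uniformly_continuous:
  assumes f: "continuous_map (path_space I) euclideanreal f" and "0 < e"
  obtains N where "\<And>x y. x \<in> topspace (path_space I) \<Longrightarrow> y \<in> topspace (path_space I) \<Longrightarrow>
    (\<forall>k<N. x k = y k) \<Longrightarrow> \<bar>f x - f y\<bar> < e"
proof -
  let ?\<Omega> = "topspace (path_space I)"
  have "\<exists>n. \<forall>y\<in>cylinder I (map x [0..<n]). \<bar>f y - f x\<bar> < e / 2" if "x \<in> ?\<Omega>" for x
  proof -
    have "openin (path_space I) {y \<in> ?\<Omega>. f y \<in> ball (f x) (e / 2)}"
      using f by (rule openin_continuous_map_preimage) auto
    moreover have "x \<in> {y \<in> ?\<Omega>. f y \<in> ball (f x) (e / 2)}"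
      using that \<open>0 < e\<close> by simp
    ultimately obtain n where "cylinder I (map x [0..<n]) \<subseteq> {y \<in> ?\<Omega>. f y \<in> ball (f x) (e / 2)}"
      by (rule open_contains_cylinder)
    then show ?thesis by (intro exI[of _ n]) (auto simp: dist_real_def abs_minus_commute)
  qed
  then obtain n where n: "\<And>x y. x \<in> ?\<Omega> \<Longrightarrow> y \<in> cylinder I (map x [0..<n x]) \<Longrightarrow> \<bar>f y - f x\<bar> < e / 2"
    by metis
  define \<U> where "\<U> = (\<lambda>x. cylinder I (map x [0..<n x])) ` ?\<Omega>"
  have "\<exists>\<F>. finite \<F> \<and> \<F> \<subseteq> \<U> \<and> ?\<Omega> \<subseteq> \<Union>\<F>"
  proof (rule compactinD)
    show "compactin (path_space I) ?\<Omega>" using compact_path_space by (simp add: compact_space_def)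
    show "openin (path_space I) U" if "U \<in> \<U>" for U using that openin_cylinder by (auto simp: \<U>_def)
    show "?\<Omega> \<subseteq> \<Union>\<U>"
    proof
      fix x assume x: "x \<in> ?\<Omega>"
      then have "x \<in> cylinder I (map x [0..<n x])"
        by (intro cylinder_map_upt) (simp add: topspace_path_space)
      with x show "x \<in> \<Union>\<U>" by (auto simp: \<U>_def)
    qed
  qed
  then obtain S where S: "finite S" "S \<subseteq> ?\<Omega>" "?\<Omega> \<subseteq> (\<Union>x\<in>S. cylinder I (map x [0..<n x]))"
    unfolding \<U>_def by (metis (no_types, lifting) finite_subset_image)
  show ?thesis
  proof (rule that[of "Max (insert 0 (n ` S))"])
    fix x y assume xy: "x \<in> ?\<Omega>" "y \<in> ?\<Omega>" "\<forall>k<Max (insert 0 (n ` S)). x k = y k"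
    obtain z where z: "z \<in> S" "x \<in> cylinder I (map z [0..<n z])" using S xy(1) by blast
    have "n z \<le> Max (insert 0 (n ` S))" using S(1) z(1) by (intro Max_ge) auto
    then have "y \<in> cylinder I (map z [0..<n z])"
      using z(2) xy by (auto simp: cylinder_eq topspace_path_space)
    moreover have "z \<in> ?\<Omega>" using z(1) S(2) by blast
    ultimately have "\<bar>f x - f z\<bar> < e / 2" "\<bar>f y - f z\<bar> < e / 2"
      using n z(2) by blast+
    then show "\<bar>f x - f y\<bar> < e" by linarith
  qed
qed

text \<open>For a function of the first \<open>N\<close> marks the integral is a polynomial in
  \<open>p\<close>. By uniform continuity \<open>f\<close> is a uniform limit of such functions, so
  its integral is a limit of polynomials, uniformly in \<open>p\<close>.\<close>

lemma continuous_on_integral_bernoulli: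
  assumes f: "continuous_map (path_space I) euclideanreal f" and i0: "i0 \<in> I"
  shows "continuous_on (prob_simplex I) (\<lambda>p. \<integral>x. f x \<partial>bernoulli I p)"
proof -
  let ?\<Omega> = "topspace (path_space I)"
  \<comment> \<open>Padding a word with \<open>i0\<close> gives a path that agrees with
    \<open>x\<close> in the first \<open>N\<close> marks, to which uniform continuity
    applies.\<close>
  define g where "g = (\<lambda>w. f (\<lambda>k. if k < length w then w ! k else i0))"
  define F where "F = (\<lambda>N p. \<Sum>w\<in>words I N. g w * prod_list (map p w))"
  have bound: "\<bar>F N p - (\<integral>x. f x \<partial>bernoulli I p)\<bar> \<le> e"
    if p: "p \<in> prob_simplex I"
      and N: "\<And>x y. x \<in> ?\<Omega> \<Longrightarrow> y \<in> ?\<Omega> \<Longrightarrow> (\<forall>k<N. x k = y k) \<Longrightarrow> \<bar>f x - f y\<bar> < e" for N p e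
  proof -
    note bpm = bernoulli_bpm[OF fin p]
    interpret prob_space "bernoulli I p" using bpm_prob_space[OF bpm] .
    define fN where "fN = (\<lambda>x. \<Sum>w\<in>words I N. g w * indicator (cylinder I w) x)"
    have fN: "fN x = g (map x [0..<N])" if "x \<in> ?\<Omega>" for x
    proof -
      have "map x [0..<N] \<in> words I N" using that by (auto simp: words_def topspace_path_space)
      moreover have "indicator (cylinder I w) x = (if w = map x [0..<N] then 1 else 0 :: real)"
        if "w \<in> words I N" for w
        using that \<open>x \<in> ?\<Omega>\<close>
        by (auto simp: words_def cylinder_eq topspace_path_space indicator_def intro!: nth_equalityI)
      then have "fN x = (\<Sum>w\<in>words I N. if w = map x [0..<N] then g w else 0)"
        unfolding fN_def by (intro sum.cong) auto
      ultimately show ?thesis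
        using finite_words[OF fin, of N] by simp
    qed
    have close: "\<bar>fN x - f x\<bar> \<le> e" if "x \<in> ?\<Omega>" for x
      unfolding fN[OF that] g_def using that i0
      by (intro less_imp_le N) (auto simp: topspace_path_space)
    have int_fN: "integrable (bernoulli I p) fN"
      unfolding fN_def using bpm_cylinder[OF bpm]
      by (intro Bochner_Integration.integrable_sum integrable_mult_right integrable_real_indicator)
        (auto simp: emeasure_eq_measure)
    have meas: "f \<in> borel_measurable (bernoulli I p)"
    proof (rule borel_measurableI)
      fix S :: "real set" assume "open S"
      have "openin (path_space I) {x \<in> ?\<Omega>. f x \<in> S}"
        using f \<open>open S\<close> by (intro openin_continuous_map_preimage) auto
      moreover have "{x \<in> ?\<Omega>. f x \<in> S} = f -` S \<inter> space (bernoulli I p)"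
        using bpm_space[OF bpm] by auto
      ultimately show "f -` S \<inter> space (bernoulli I p) \<in> sets (bernoulli I p)"
        using bpm_sets[OF bpm] by auto
    qed
    have int_diff: "integrable (bernoulli I p) (\<lambda>x. fN x - f x)"
      using close meas borel_measurable_integrable[OF int_fN] bpm_space[OF bpm]
      by (intro integrable_const_bound[where B = e] AE_I2) auto
    have int_f: "integrable (bernoulli I p) f"
      using Bochner_Integration.integrable_diff[OF int_fN int_diff] by simp
    have "F N p = (\<integral>x. fN x \<partial>bernoulli I p)"
      unfolding fN_def F_def using bpm_cylinder[OF bpm] bernoulli_cylinder[OF fin p]
      by (subst Bochner_Integration.integral_sum)
        (auto simp: words_def emeasure_eq_measure intro!: sum.cong integrable_mult_right integrable_real_indicator)
    then have "\<bar>F N p - (\<integral>x. f x \<partial>bernoulli I p)\<bar> = \<bar>\<integral>x. fN x - f x \<partial>bernoulli I p\<bar>"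
      using int_fN int_f by simp
    also have "\<dots> \<le> (\<integral>x. \<bar>fN x - f x\<bar> \<partial>bernoulli I p)"
      by (rule integral_abs_bound)
    also have "\<dots> \<le> e"
      using close int_diff bpm_space[OF bpm] by (intro integral_le_const AE_I2) auto
    finally show ?thesis .
  qed
  have "uniform_limit (prob_simplex I) F (\<lambda>p. \<integral>x. f x \<partial>bernoulli I p) sequentially"
  proof (rule uniform_limitI)
    fix e :: real assume "e > 0"
    then obtain N where N: "\<And>x y. x \<in> ?\<Omega> \<Longrightarrow> y \<in> ?\<Omega> \<Longrightarrow> (\<forall>k<N. x k = y k) \<Longrightarrow> \<bar>f x - f y\<bar> < e / 2"
      using path_space_uniformly_continuous[OF f, of "e / 2"] by auto
    have "\<bar>F n p - (\<integral>x. f x \<partial>bernoulli I p)\<bar> < e" if "n \<ge> N" "p \<in> prob_simplex I" for n p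
    proof -
      have "\<bar>F n p - (\<integral>x. f x \<partial>bernoulli I p)\<bar> \<le> e / 2"
        using that by (intro bound N) auto
      then show ?thesis using \<open>e > 0\<close> by simp
    qed
    then show "\<forall>\<^sub>F n in sequentially. \<forall>p\<in>prob_simplex I. dist (F n p) (\<integral>x. f x \<partial>bernoulli I p) < e"
      by (auto simp: eventually_sequentially dist_real_def)
  qed
  moreover have "continuous_on (prob_simplex I) (F n)" for n
    unfolding F_def by (intro continuous_intros)
  ultimately show ?thesis
    by (intro uniform_limit_theorem[where F = sequentially and f = F]) auto
qed

lemma compact_variety: "compact variety"
proof -
  have "closed (\<Inter>(v, w)\<in>{(v, w). homogeneous_relation v w}. {p :: 'i \<Rightarrow> real. prod_list (map p v) = prod_list (map p w)})"
    by (intro closed_INT) (auto intro!: closed_Collect_eq continuous_on_weight)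
  then have "compact (prob_simplex I \<inter>
      (\<Inter>(v, w)\<in>{(v, w). homogeneous_relation v w}. {p. prod_list (map p v) = prod_list (map p w)}))"
    by (rule compact_Int_closed[OF compact_prob_simplex[OF fin]])
  also have "\<dots> = variety" by (auto simp: variety_def)
  finally show ?thesis .
qed

lemma bounded_continuous_path_space:
  assumes "continuous_map (path_space I) euclideanreal f"
  shows "bounded (f ` topspace (path_space I))"
proof -
  have "compactin euclideanreal (f ` topspace (path_space I))"
    using compact_path_space assms by (intro image_compactin[where X = "path_space I"]) (auto simp: compact_space_def)
  then show ?thesis by (simp add: compact_imp_bounded)
qed

lemma ergodic_subset_topspace: "ergodic \<subseteq> topspace (weak_topology (path_space I))"
proof -
  \<comment> \<open>The underlying set of \<open>weak_topology\<close> is the union of the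
    generating sets. The test function 0 with \<open>U = UNIV\<close> shows that it contains every
    Borel probability measure.\<close>
  have "borel_probability_measures (path_space I) =
      {M \<in> borel_probability_measures (path_space I). (\<integral>x. 0 \<partial>M) \<in> (UNIV :: real set)}" by simp
  then have "openin (weak_topology (path_space I)) (borel_probability_measures (path_space I))"
    unfolding weak_topology_def
    by (intro topology_generated_by_Basis CollectI exI[of _ "\<lambda>_. 0 :: real"] exI[of _ "UNIV :: real set"])
      (auto simp: image_constant_conv)
  then show ?thesis using openin_subset by (auto simp: ergodic_def exch_def)
qed

lemma continuous_map_bernoulli:
  assumes "i0 \<in> I"
  shows "continuous_map (top_of_set variety) (subtopology (weak_topology (path_space I)) ergodic) (bernoulli I)"
proof (rule continuous_map_into_subtopology)
  have VS: "variety \<subseteq> prob_simplex I" by (auto simp: variety_def)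
  have bpm: "bernoulli I p \<in> borel_probability_measures (path_space I)" if "p \<in> variety" for p
    using that VS by (intro bernoulli_bpm fin) auto
  have "bernoulli I ` topspace (top_of_set variety) \<subseteq> topspace (weak_topology (path_space I))"
    using bernoulli_ergodic ergodic_subset_topspace by auto
  note covered = this[unfolded weak_topology_def topology_generated_by_topspace]
  show "continuous_map (top_of_set variety) (weak_topology (path_space I)) (bernoulli I)"
    unfolding weak_topology_def
  proof (rule continuous_on_generated_topo[OF _ covered])
    fix W assume "W \<in> {{M \<in> borel_probability_measures (path_space I). (\<integral>x. f x \<partial>M) \<in> U} |f U.
      continuous_map (path_space I) euclideanreal f \<and> bounded (f ` topspace (path_space I)) \<and> open U}"
    then obtain f and U :: "real set" where W: "W = {M \<in> borel_probability_measures (path_space I). (\<integral>x. f x \<partial>M) \<in> U}"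
      and f: "continuous_map (path_space I) euclideanreal f" and U: "open U" by blast
    have "continuous_on variety (\<lambda>p. \<integral>x. f x \<partial>bernoulli I p)"
      using continuous_on_integral_bernoulli[OF f assms] VS by (rule continuous_on_subset)
    then have "openin (top_of_set variety) (variety \<inter> (\<lambda>p. \<integral>x. f x \<partial>bernoulli I p) -` U)"
      using U by (rule continuous_openin_preimage_gen)
    also have "variety \<inter> (\<lambda>p. \<integral>x. f x \<partial>bernoulli I p) -` U =
        bernoulli I -` W \<inter> topspace (top_of_set variety)"
      using bpm by (auto simp: W)
    finally show "openin (top_of_set variety) (bernoulli I -` W \<inter> topspace (top_of_set variety))" .
  qed
qed (use bernoulli_ergodic in auto)

text \<open>The event that the first mark is \<open>i\<close> is open and closed, so its indicator
  is an admissible test function for the weak topology.\<close>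

lemma continuous_map_marginal:
  "continuous_map (subtopology (weak_topology (path_space I)) ergodic) euclidean marginal"
proof -
  have "continuous_map (weak_topology (path_space I)) euclideanreal (\<lambda>\<nu>. marginal \<nu> i)" for i
  proof (cases "i \<in> I")
    case True
    define f :: "(nat \<Rightarrow> 'i) \<Rightarrow> real" where "f = (\<lambda>x. if x 0 = i then 1 else 0)"
    have f: "continuous_map (path_space I) euclideanreal f"
    proof -
      have "continuous_map (discrete_topology I) euclideanreal (\<lambda>j. if j = i then 1 else 0 :: real)"
        by simp
      from continuous_map_compose[OF continuous_map_path_space_apply this, of 0] show ?thesis
        by (simp add: f_def o_def)
    qed
    have int: "(\<integral>x. f x \<partial>M) = marginal M i" if M: "M \<in> borel_probability_measures (path_space I)" for M
    proof -
      have "(\<integral>x. f x \<partial>M) = (\<integral>x. indicator (cylinder I [i]) x \<partial>M)"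
        by (intro Bochner_Integration.integral_cong refl)
          (auto simp: f_def bpm_space[OF M] topspace_path_space cylinder_eq indicator_def)
      then show ?thesis using True bpm_cylinder[OF M] by (simp add: marginal_def)
    qed
    show ?thesis
      unfolding continuous_map_def
    proof (intro conjI allI impI)
      fix U :: "real set" assume "openin euclideanreal U"
      then have U: "open U" by simp
      have sub: "topspace (weak_topology (path_space I)) \<subseteq> borel_probability_measures (path_space I)"
        unfolding weak_topology_def topology_generated_by_topspace by auto
      have op: "openin (weak_topology (path_space I)) {M \<in> borel_probability_measures (path_space I). (\<integral>x. f x \<partial>M) \<in> U}"
        unfolding weak_topology_def using f U bounded_continuous_path_space[OF f]
        by (intro topology_generated_by_Basis) blast
      have "{M \<in> borel_probability_measures (path_space I). (\<integral>x. f x \<partial>M) \<in> U} =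
          {M \<in> topspace (weak_topology (path_space I)). marginal M i \<in> U}"
        using int sub openin_subset[OF op] by auto
      with op show "openin (weak_topology (path_space I)) {M \<in> topspace (weak_topology (path_space I)). marginal M i \<in> U}"
        by simp
    qed auto
  next
    case False
    then show ?thesis by (simp add: marginal_def)
  qed
  then have "continuous_map (weak_topology (path_space I)) (product_topology (\<lambda>_. euclideanreal) UNIV) marginal"
    by (intro continuous_map_coordinatewise_then_product) auto
  then show ?thesis
    by (simp add: euclidean_product_topology continuous_map_from_subtopology)
qed

text \<open>A continuous bijection from a compact space to a Hausdorff space. The source is compact
  as the image of the compact set \<open>variety\<close> under \<open>bernoulli I\<close>, so
  continuity enters in both directions of the correspondence.\<close>

lemma ergodic_homeomorphic:
  assumes i0: "i0 \<in> I" and F: "continuous_on variety F" "inj_on F variety" "F ` variety = closed_disk d"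
  shows "homeomorphic_map (subtopology (weak_topology (path_space I)) ergodic)
    (subtopology (Euclidean_space d) (closed_disk d)) (F \<circ> marginal)"
proof (rule continuous_imp_homeomorphic_map)
  let ?X = "subtopology (weak_topology (path_space I)) ergodic"
  have tX: "topspace ?X = ergodic" using ergodic_subset_topspace by auto
  have img: "bernoulli I ` variety = ergodic"
  proof
    show "ergodic \<subseteq> bernoulli I ` variety"
      using marginal_variety bernoulli_marginal by (metis imageI subsetI)
  qed (use bernoulli_ergodic in auto)
  have img': "marginal ` ergodic = variety"
    using img marginal_bernoulli by (force simp: image_comp[symmetric] simp flip: img)
  have disk: "subtopology (Euclidean_space d) (closed_disk d) = top_of_set (closed_disk d)"
  proof -
    have "closed_disk d \<subseteq> {x. \<forall>i\<ge>d. x i = 0}" by (auto simp: closed_disk_def topspace_Euclidean_space)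
    then show ?thesis
      by (simp add: Euclidean_space_def euclidean_product_topology subtopology_subtopology inf.absorb2)
  qed
  show "compact_space ?X"
  proof -
    have "compactin (top_of_set variety) variety"
      using compact_variety by (simp add: compactin_subtopology)
    from image_compactin[OF this continuous_map_bernoulli[OF i0]]
    show ?thesis
      unfolding img compactin_subtopology by (intro compact_space_subtopology) auto
  qed
  show "Hausdorff_space (subtopology (Euclidean_space d) (closed_disk d))"
    unfolding disk by (intro Hausdorff_space_subtopology) auto
  show "continuous_map ?X (subtopology (Euclidean_space d) (closed_disk d)) (F \<circ> marginal)"
    unfolding disk
  proof (rule continuous_map_compose[of _ "top_of_set variety"])
    show "continuous_map ?X (top_of_set variety) marginal"
      using continuous_map_marginal img' tX by (intro continuous_map_into_subtopology) auto
    show "continuous_map (top_of_set variety) (top_of_set (closed_disk d)) F"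
      using F by auto
  qed
  show "(F \<circ> marginal) ` topspace ?X = topspace (subtopology (Euclidean_space d) (closed_disk d))"
    unfolding disk tX image_comp[symmetric] img' F(3) by simp
  have "inj_on marginal ergodic"
    using bernoulli_marginal by (metis inj_onI)
  then show "inj_on (F \<circ> marginal) (topspace ?X)"
    unfolding tX using F(2) img' by (intro comp_inj_on) auto
qed

lemma nondegenerate_iff:
  assumes \<nu>: "\<nu> \<in> ergodic"
  shows "(\<forall>w\<in>lists I. measure \<nu> (cylinder I w) \<noteq> 0) \<longleftrightarrow> (\<forall>i\<in>I. 0 < marginal \<nu> i)"
proof
  assume *: "\<forall>w\<in>lists I. measure \<nu> (cylinder I w) \<noteq> 0"
  show "\<forall>i\<in>I. 0 < marginal \<nu> i"
  proof
    fix i assume "i \<in> I"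
    then have "measure \<nu> (cylinder I [i]) \<noteq> 0" using * by auto
    with \<open>i \<in> I\<close> show "0 < marginal \<nu> i" by (simp add: marginal_def zero_less_measure_iff)
  qed
next
  assume *: "\<forall>i\<in>I. 0 < marginal \<nu> i"
  show "\<forall>w\<in>lists I. measure \<nu> (cylinder I w) \<noteq> 0"
  proof
    fix w assume w: "w \<in> lists I"
    have "prod_list (map (marginal \<nu>) w) \<noteq> 0" using w * by (fastforce simp: prod_list_zero_iff)
    then show "measure \<nu> (cylinder I w) \<noteq> 0" using ergodic_cylinder[OF \<nu> w] by simp
  qed
qed

end

section \<open>Multiples in abelian groups\<close>

definition smul :: "nat \<Rightarrow> 'a :: ab_group_add \<Rightarrow> 'a"
  where "smul n a = sum_list (replicate n a)"

definition zmul :: "int \<Rightarrow> 'a :: ab_group_add \<Rightarrow> 'a"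
  where "zmul k a = smul (nat k) a - smul (nat (- k)) a"

lemma smul_simps [simp]: "smul 0 a = 0" "smul (Suc n) a = a + smul n a" "smul n 0 = 0"
  by (induction n) (auto simp: smul_def)

lemma smul_add: "smul (m + n) a = smul m a + smul n a"
  by (induction m) (auto simp: add.assoc)

lemma smul_distrib: "smul n (a + b) = smul n a + smul n b"
  by (induction n) (auto simp: algebra_simps)

lemma smul_diff: "smul n (a - b) = smul n a - smul n b"
  by (induction n) (auto simp: algebra_simps)

lemma smul_mult: "smul (m * n) a = smul m (smul n a)"
  by (induction m) (auto simp: smul_add)

lemma smul_sum: "smul n (\<Sum>i\<in>A. f i) = (\<Sum>i\<in>A. smul n (f i))"
  by (induction n) (auto simp: sum.distrib)

lemma zmul_diff_nat: "zmul (int m - int n) a = smul m a - smul n a"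
proof (cases "n \<le> m")
  case True
  then obtain k where "m = n + k" using le_Suc_ex by blast
  then show ?thesis by (simp add: zmul_def smul_add)
next
  case False
  then obtain k where "n = m + k" using le_Suc_ex by (metis nat_le_linear)
  then show ?thesis by (simp add: zmul_def smul_add)
qed

lemma zmul_of_nat [simp]: "zmul (int n) a = smul n a"
  using zmul_diff_nat[of n 0 a] by simp

lemma zmul_0 [simp]: "zmul 0 a = 0"
  by (simp add: zmul_def)

lemma zmul_add: "zmul (k + l) a = zmul k a + zmul l a"
proof -
  have "k + l = int (nat k + nat l) - int (nat (- k) + nat (- l))" by simp
  then have "zmul (k + l) a = smul (nat k + nat l) a - smul (nat (- k) + nat (- l)) a"
    by (metis zmul_diff_nat)
  then show ?thesis by (simp add: zmul_def smul_add)
qed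

lemma zmul_minus: "zmul (- k) a = - zmul k a"
  by (simp add: zmul_def)

lemma zmul_diff: "zmul (k - l) a = zmul k a - zmul l a"
  using zmul_add[of k "- l" a] by (simp add: zmul_minus)

lemma zmul_distrib: "zmul k (a + b) = zmul k a + zmul k b"
  by (simp add: zmul_def smul_distrib)

section \<open>Torsion in the rational tensor product\<close>

text \<open>
  Because of the rounding this is additive in \<open>r\<close> only for \<open>N\<close> divisible by the denominators
  involved, so a relation is killed for suitable \<open>N\<close>.
\<close>

definition clear_denominators :: "nat \<Rightarrow> ('a :: ab_group_add \<times> rat \<Rightarrow>\<^sub>0 int) \<Rightarrow> 'a" where
  "clear_denominators N f =
     (\<Sum>x\<in>Poly_Mapping.keys f. zmul (Poly_Mapping.lookup f x * \<lfloor>of_nat N * snd x\<rfloor>) (fst x))"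

lemma clear_denominators_superset:
  assumes "finite K" "Poly_Mapping.keys f \<subseteq> K"
  shows "clear_denominators N f =
    (\<Sum>x\<in>K. zmul (Poly_Mapping.lookup f x * \<lfloor>of_nat N * snd x\<rfloor>) (fst x))"
  unfolding clear_denominators_def using assms
  by (intro sum.mono_neutral_left) (auto simp: in_keys_iff)

lemma clear_denominators_diff:
  "clear_denominators N (f - g) = clear_denominators N f - clear_denominators N g"
proof -
  let ?K = "Poly_Mapping.keys f \<union> Poly_Mapping.keys g"
  have "Poly_Mapping.keys (f - g) \<subseteq> ?K" by (rule keys_diff)
  then show ?thesis
    by (subst (1 2 3) clear_denominators_superset[where K = ?K])
      (auto simp: lookup_minus left_diff_distrib zmul_diff sum_subtractf)
qed

lemma clear_denominators_frag_of:
  "clear_denominators N (frag_of (a, r)) = zmul \<lfloor>of_nat N * r\<rfloor> a"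
  by (simp add: clear_denominators_def)

text \<open>Quantifying over all multiples \<open>N * m\<close> is what makes the induction work:
  for a difference of two relations the product of their values of \<open>N\<close> serves
  both.\<close>

lemma bilinear_relations_clear:
  assumes "f \<in> bilinear_relations"
  shows "\<exists>N>0. \<forall>m. clear_denominators (N * m) f = 0"
  using assms
proof induction
  case zero
  then show ?case by (auto simp: clear_denominators_def)
next
  case (diff x y)
  then obtain M N where M: "M > 0" "\<And>m. clear_denominators (M * m) x = 0"
    and N: "N > 0" "\<And>m. clear_denominators (N * m) y = 0" by blast
  have "clear_denominators (M * N * m) (x - y) = 0" for m
    using M(2)[of "N * m"] N(2)[of "M * m"] by (simp add: clear_denominators_diff ac_simps)
  then show ?case using M(1) N(1) by (intro exI[of _ "M * N"]) simp
next
  case (left a b r)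
  then show ?case
    by (auto simp: clear_denominators_diff clear_denominators_frag_of zmul_distrib)
next
  case (right a r q)
  obtain k l where kl: "quotient_of r = (k, l)" by (cases "quotient_of r")
  then have l: "l > 0" "r = of_int k / of_int l"
    by (auto simp: quotient_of_denom_pos quotient_of_div)
  have "clear_denominators (nat l * m) (frag_of (a, r + q) - frag_of (a, r) - frag_of (a, q)) = 0" for m
  proof -
    have r: "of_nat (nat l * m) * r = of_int (k * int m)" using l by (simp add: field_simps)
    \<comment> \<open>Once the multiple of \<open>r\<close> is an integer, it can be pulled out of
      the floor, whatever \<open>q\<close> is.\<close>
    have "\<lfloor>of_nat (nat l * m) * (r + q)\<rfloor> = k * int m + \<lfloor>of_nat (nat l * m) * q\<rfloor>"
      unfolding distrib_left r by (simp only: int_add_floor)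
    then show ?thesis
      unfolding clear_denominators_diff clear_denominators_frag_of r floor_of_int by (simp add: zmul_add)
  qed
  then show ?case using l by (intro exI[of _ "nat l"]) simp
qed

section \<open>The canonical map into the rational tensor product\<close>

lift_definition tensor :: "'a :: ab_group_add \<Rightarrow> 'a rat_tensor"
  is "\<lambda>a. frag_of (a, 1)" .

lemma tensor_add: "tensor (a + b) = tensor a + tensor b"
proof transfer
  fix a b :: 'a
  show "frag_of (a + b, 1) - (frag_of (a, 1) + frag_of (b, 1)) \<in> bilinear_relations"
    using bilinear_relations.left[of a b 1] by (simp add: diff_diff_eq)
qed

lemma tensor_0: "tensor 0 = 0"
  using tensor_add[of 0 0] by simp

lemma tensor_diff: "tensor (a - b) = tensor a - tensor b"
  using tensor_add[of "a - b" b] by (simp add: algebra_simps)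

lemma tensor_smul: "tensor (smul n a) = rat_tensor_scale (of_nat n) (tensor a)"
  by (induction n) (auto simp: tensor_0 tensor_add rat_tensor.scale_left_distrib)

lemma tensor_zmul: "tensor (zmul k a) = rat_tensor_scale (of_int k) (tensor a)"
proof -
  have "rat_tensor_scale (of_int k) (tensor a) =
      rat_tensor_scale (of_nat (nat k) - of_nat (nat (- k))) (tensor a)"
    by (cases "k \<ge> 0") simp_all
  then show ?thesis
    by (simp add: zmul_def tensor_diff tensor_smul rat_tensor.scale_left_diff_distrib)
qed

lemma tensor_sum: "tensor (\<Sum>i\<in>A. f i) = (\<Sum>i\<in>A. tensor (f i))"
  by (induction A rule: infinite_finite_induct) (auto simp: tensor_0 tensor_add)

lemma tensor_sum_list: "tensor (sum_list (map f w)) = (\<Sum>i\<leftarrow>w. tensor (f i))"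
  by (induction w) (auto simp: tensor_0 tensor_add)

text \<open>The kernel consists of torsion: on \<open>frag_of (a, 1)\<close> no rounding takes
  place, and \<open>clear_denominators N\<close> returns the \<open>N\<close>-fold multiple of
  \<open>a\<close>.\<close>

lemma tensor_eq_0:
  assumes "tensor a = 0"
  obtains N where "N > 0" "smul N a = 0"
proof -
  have "frag_of (a, 1) - 0 \<in> bilinear_relations"
    using assms by transfer
  then obtain N where "N > 0" "\<And>m. clear_denominators (N * m) (frag_of (a, 1)) = 0"
    using bilinear_relations_clear[of "frag_of (a, 1)"] by auto
  from this(1) this(2)[of 1] show ?thesis
    by (intro that[of N]) (auto simp: clear_denominators_frag_of)
qed

text \<open>The class of a pair \<open>(a, r)\<close> is \<open>r\<close> times the class of
  \<open>(a, 1)\<close>.\<close>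

lemma span_tensor: "rat_tensor.span (range tensor) = (UNIV :: 'a :: ab_group_add rat_tensor set)"
proof -
  have "x \<in> rat_tensor.span (range tensor)" for x :: "'a rat_tensor"
  proof -
    obtain f where f: "x = abs_rat_tensor f" by (induct x rule: rat_tensor.abs_induct) blast
    have "abs_rat_tensor f \<in> rat_tensor.span (range tensor)"
    proof (induction f rule: frag_all_induct)
      case zero
      have "abs_rat_tensor 0 = (0 :: 'a rat_tensor)" by (simp add: zero_rat_tensor_def)
      then show ?case by (simp add: rat_tensor.span_zero)
    next
      case (one y)
      obtain a r where y: "y = (a, r)" by (cases y)
      have "abs_rat_tensor (frag_of (a, r)) = rat_tensor_scale r (tensor a)"
        by (simp add: tensor.abs_eq rat_tensor_scale.abs_eq)
      then show ?case unfolding y by (simp add: rat_tensor.span_scale rat_tensor.span_base)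
    next
      case (diff a b)
      have "abs_rat_tensor (a - b) = abs_rat_tensor a - abs_rat_tensor b"
        by (simp add: minus_rat_tensor_def uminus_rat_tensor.abs_eq plus_rat_tensor.abs_eq)
      with diff show ?case by (simp add: rat_tensor.span_diff)
    qed
    with f show ?thesis by simp
  qed
  then show ?thesis by auto
qed

section \<open>Words with prescribed letter counts\<close>

lemma count_list_replicate: "count_list (replicate n x) y = (if x = y then n else 0)"
  by (induction n) auto

lemma word_of_counts:
  fixes n :: "'i \<Rightarrow> nat"
  assumes "finite I"
  obtains w where "w \<in> lists I" "length w = (\<Sum>i\<in>I. n i)"
    "\<And>i. i \<in> I \<Longrightarrow> count_list w i = n i"
proof -
  obtain l where l: "set l = I" "distinct l" using finite_distinct_list[OF assms] by blast
  define w where "w = concat (map (\<lambda>i. replicate (n i) i) l)"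
  have "count_list w i = (if i \<in> set l then n i else 0)" for i
    using l(2) unfolding w_def by (induction l) (auto simp: count_list_0_iff count_list_replicate)
  moreover have "length w = (\<Sum>i\<in>I. n i)"
    using l by (simp add: w_def length_concat o_def sum_list_distinct_conv_sum_set)
  ultimately show ?thesis using l by (intro that[of w]) (auto simp: w_def)
qed

lemma sum_list_eq_sum_smul:
  fixes f :: "'i \<Rightarrow> 'a :: ab_group_add"
  assumes "finite I" "w \<in> lists I"
  shows "sum_list (map f w) = (\<Sum>i\<in>I. smul (count_list w i) (f i))"
  using assms(2)
proof (induction w)
  case (Cons a w)
  have "(\<Sum>i\<in>I. smul (count_list (a # w) i) (f i)) =
      (\<Sum>i\<in>I. (if i = a then f i else 0) + smul (count_list w i) (f i))"
    by (intro sum.cong) auto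
  also have "\<dots> = f a + (\<Sum>i\<in>I. smul (count_list w i) (f i))"
    using Cons.hyps assms(1) by (auto simp: sum.distrib)
  finally show ?case using Cons by simp
qed simp

lemma prod_list_eq_prod_power:
  fixes f :: "'i \<Rightarrow> real"
  assumes "finite I" "w \<in> lists I"
  shows "prod_list (map f w) = (\<Prod>i\<in>I. f i ^ count_list w i)"
  using assms(2)
proof (induction w)
  case (Cons a w)
  have "(\<Prod>i\<in>I. f i ^ count_list (a # w) i) =
      (\<Prod>i\<in>I. (if i = a then f i else 1) * f i ^ count_list w i)"
    by (intro prod.cong) auto
  also have "\<dots> = f a * (\<Prod>i\<in>I. f i ^ count_list w i)"
    using Cons.hyps assms(1) by (auto simp: prod.distrib)
  finally show ?case using Cons by simp
qed simp

lemma length_eq_sum_count: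
  assumes "finite I" "w \<in> lists I"
  shows "length w = (\<Sum>i\<in>I. count_list w i)"
proof -
  have "length w = (\<Sum>i\<in>set w. count_list w i)" by (simp add: sum_count_set)
  also have "\<dots> = (\<Sum>i\<in>I. count_list w i)"
    using assms by (intro sum.mono_neutral_left) (auto simp: count_list_0_iff)
  finally show ?thesis .
qed

section \<open>The group generated by a finite family\<close>

locale generated_group =
  fixes I :: "'i set" and \<sigma> :: "'i \<Rightarrow> 'a :: ab_group_add" and i0 :: 'i
  assumes fin: "finite I" and i0: "i0 \<in> I"
    and generates: "\<exists>v\<in>lists I. \<exists>w\<in>lists I. a = sum_list (map \<sigma> v) - sum_list (map \<sigma> w)"
begin

sublocale exchangeable I \<sigma>
  by unfold_locales (rule fin)

text \<open>For \<open>\<sigma> = frac \<circ> s\<close> this turns out to be the branching and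
  admissible alternative of the theorem, in which the dimension drops by one.\<close>

definition graded :: bool where
  "graded \<longleftrightarrow> (\<forall>v\<in>lists I. \<forall>w\<in>lists I. sum_list (map \<sigma> v) = sum_list (map \<sigma> w) \<longrightarrow> length v = length w)"

abbreviation e :: "'i \<Rightarrow> 'a rat_tensor" where "e i \<equiv> tensor (\<sigma> i)"

text \<open>Spans the directions of the affine hull of the vectors \<open>e i\<close>; the dimension
  of this span is that of the disk.\<close>

definition diffs :: "'a rat_tensor set" where "diffs = (\<lambda>i. e i - e i0) ` I"

lemma tensor_word: "tensor (sum_list (map \<sigma> w)) = (\<Sum>i\<leftarrow>w. e i)"
  by (rule tensor_sum_list)

text \<open>Modulo \<open>diffs\<close> every letter equals \<open>e i0\<close>, so only the length
  of the word is left.\<close>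

lemma word_mod_diffs:
  assumes "w \<in> lists I"
  shows "(\<Sum>i\<leftarrow>w. e i) - rat_tensor_scale (of_nat (length w)) (e i0) \<in> rat_tensor.span diffs"
  using assms
proof (induction w)
  case Nil
  then show ?case by (simp add: rat_tensor.span_zero)
next
  case (Cons i w)
  have "(e i - e i0) + ((\<Sum>i\<leftarrow>w. e i) - rat_tensor_scale (of_nat (length w)) (e i0)) \<in> rat_tensor.span diffs"
    using Cons by (intro rat_tensor.span_add) (auto simp: diffs_def intro: rat_tensor.span_base)
  then show ?case by (simp add: rat_tensor.scale_left_distrib algebra_simps)
qed

text \<open>A relation in the tensor product holds in the group only up to torsion, hence the factor
  \<open>N\<close>. The positive and the negative part of \<open>N * u\<close> serve as letter
  counts of the two words.\<close>

lemma integer_relation: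
  fixes u :: "'i \<Rightarrow> int"
  assumes "(\<Sum>i\<in>I. rat_tensor_scale (of_int (u i)) (e i)) = 0"
  obtains N v w where "N > 0" "v \<in> lists I" "w \<in> lists I" "sum_list (map \<sigma> v) = sum_list (map \<sigma> w)"
    "\<forall>i\<in>I. count_list v i = N * nat (u i)" "\<forall>i\<in>I. count_list w i = N * nat (- u i)"
    "int (length v) - int (length w) = int N * (\<Sum>i\<in>I. u i)"
proof -
  have "tensor (\<Sum>i\<in>I. zmul (u i) (\<sigma> i)) = 0"
    using assms by (simp add: tensor_sum tensor_zmul)
  then obtain N where N: "N > 0" "smul N (\<Sum>i\<in>I. zmul (u i) (\<sigma> i)) = 0"
    by (rule tensor_eq_0)
  obtain v where v: "v \<in> lists I" "length v = (\<Sum>i\<in>I. N * nat (u i))"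
    "\<And>i. i \<in> I \<Longrightarrow> count_list v i = N * nat (u i)"
    using word_of_counts[OF fin, of "\<lambda>i. N * nat (u i)"] by blast
  obtain w where w: "w \<in> lists I" "length w = (\<Sum>i\<in>I. N * nat (- u i))"
    "\<And>i. i \<in> I \<Longrightarrow> count_list w i = N * nat (- u i)"
    using word_of_counts[OF fin, of "\<lambda>i. N * nat (- u i)"] by blast
  have "sum_list (map \<sigma> v) - sum_list (map \<sigma> w) = smul N (\<Sum>i\<in>I. zmul (u i) (\<sigma> i))"
    using v w sum_list_eq_sum_smul[OF fin v(1), of \<sigma>] sum_list_eq_sum_smul[OF fin w(1), of \<sigma>]
    by (simp add: smul_sum zmul_def smul_diff smul_mult sum_subtractf cong: sum.cong)
  then have "sum_list (map \<sigma> v) = sum_list (map \<sigma> w)" using N by simp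
  moreover have "int (length v) - int (length w) = (\<Sum>i\<in>I. int N * (int (nat (u i)) - int (nat (- u i))))"
    by (simp add: v(2) w(2) sum_subtractf right_diff_distrib)
  then have "int (length v) - int (length w) = int N * (\<Sum>i\<in>I. u i)"
    by (simp add: sum_distrib_left int_nat_eq cong: sum.cong) (auto intro!: sum.cong)
  ultimately show ?thesis using N v w by (intro that[of N v w]) auto
qed

text \<open>Written in the vectors \<open>e i\<close>, a combination of the differences
  \<open>e i - e i0\<close> has coefficients of total 0; \<open>M\<close> is a common denominator of
  them.\<close>

lemma diffs_integer:
  assumes "x \<in> rat_tensor.span diffs"
  shows "\<exists>M>0. \<exists>u :: 'i \<Rightarrow> int. (\<Sum>i\<in>I. u i) = 0 \<and>
    rat_tensor_scale (of_int M) x = (\<Sum>i\<in>I. rat_tensor_scale (of_int (u i)) (e i))" (is "?R x")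
  using assms
proof (induction rule: rat_tensor.span_induct_alt)
  case base
  show ?case by (intro exI[of _ 1] conjI exI[of _ "\<lambda>_. 0"]) auto
next
  case (step c x y)
  obtain j where j: "j \<in> I" "x = e j - e i0" using step.hyps by (auto simp: diffs_def)
  obtain M u where M: "M > 0" "(\<Sum>i\<in>I. u i) = 0"
    "rat_tensor_scale (of_int M) y = (\<Sum>i\<in>I. rat_tensor_scale (of_int (u i)) (e i))"
    using step.IH by blast
  obtain k l where kl: "quotient_of c = (k, l)" by (cases "quotient_of c")
  then have l: "l > 0" "c = of_int k / of_int l"
    by (auto simp: quotient_of_denom_pos quotient_of_div)
  \<comment> \<open>With \<open>c = k / l\<close> the new denominator is \<open>M * l\<close>, which
    turns the new summand into \<open>M * k\<close> times \<open>x\<close> and multiplies the old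
    integer coefficients by \<open>l\<close>.\<close>
  define u' where "u' = (\<lambda>i. l * u i + M * k * ((if i = j then 1 else 0) - (if i = i0 then 1 else 0)))"
  have "(\<Sum>i\<in>I. u' i) = l * (\<Sum>i\<in>I. u i) + M * k * ((\<Sum>i\<in>I. if i = j then 1 else 0) - (\<Sum>i\<in>I. if i = i0 then 1 else 0))"
    by (simp add: u'_def sum.distrib sum_subtractf sum_distrib_left[symmetric])
  then have 0: "(\<Sum>i\<in>I. u' i) = 0" using M(2) j(1) i0 fin by simp
  have "(\<Sum>i\<in>I. rat_tensor_scale (of_int (u' i)) (e i)) =
      (\<Sum>i\<in>I. rat_tensor_scale (of_int l) (rat_tensor_scale (of_int (u i)) (e i)) +
        ((if i = j then rat_tensor_scale (of_int (M * k)) (e i) else 0) -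
         (if i = i0 then rat_tensor_scale (of_int (M * k)) (e i) else 0)))"
    by (intro sum.cong)
      (auto simp: u'_def rat_tensor.scale_left_distrib rat_tensor.scale_left_diff_distrib algebra_simps)
  also have "\<dots> = rat_tensor_scale (of_int l) (rat_tensor_scale (of_int M) y) +
      rat_tensor_scale (of_int (M * k)) x"
    using j fin i0
    by (simp add: sum.distrib sum_subtractf M(3) rat_tensor.scale_sum_right rat_tensor.scale_right_diff_distrib)
  also have "\<dots> = rat_tensor_scale (of_int (M * l)) (rat_tensor_scale c x + y)"
    using l by (simp add: rat_tensor.scale_right_distrib field_simps)
  finally show ?case
    using 0 M(1) l(1) by (intro exI[of _ "M * l"] conjI exI[of _ u']) auto
qed

text \<open>If \<open>e i0\<close> lies in the span, a multiple \<open>M\<close> of it equals a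
  combination of total 0, which yields two words of equal sum whose lengths differ by
  \<open>N * M\<close>. Conversely, two words of equal sum and different lengths put a nonzero
  multiple of \<open>e i0\<close> into the span.\<close>

lemma graded_iff: "graded \<longleftrightarrow> e i0 \<notin> rat_tensor.span diffs"
proof
  assume graded: "graded"
  show "e i0 \<notin> rat_tensor.span diffs"
  proof
    assume "e i0 \<in> rat_tensor.span diffs"
    then obtain M u where M: "M > 0" "(\<Sum>i\<in>I. u i) = 0"
      "rat_tensor_scale (of_int M) (e i0) = (\<Sum>i\<in>I. rat_tensor_scale (of_int (u i)) (e i))"
      using diffs_integer by blast
    define u' where "u' = (\<lambda>i. (if i = i0 then M else 0) - u i)"
    have "(\<Sum>i\<in>I. rat_tensor_scale (of_int (u' i)) (e i)) =
        (\<Sum>i\<in>I. (if i = i0 then rat_tensor_scale (of_int M) (e i) else 0) - rat_tensor_scale (of_int (u i)) (e i))"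
      by (intro sum.cong) (auto simp: u'_def rat_tensor.scale_left_diff_distrib)
    also have "\<dots> = 0" using fin i0 by (simp add: sum_subtractf M(3))
    finally obtain N v w where N: "N > 0"
      and vw: "v \<in> lists I" "w \<in> lists I" "sum_list (map \<sigma> v) = sum_list (map \<sigma> w)"
      and len: "int (length v) - int (length w) = int N * (\<Sum>i\<in>I. u' i)"
      by (rule integer_relation)
    have "length v = length w" using graded vw unfolding graded_def by blast
    moreover have "(\<Sum>i\<in>I. u' i) = M" using fin i0 M(2) by (simp add: u'_def sum_subtractf)
    ultimately show False using M(1) N len by simp
  qed
next
  assume notin: "e i0 \<notin> rat_tensor.span diffs"
  show "graded"
    unfolding graded_def
  proof (intro ballI impI)
    fix v w assume vw: "v \<in> lists I" "w \<in> lists I" "sum_list (map \<sigma> v) = sum_list (map \<sigma> w)"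
    define c :: rat where "c = of_nat (length w) - of_nat (length v)"
    have eq: "(\<Sum>i\<leftarrow>v. e i) = (\<Sum>i\<leftarrow>w. e i)"
      using vw(3) by (metis tensor_word)
    have "((\<Sum>i\<leftarrow>v. e i) - rat_tensor_scale (of_nat (length v)) (e i0)) -
        ((\<Sum>i\<leftarrow>w. e i) - rat_tensor_scale (of_nat (length w)) (e i0)) \<in> rat_tensor.span diffs"
      by (intro rat_tensor.span_diff word_mod_diffs vw)
    then have c: "rat_tensor_scale c (e i0) \<in> rat_tensor.span diffs"
      by (simp add: eq c_def rat_tensor.scale_left_diff_distrib)
    show "length v = length w"
    proof (rule ccontr)
      assume "length v \<noteq> length w"
      then have "c \<noteq> 0" by (simp add: c_def)
      then show False using rat_tensor.span_scale[OF c, of "inverse c"] notin by simp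
    qed
  qed
qed

lemma span_insert_diffs: "rat_tensor.span (insert (e i0) diffs) = UNIV"
proof -
  let ?S = "rat_tensor.span (insert (e i0) diffs)"
  have word: "tensor (sum_list (map \<sigma> w)) \<in> ?S" if "w \<in> lists I" for w
  proof -
    have "(\<Sum>i\<leftarrow>w. e i) - rat_tensor_scale (of_nat (length w)) (e i0) \<in> ?S"
      using word_mod_diffs[OF that] rat_tensor.span_mono[of diffs "insert (e i0) diffs"] by blast
    moreover have "rat_tensor_scale (of_nat (length w)) (e i0) \<in> ?S"
      by (intro rat_tensor.span_scale rat_tensor.span_base) simp
    ultimately show ?thesis
      unfolding tensor_word by (metis diff_add_cancel rat_tensor.span_add)
  qed
  have "tensor a \<in> ?S" for a
  proof -
    obtain v w where "v \<in> lists I" "w \<in> lists I" "a = sum_list (map \<sigma> v) - sum_list (map \<sigma> w)"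
      using generates[of a] by blast
    then show ?thesis using word by (simp add: tensor_diff rat_tensor.span_diff)
  qed
  then have "rat_tensor.span (range tensor) \<subseteq> ?S"
    by (intro rat_tensor.span_minimal) auto
  then show ?thesis by (auto simp: span_tensor)
qed

lemma variety_parametrization:
  obtains d F where "if graded then d + 1 = group_rank TYPE('a) else d = group_rank TYPE('a)"
    "continuous_on variety F" "inj_on F variety" "F ` variety = closed_disk d"
    "\<And>p. p \<in> variety \<Longrightarrow> F p \<in> disk_interior d \<longleftrightarrow> (\<forall>i\<in>I. 0 < p i)"
proof -
  \<comment> \<open>The basis is taken among the differences themselves, so that its members are
    \<open>e (j k) - e i0\<close> as \<open>simplex_projection\<close> demands.\<close>
  obtain B where B: "B \<subseteq> diffs" "rat_tensor.independent B" "diffs \<subseteq> rat_tensor.span B"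
    using rat_tensor.maximal_independent_subset[of diffs] by blast
  have spanB: "rat_tensor.span B = rat_tensor.span diffs"
    using B(1,3) by (metis rat_tensor.span_mono rat_tensor.span_span subset_antisym)
  have finB: "finite B"
    using B(1) fin by (auto simp: diffs_def intro: finite_subset)
  define d where "d = card B"
  \<comment> \<open>By \<open>graded_iff\<close>, \<open>e i0\<close> either completes
    \<open>B\<close> to a basis of the whole tensor product or already lies in its span.\<close>
  have rank: "if graded then d + 1 = group_rank TYPE('a) else d = group_rank TYPE('a)"
  proof (cases graded)
    case True
    then have notin: "e i0 \<notin> rat_tensor.span B" by (simp add: graded_iff spanB)
    then have ind: "rat_tensor.independent (insert (e i0) B)"
      using B(2) by (simp add: rat_tensor.independent_insert)
    have "rat_tensor.span (insert (e i0) B) = rat_tensor.span (insert (e i0) diffs)"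
      using spanB by (simp add: rat_tensor.span_insert)
    then have "rat_tensor.dim (UNIV :: 'a rat_tensor set) = card (insert (e i0) B)"
      using rat_tensor.dim_unique[of "insert (e i0) B" UNIV] ind span_insert_diffs by auto
    moreover have "e i0 \<notin> B" using notin rat_tensor.span_base by blast
    ultimately show ?thesis using True finB by (simp add: group_rank_def d_def)
  next
    case False
    then have "rat_tensor.span diffs = rat_tensor.span (insert (e i0) diffs)"
      by (simp add: graded_iff rat_tensor.span_redundant)
    then have "rat_tensor.dim (UNIV :: 'a rat_tensor set) = card B"
      using rat_tensor.dim_unique[of B UNIV] B(2) span_insert_diffs spanB by auto
    then show ?thesis using False by (simp add: group_rank_def d_def)
  qed
  obtain b where b: "bij_betw b {..<d} B"
    using ex_bij_betw_nat_finite[OF finB] by (auto simp: d_def atLeast0LessThan)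
  have "\<exists>i\<in>I. b k = e i - e i0" if "k < d" for k
    using b B(1) that by (auto simp: diffs_def bij_betw_def)
  then obtain j where j: "\<And>k. k < d \<Longrightarrow> j k \<in> I" "\<And>k. k < d \<Longrightarrow> b k = e (j k) - e i0"
    by metis
  have bB: "b k \<in> B" if "k < d" for k using b that by (auto simp: bij_betw_def)
  define \<beta> where "\<beta> = (\<lambda>k i. rat_tensor.representation B (e i - e i0) (b k))"
  interpret simplex_projection I d \<beta> i0 j
  proof
    show "finite I" "i0 \<in> I" by (fact fin i0)+
    show "\<beta> k i0 = 0" if "k < d" for k by (simp add: \<beta>_def rat_tensor.representation_zero)
    show "j k \<in> I" if "k < d" for k using j(1)[OF that] .
    show "\<beta> k (j l) = (if k = l then 1 else 0)" if "k < d" "l < d" for k l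
    proof -
      have "\<beta> k (j l) = rat_tensor.representation B (b l) (b k)"
        using j(2)[OF that(2)] by (simp add: \<beta>_def)
      also have "\<dots> = (if b l = b k then 1 else 0)"
        using rat_tensor.representation_basis[OF B(2) bB[OF that(2)]] by auto
      also have "b l = b k \<longleftrightarrow> k = l"
        using b that by (auto simp: bij_betw_def inj_on_def)
      finally show ?thesis .
    qed
  qed
  have expand: "e i - e i0 = (\<Sum>k<d. rat_tensor_scale (\<beta> k i) (b k))" if "i \<in> I" for i
  proof -
    have "e i - e i0 \<in> rat_tensor.span B" using B(3) that by (auto simp: diffs_def)
    then have "(\<Sum>v\<in>B. rat_tensor_scale (rat_tensor.representation B (e i - e i0) v) v) = e i - e i0"
      using rat_tensor.sum_representation_eq[OF B(2) _ finB] by blast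
    also have "(\<Sum>v\<in>B. rat_tensor_scale (rat_tensor.representation B (e i - e i0) v) v) =
        (\<Sum>k<d. rat_tensor_scale (\<beta> k i) (b k))"
      unfolding \<beta>_def by (rule sum.reindex_bij_betw[OF b, symmetric])
    finally show ?thesis by simp
  qed
  \<comment> \<open>For total 0 each \<open>e i\<close> may be replaced by
    \<open>e i - e i0\<close>; independence of \<open>B\<close> then turns the vector equation into
    the \<open>d\<close> coordinate equations.\<close>
  have null_iff: "null (\<lambda>i. of_int (u i)) \<longleftrightarrow> (\<Sum>i\<in>I. u i) = 0 \<and> (\<Sum>i\<in>I. rat_tensor_scale (of_int (u i)) (e i)) = 0"
    for u :: "'i \<Rightarrow> int"
  proof (cases "(\<Sum>i\<in>I. u i) = 0")
    case True
    define c where "c = (\<lambda>k. \<Sum>i\<in>I. \<beta> k i * of_int (u i))"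
    have "(\<Sum>i\<in>I. rat_tensor_scale (of_int (u i)) (e i0)) = rat_tensor_scale (of_int (\<Sum>i\<in>I. u i)) (e i0)"
      by (simp add: rat_tensor.scale_sum_left)
    then have "(\<Sum>i\<in>I. rat_tensor_scale (of_int (u i)) (e i)) =
        (\<Sum>i\<in>I. rat_tensor_scale (of_int (u i)) (e i - e i0))"
      using True by (simp add: rat_tensor.scale_right_diff_distrib sum_subtractf)
    also have "\<dots> = (\<Sum>i\<in>I. \<Sum>k<d. rat_tensor_scale (\<beta> k i * of_int (u i)) (b k))"
      by (intro sum.cong refl) (simp add: expand rat_tensor.scale_sum_right mult.commute)
    also have "\<dots> = (\<Sum>k<d. rat_tensor_scale (c k) (b k))"
      unfolding c_def rat_tensor.scale_sum_left by (rule sum.swap)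
    finally have eq: "(\<Sum>i\<in>I. rat_tensor_scale (of_int (u i)) (e i)) = (\<Sum>k<d. rat_tensor_scale (c k) (b k))" .
    have "(\<Sum>k<d. rat_tensor_scale (c k) (b k)) = 0 \<longleftrightarrow> (\<forall>k<d. c k = 0)"
    proof
      assume 0: "(\<Sum>k<d. rat_tensor_scale (c k) (b k)) = 0"
      define c' where "c' = (\<lambda>v. c (the_inv_into {..<d} b v))"
      have c': "c' (b k) = c k" if "k < d" for k
        using b that by (simp add: c'_def bij_betw_def the_inv_into_f_f)
      have "(\<Sum>v\<in>B. rat_tensor_scale (c' v) v) = (\<Sum>k<d. rat_tensor_scale (c' (b k)) (b k))"
        by (rule sum.reindex_bij_betw[OF b, symmetric])
      also have "\<dots> = 0" using 0 c' by simp
      finally have "c' v = 0" if "v \<in> B" for v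
        using rat_tensor.independentD[OF B(2) finB subset_refl] that by blast
      then show "\<forall>k<d. c k = 0" using c' bB by metis
    qed simp
    moreover have "(\<Sum>i\<in>I. of_rat (\<beta> k i) * real_of_int (u i)) = of_rat (c k)" for k
      by (simp add: c_def of_rat_sum of_rat_mult)
    moreover have "(\<Sum>i\<in>I. real_of_int (u i)) = 0"
      using True by (metis of_int_0 of_int_sum)
    ultimately show ?thesis using True by (simp add: null_def eq)
  next
    case False
    then have "(\<Sum>i\<in>I. real_of_int (u i)) \<noteq> 0"
      by (metis of_int_eq_0_iff of_int_sum)
    with False show ?thesis by (simp add: null_def)
  qed
  have "toric = variety"
  proof
    show "toric \<subseteq> variety"
    proof
      fix p assume p: "p \<in> toric"
      have "prod_list (map p v) = prod_list (map p w)" if vw: "homogeneous_relation v w" for v w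
      proof -
        have v: "v \<in> lists I" and w: "w \<in> lists I" and len: "length v = length w"
          and eq: "sum_list (map \<sigma> v) = sum_list (map \<sigma> w)"
          using vw by (auto simp: homogeneous_relation_def)
        define u where "u = (\<lambda>i. int (count_list v i) - int (count_list w i))"
        have "(\<Sum>i\<in>I. u i) = int (length v) - int (length w)"
          by (simp add: u_def sum_subtractf length_eq_sum_count[OF fin v] length_eq_sum_count[OF fin w])
        moreover have "(\<Sum>i\<in>I. rat_tensor_scale (of_int (u i)) (e i)) = 0"
        proof -
          have "(\<Sum>i\<in>I. rat_tensor_scale (of_int (u i)) (e i)) =
              tensor (sum_list (map \<sigma> v)) - tensor (sum_list (map \<sigma> w))"
            by (simp add: u_def sum_list_eq_sum_smul[OF fin v] sum_list_eq_sum_smul[OF fin w]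
                tensor_sum tensor_smul rat_tensor.scale_left_diff_distrib sum_subtractf)
          then show ?thesis using eq by simp
        qed
        ultimately have "null (\<lambda>i. of_int (u i))" using len by (simp add: null_iff)
        then have *: "(\<Prod>i\<in>I. p i ^ nat (u i)) = (\<Prod>i\<in>I. p i ^ nat (- u i))"
          using p by (simp add: toric_def)
        \<comment> \<open>The words may share letters. The common part contributes the same factor
          on both sides, and the equation for the cancelled exponents is multiplied by it; no
          division by a possibly vanishing coordinate occurs.\<close>
        define m where "m = (\<lambda>i. min (count_list v i) (count_list w i))"
        have "count_list v i = m i + nat (u i)" "count_list w i = m i + nat (- u i)" for i
          by (auto simp: m_def u_def)
        then show ?thesis
          by (simp add: prod_list_eq_prod_power[OF fin v] prod_list_eq_prod_power[OF fin w]
              power_add prod.distrib *)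
      qed
      with p show "p \<in> variety" by (simp add: toric_def variety_def)
    qed
    show "variety \<subseteq> toric"
    proof
      fix p assume p: "p \<in> variety"
      then have pS: "p \<in> prob_simplex I" by (simp add: variety_def)
      have "(\<Prod>i\<in>I. p i ^ nat (u i)) = (\<Prod>i\<in>I. p i ^ nat (- u i))"
        if u: "null (\<lambda>i. of_int (u i))" for u :: "'i \<Rightarrow> int"
      proof -
        have u0: "(\<Sum>i\<in>I. u i) = 0" and rel: "(\<Sum>i\<in>I. rat_tensor_scale (of_int (u i)) (e i)) = 0"
          using u by (auto simp: null_iff)
        obtain N v w where N: "N > 0" and v: "v \<in> lists I" and w: "w \<in> lists I"
          and eq: "sum_list (map \<sigma> v) = sum_list (map \<sigma> w)"
          and cv: "\<forall>i\<in>I. count_list v i = N * nat (u i)"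
          and cw: "\<forall>i\<in>I. count_list w i = N * nat (- u i)"
          and len: "int (length v) - int (length w) = int N * (\<Sum>i\<in>I. u i)"
          using rel by (rule integer_relation)
        have "homogeneous_relation v w"
          using v w eq len u0 by (simp add: homogeneous_relation_def)
        then have "prod_list (map p v) = prod_list (map p w)" using p by (simp add: variety_def)
        moreover have "prod_list (map p v) = (\<Prod>i\<in>I. p i ^ nat (u i)) ^ N"
          unfolding prod_list_eq_prod_power[OF fin v] prod_power_distrib
          using cv by (intro prod.cong) (auto simp: power_mult[symmetric] mult.commute)
        moreover have "prod_list (map p w) = (\<Prod>i\<in>I. p i ^ nat (- u i)) ^ N"
          unfolding prod_list_eq_prod_power[OF fin w] prod_power_distrib
          using cw by (intro prod.cong) (auto simp: power_mult[symmetric] mult.commute)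
        ultimately have eqN: "(\<Prod>i\<in>I. p i ^ nat (u i)) ^ N = (\<Prod>i\<in>I. p i ^ nat (- u i)) ^ N"
          by simp
        \<comment> \<open>The words give the equation only for the exponents \<open>N * u\<close>.
          Both monomials are nonnegative, so their equal \<open>N\<close>-th powers have equal
          bases, and torsion leaves no trace.\<close>
        have "0 \<le> (\<Prod>i\<in>I. p i ^ n i)" for n
          using prob_simplex_nonneg[OF pS] by (intro prod_nonneg) simp
        from power_eq_imp_eq_base[OF eqN this this N] show ?thesis .
      qed
      with pS show "p \<in> toric" by (simp add: toric_def)
    qed
  qed
  moreover obtain F where "continuous_on toric F" "inj_on F toric" "F ` toric = closed_disk d"
    "\<And>p. p \<in> toric \<Longrightarrow> F p \<in> disk_interior d \<longleftrightarrow> (\<forall>i\<in>I. 0 < p i)"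
    using disk_parametrization by blast
  ultimately show ?thesis using rank by (intro that[of d F]) auto
qed

end

section \<open>The embedding into the group of fractions\<close>

text \<open>An element is encoded as \<open>(a + a) - a\<close>, since there may be no identity to
  subtract.\<close>

lift_definition frac :: "'g :: {ab_semigroup_add, cancel_semigroup_add} \<Rightarrow> 'g fraction_group"
  is "\<lambda>a. (a + a, a)" .

lemma frac_add: "frac (a + b) = frac a + frac b"
  by transfer (simp add: ac_simps)

lemma frac_eq_iff [simp]: "frac a = frac b \<longleftrightarrow> a = b"
proof transfer
  fix a b :: 'a
  have "a + a + b = (a + b) + a" "b + b + a = (a + b) + b" by (simp_all add: ac_simps)
  then show "fst (a + a, a) + snd (b + b, b) = fst (b + b, b) + snd (a + a, a) \<longleftrightarrow> a = b"
    by simp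
qed

text \<open>A cancellative semigroup has no idempotents besides an identity, and an element of a
  group is 0 iff it equals its double.\<close>

lemma frac_eq_0_iff: "frac a = 0 \<longleftrightarrow> is_identity a"
proof -
  have "frac a = 0 \<longleftrightarrow> frac a + frac a = frac a" by simp
  also have "\<dots> \<longleftrightarrow> a + a = a" by (simp flip: frac_add)
  also have "\<dots> \<longleftrightarrow> is_identity a"
  proof
    assume "a + a = a"
    then have "a + (a + x) = a + x" for x by (simp flip: add.assoc)
    then show "is_identity a" by (simp add: is_identity_def)
  qed (simp add: is_identity_def)
  finally show ?thesis .
qed

lemma frac_diff_surj: "\<exists>a b. z = frac a - frac b"
proof -
  have "\<exists>a b. z + frac b = frac a"
  proof transfer
    fix z :: "'a \<times> 'a"
    show "\<exists>a b. fst (fst z + fst (b + b, b), snd z + snd (b + b, b)) + snd (a + a, a) =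
        fst (a + a, a) + snd (fst z + fst (b + b, b), snd z + snd (b + b, b))"
      by (rule exI[of _ "fst z"], rule exI[of _ "snd z"]) (simp add: ac_simps)
  qed
  then show ?thesis by (metis add_diff_cancel)
qed

section \<open>Monoids embedded in the group of fractions\<close>

fun option_frac :: "'g :: {ab_semigroup_add, cancel_semigroup_add} option \<Rightarrow> 'g fraction_group" where
  "option_frac None = 0"
| "option_frac (Some a) = frac a"

lemma option_frac_add: "option_frac (option_add x y) = option_frac x + option_frac y"
  by (cases "(x, y)" rule: option_add.cases) (auto simp: frac_add)

text \<open>The branching property of a Cayley graph, read in the group of fractions with
  \<open>Q\<close> the image of the monoid. In this form the different encodings of the monoid can
  be compared.\<close>

definition grading :: "'a :: ab_group_add set \<Rightarrow> 'j set \<Rightarrow> ('j \<Rightarrow> 'a) \<Rightarrow> bool" where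
  "grading Q J \<tau> \<longleftrightarrow> finite J \<and> J \<noteq> {} \<and> \<tau> ` J \<subseteq> Q \<and>
     (\<forall>x\<in>Q. \<exists>w\<in>lists J. sum_list (map \<tau> w) = x) \<and>
     (\<forall>v\<in>lists J. \<forall>w\<in>lists J. sum_list (map \<tau> v) = sum_list (map \<tau> w) \<longrightarrow> length v = length w)"

lemma grading_length:
  "grading Q J \<tau> \<Longrightarrow> v \<in> lists J \<Longrightarrow> w \<in> lists J \<Longrightarrow>
    sum_list (map \<tau> v) = sum_list (map \<tau> w) \<Longrightarrow> length v = length w"
  unfolding grading_def by blast

text \<open>Since \<open>val\<close> is injective on the carrier, end points of paths can be
  compared by the sums of the values of their marks. This serves \<open>monoid_of_identity\<close>,
  \<open>adjoin_identity\<close> and \<open>semigroup1\<close> alike.\<close>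

locale valued_monoid =
  fixes M :: "('m, 'b) monoid_scheme" and val :: "'m \<Rightarrow> 'a :: ab_group_add"
  assumes val_mult: "val (x \<otimes>\<^bsub>M\<^esub> y) = val x + val y"
    and val_one: "val \<one>\<^bsub>M\<^esub> = 0"
    and inj_val: "inj_on val (carrier M)"
    and mult_closed: "x \<in> carrier M \<Longrightarrow> y \<in> carrier M \<Longrightarrow> x \<otimes>\<^bsub>M\<^esub> y \<in> carrier M"
    and one_closed: "\<one>\<^bsub>M\<^esub> \<in> carrier M"
begin

lemma val_path_end: "val (path_end M t w) = sum_list (map (val \<circ> t) w)"
  unfolding path_end_def
  by (induction w rule: rev_induct) (auto simp: val_mult val_one)

lemma path_end_closed:
  assumes "t ` J \<subseteq> carrier M" "w \<in> lists J"
  shows "path_end M t w \<in> carrier M"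
  using assms(2) unfolding path_end_def
proof (induction w rule: rev_induct)
  case (snoc i w)
  then have "i \<in> J" "w \<in> lists J" by auto
  then show ?case using snoc.IH assms(1) by (auto intro!: mult_closed)
qed (auto simp: one_closed)

lemma mem_paths_to_iff:
  assumes "t ` J \<subseteq> carrier M" "v \<in> carrier M"
  shows "w \<in> paths_to M J t v \<longleftrightarrow> w \<in> lists J \<and> sum_list (map (val \<circ> t) w) = val v"
  using path_end_closed[OF assms(1)] assms(2) inj_val
  by (auto simp: paths_to_def val_path_end[symmetric] inj_on_def)

lemma generating_system_iff:
  "generating_system M J t \<longleftrightarrow> finite J \<and> J \<noteq> {} \<and> t ` J \<subseteq> carrier M \<and>
    (\<forall>x\<in>val ` carrier M. \<exists>w\<in>lists J. sum_list (map (val \<circ> t) w) = x)"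
proof -
  have "(\<exists>w\<in>lists J. path_end M t w = v) \<longleftrightarrow> (\<exists>w\<in>lists J. sum_list (map (val \<circ> t) w) = val v)"
    if "t ` J \<subseteq> carrier M" "v \<in> carrier M" for v
    using mem_paths_to_iff[OF that] by (auto simp: paths_to_def)
  then show ?thesis unfolding generating_system_def by auto
qed

lemma branching_iff_grading:
  "generating_system M J t \<and> branching_cayley_graph M J t \<longleftrightarrow>
    t ` J \<subseteq> carrier M \<and> grading (val ` carrier M) J (val \<circ> t)"
proof (cases "t ` J \<subseteq> carrier M")
  case True
  note iff = mem_paths_to_iff[OF True]
  have eq: "sum_list (map (val \<circ> t) w) = val (path_end M t w)" for w
    by (simp add: val_path_end)
  have "branching_cayley_graph M J t \<longleftrightarrow>
      (\<forall>v\<in>lists J. \<forall>w\<in>lists J. sum_list (map (val \<circ> t) v) = sum_list (map (val \<circ> t) w) \<longrightarrow> length v = length w)"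
    if gen: "generating_system M J t"
  proof
    assume br: "branching_cayley_graph M J t"
    show "\<forall>v\<in>lists J. \<forall>w\<in>lists J. sum_list (map (val \<circ> t) v) = sum_list (map (val \<circ> t) w) \<longrightarrow> length v = length w"
    proof (intro ballI impI)
      fix v w assume vw: "v \<in> lists J" "w \<in> lists J"
        "sum_list (map (val \<circ> t) v) = sum_list (map (val \<circ> t) w)"
      have c: "path_end M t w \<in> carrier M" using path_end_closed[OF True vw(2)] .
      then have "v \<in> paths_to M J t (path_end M t w)" "w \<in> paths_to M J t (path_end M t w)"
        using vw eq by (simp_all only: iff)
      then show "length v = length w" using br c unfolding branching_cayley_graph_def by blast
    qed
  next
    assume *: "\<forall>v\<in>lists J. \<forall>w\<in>lists J. sum_list (map (val \<circ> t) v) = sum_list (map (val \<circ> t) w) \<longrightarrow> length v = length w"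
    show "branching_cayley_graph M J t"
      unfolding branching_cayley_graph_def
    proof (intro ballI conjI)
      fix x assume x: "x \<in> carrier M"
      show "paths_to M J t x \<noteq> {}"
        using gen x unfolding generating_system_def paths_to_def by blast
      show "length v = length w" if "v \<in> paths_to M J t x" "w \<in> paths_to M J t x" for v w
        using that * unfolding iff[OF x] by metis
    qed
  qed
  with True show ?thesis unfolding grading_def generating_system_iff by auto
qed (auto simp: generating_system_def)

end

abbreviation frac_monoid :: "'g :: {ab_semigroup_add, cancel_semigroup_add} fraction_group set"
  where "frac_monoid \<equiv> insert 0 (range frac)"

lemma valued_monoid_identity:
  assumes "is_identity (e :: 'g :: {ab_semigroup_add, cancel_semigroup_add})"
  shows "valued_monoid (monoid_of_identity e) frac" "frac ` carrier (monoid_of_identity e) = frac_monoid"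
proof -
  have "frac e = 0" using assms by (simp add: frac_eq_0_iff)
  then show "valued_monoid (monoid_of_identity e) frac"
    by unfold_locales (auto simp: monoid_of_identity_def frac_add inj_on_def)
  have "0 \<in> range (frac :: 'g \<Rightarrow> _)" using \<open>frac e = 0\<close> by (metis rangeI)
  then show "frac ` carrier (monoid_of_identity e) = frac_monoid"
    by (auto simp: monoid_of_identity_def)
qed

text \<open>The hypothesis makes \<open>option_frac\<close> injective: an identity of the semigroup
  would share the value 0 with \<open>None\<close>.\<close>

lemma valued_monoid_adjoin:
  assumes "\<not> (\<exists>e :: 'g :: {ab_semigroup_add, cancel_semigroup_add}. is_identity e)"
  shows "valued_monoid (adjoin_identity :: 'g option monoid) option_frac"
    "option_frac ` carrier (adjoin_identity :: 'g option monoid) = frac_monoid"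
proof -
  have nz: "frac (a :: 'g) \<noteq> 0" for a using assms by (simp add: frac_eq_0_iff)
  have "x = y" if "option_frac x = option_frac (y :: 'g option)" for x y
    using that nz[symmetric] nz by (cases x; cases y) auto
  then show "valued_monoid (adjoin_identity :: 'g option monoid) option_frac"
    by unfold_locales (auto simp: adjoin_identity_def option_frac_add inj_on_def)
  show "option_frac ` carrier (adjoin_identity :: 'g option monoid) = frac_monoid"
    by (auto simp: adjoin_identity_def UNIV_option_conv image_image)
qed

lemma is_identity_unique: "is_identity e \<Longrightarrow> is_identity f \<Longrightarrow> e = f"
  unfolding is_identity_def by (metis add.commute)

lemma valued_monoid_semigroup1:
  "valued_monoid (semigroup1 :: 'g :: {ab_semigroup_add, cancel_semigroup_add} option monoid) option_frac"
  "option_frac ` carrier (semigroup1 :: 'g option monoid) = frac_monoid"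
proof -
  have "valued_monoid (semigroup1 :: 'g option monoid) option_frac \<and>
      option_frac ` carrier (semigroup1 :: 'g option monoid) = frac_monoid"
  proof (cases "\<exists>e :: 'g. is_identity e")
    case True
    then obtain e :: 'g where e: "is_identity e" by blast
    then have the: "(THE e :: 'g. is_identity e) = e"
      using is_identity_unique by blast
    have "frac e = 0" using e by (simp add: frac_eq_0_iff)
    then have "0 \<in> range (frac :: 'g \<Rightarrow> _)" by (metis rangeI)
    with True \<open>frac e = 0\<close> the show ?thesis
      by (auto simp: semigroup1_def valued_monoid_def option_frac_add inj_on_def image_image)
  next
    case False
    then have "(semigroup1 :: 'g option monoid) = adjoin_identity" by (simp add: semigroup1_def)
    with valued_monoid_adjoin[OF False] show ?thesis by simp
  qed
  then show "valued_monoid (semigroup1 :: 'g option monoid) option_frac"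
    "option_frac ` carrier (semigroup1 :: 'g option monoid) = frac_monoid" by auto
qed

section \<open>Gradings and irreducible elements\<close>

lemma sum_list_frac_monoid:
  assumes "\<tau> ` J \<subseteq> frac_monoid" "w \<in> lists J"
  shows "sum_list (map \<tau> w) \<in> frac_monoid"
  using assms(2)
proof (induction w rule: rev_induct)
  case (snoc i w)
  then have "\<tau> i \<in> frac_monoid" "sum_list (map \<tau> w) \<in> frac_monoid" using assms(1) by auto
  then show ?case by (auto simp flip: frac_add)
qed simp

text \<open>A generator has length 1, whereas a sum of two elements other than the identity has
  length at least 2. So a generator cannot split, and the word of an irreducible element has a
  single letter. In particular all gradings use the same values.\<close>

lemma grading_irreducible:
  fixes \<tau> :: "'j \<Rightarrow> 'g :: {ab_semigroup_add, cancel_semigroup_add} fraction_group"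
  assumes "grading frac_monoid J \<tau>"
  shows "\<tau> ` J = frac ` {x. irreducible_element x}"
proof
  have sub: "\<tau> ` J \<subseteq> frac_monoid"
    and gen: "\<And>x. x \<in> frac_monoid \<Longrightarrow> \<exists>w\<in>lists J. sum_list (map \<tau> w) = x"
    and len: "\<And>v w. v \<in> lists J \<Longrightarrow> w \<in> lists J \<Longrightarrow> sum_list (map \<tau> v) = sum_list (map \<tau> w) \<Longrightarrow> length v = length w"
    using assms unfolding grading_def by blast+
  have nz: "sum_list (map \<tau> w) \<noteq> 0" if "w \<in> lists J" "w \<noteq> []" for w
    using len[of w "[]"] that by auto
  show "\<tau> ` J \<subseteq> frac ` {x. irreducible_element x}"
  proof
    fix y assume "y \<in> \<tau> ` J"
    then obtain j where j: "j \<in> J" "y = \<tau> j" by blast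
    have "y \<noteq> 0" using nz[of "[j]"] j by auto
    then obtain x where x: "y = frac x" using sub j by auto
    have "\<not> (\<exists>a b. \<not> is_identity a \<and> \<not> is_identity b \<and> x = a + b)"
    proof
      assume "\<exists>a b. \<not> is_identity a \<and> \<not> is_identity b \<and> x = a + b"
      then obtain a b where ab: "\<not> is_identity a" "\<not> is_identity b" "x = a + b" by blast
      obtain v where v: "v \<in> lists J" "sum_list (map \<tau> v) = frac a" using gen[of "frac a"] by auto
      obtain w where w: "w \<in> lists J" "sum_list (map \<tau> w) = frac b" using gen[of "frac b"] by auto
      have "length (v @ w) = length [j]"
        using v w j x ab(3) by (intro len) (auto simp: frac_add)
      moreover have "v \<noteq> []" "w \<noteq> []"
        using v(2) w(2) ab(1,2) by (auto simp: frac_eq_0_iff[symmetric])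
      ultimately show False by (cases v; cases w) auto
    qed
    then have "irreducible_element x"
      using \<open>y \<noteq> 0\<close> x by (simp add: irreducible_element_def frac_eq_0_iff[symmetric])
    then show "y \<in> frac ` {x. irreducible_element x}" using x by blast
  qed
  show "frac ` {x. irreducible_element x} \<subseteq> \<tau> ` J"
  proof
    fix y assume "y \<in> frac ` {x :: 'g. irreducible_element x}"
    then obtain x :: 'g where x: "irreducible_element x" "y = frac x" by blast
    obtain w where w: "w \<in> lists J" "sum_list (map \<tau> w) = frac x" using gen[of "frac x"] by auto
    have "frac x \<noteq> 0" using x(1) by (simp add: irreducible_element_def frac_eq_0_iff)
    then obtain j v where jv: "w = j # v" using w(2) by (cases w) auto
    have "v = []"
    proof (rule ccontr)
      assume "v \<noteq> []"
      have v: "v \<in> lists J" "j \<in> J" using w jv by auto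
      have "sum_list (map \<tau> v) \<noteq> 0" using nz v \<open>v \<noteq> []\<close> by blast
      moreover have "sum_list (map \<tau> v) \<in> frac_monoid" using sum_list_frac_monoid[OF sub v(1)] .
      ultimately obtain b where b: "sum_list (map \<tau> v) = frac b" "frac b \<noteq> 0" by auto
      have "\<tau> j \<noteq> 0" using nz[of "[j]"] v by auto
      then obtain a where a: "\<tau> j = frac a" "frac a \<noteq> 0" using sub v by auto
      have "frac x = frac (a + b)" using w(2) jv a b by (simp add: frac_add)
      then have "x = a + b" by simp
      with a b x(1) show False unfolding irreducible_element_def frac_eq_0_iff by blast
    qed
    then have "y = \<tau> j" "j \<in> J" using w jv x(2) by auto
    then show "y \<in> \<tau> ` J" by blast
  qed
qed

text \<open>\<open>branching_monoid\<close> quantifies over families indexed by natural numbers;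
  this transports the given family there.\<close>

lemma grading_reindex:
  assumes "grading Q J \<tau>" "bij_betw h J' J"
  shows "grading Q J' (\<tau> \<circ> h)"
proof -
  have img: "h ` J' = J" using assms(2) by (simp add: bij_betw_def)
  have lists: "map h w \<in> lists J" if "w \<in> lists J'" for w using that img by auto
  have "finite J'" using assms by (simp add: grading_def bij_betw_finite)
  moreover have "\<exists>w\<in>lists J'. sum_list (map (\<tau> \<circ> h) w) = x" if x: "x \<in> Q" for x
  proof -
    obtain w where w: "w \<in> lists J" "sum_list (map \<tau> w) = x"
      using assms(1) x unfolding grading_def by blast
    then obtain w' where "w' \<in> lists J'" "w = map h w'" unfolding img[symmetric] lists_image by blast
    then show ?thesis using w(2) by (intro bexI[of _ w']) auto
  qed
  moreover have "length v = length w"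
    if "v \<in> lists J'" "w \<in> lists J'" "sum_list (map (\<tau> \<circ> h) v) = sum_list (map (\<tau> \<circ> h) w)" for v w
  proof -
    have "length (map h v) = length (map h w)"
      using that by (intro grading_length[OF assms(1)] lists) auto
    then show ?thesis by simp
  qed
  moreover have "(\<tau> \<circ> h) ` J' \<subseteq> Q" "J' \<noteq> {}"
    using assms(1) img by (auto simp: grading_def)
  ultimately show ?thesis
    unfolding grading_def by blast
qed

lemma monoid_adjoin_identity: "monoid (adjoin_identity :: 'g :: ab_semigroup_add option monoid)"
proof (rule monoidI)
  fix x y z :: "'g option"
  show "(x \<otimes>\<^bsub>adjoin_identity\<^esub> y) \<otimes>\<^bsub>adjoin_identity\<^esub> z = x \<otimes>\<^bsub>adjoin_identity\<^esub> (y \<otimes>\<^bsub>adjoin_identity\<^esub> z)"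
    by (cases x; cases y; cases z) (auto simp: adjoin_identity_def add.assoc)
  show "x \<otimes>\<^bsub>adjoin_identity\<^esub> \<one>\<^bsub>adjoin_identity\<^esub> = x"
    by (cases x) (auto simp: adjoin_identity_def)
qed (auto simp: adjoin_identity_def)

lemma monoid_monoid_of_identity:
  assumes "is_identity e"
  shows "monoid (monoid_of_identity e)"
proof (rule monoidI)
  fix x
  show "x \<otimes>\<^bsub>monoid_of_identity e\<^esub> \<one>\<^bsub>monoid_of_identity e\<^esub> = x"
    using assms add.commute[of x e] by (simp add: monoid_of_identity_def is_identity_def)
qed (use assms in \<open>auto simp: monoid_of_identity_def is_identity_def add.assoc\<close>)

text \<open>The old identity would be an idempotent of positive length.\<close>

lemma not_branching_adjoin:
  assumes "is_identity (e :: 'g :: {ab_semigroup_add, cancel_semigroup_add})"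
  shows "\<not> branching_monoid (adjoin_identity :: 'g option monoid)"
proof
  let ?M = "adjoin_identity :: 'g option monoid"
  assume "branching_monoid ?M"
  then obtain J :: "nat set" and t where br: "branching_cayley_graph ?M J t"
    unfolding branching_monoid_def by blast
  have same: "length v = length w"
    if "v \<in> lists J" "w \<in> lists J" "path_end ?M t v = path_end ?M t w" for v w
  proof -
    have "v \<in> paths_to ?M J t (path_end ?M t w)" "w \<in> paths_to ?M J t (path_end ?M t w)"
      using that by (simp_all add: paths_to_def)
    moreover have "path_end ?M t w \<in> carrier ?M" by (simp add: adjoin_identity_def)
    ultimately show ?thesis using br unfolding branching_cayley_graph_def by blast
  qed
  have nonempty: "paths_to ?M J t (Some e) \<noteq> {}"
    using br unfolding branching_cayley_graph_def by (auto simp: adjoin_identity_def)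
  then obtain w where w: "w \<in> lists J" "path_end ?M t w = Some e"
    by (auto simp: paths_to_def)
  \<comment> \<open>A letter with the value \<open>None\<close> would return to the start after one
    step, where the empty path ends too.\<close>
  have tn: "t i \<noteq> None" if "i \<in> J" for i
    using same[of "[i]" "[]"] that by (auto simp: path_end_def adjoin_identity_def)
  obtain i v where iv: "w = i # v" using w(2) by (cases w) (auto simp: path_end_def adjoin_identity_def)
  then have "i \<in> J" using w(1) by auto
  then obtain x where x: "t i = Some x" using tn by blast
  have "e + x = x" using assms by (simp add: is_identity_def)
  \<comment> \<open>Started at \<open>Some e\<close> instead of \<open>None\<close>, the first
    letter of \<open>w\<close> leads to the same vertex \<open>Some x\<close>, because
    \<open>e + x = x\<close>.\<close>
  then have "path_end ?M t (w @ w) = path_end ?M t w"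
    using w(2) x by (simp add: path_end_def iv) (simp add: adjoin_identity_def)
  then have "length (w @ w) = length w" using w(1) by (intro same) auto
  then show False using iv by simp
qed

text \<open>All gradings take the irreducible elements as values, so if some family is a grading,
  words over an admissible \<open>s\<close> translate letter by letter, without change of length or
  sum, into words over that family. Conversely, the family \<open>s\<close> itself witnesses the
  branching property.\<close>

lemma branching_admissible_iff:
  fixes s :: "'i \<Rightarrow> 'g :: {ab_semigroup_add, cancel_semigroup_add}"
  assumes "semigroup_generators I s"
  shows "branching_semigroup TYPE('g) \<and> admissible_generators I s \<longleftrightarrow> grading frac_monoid I (frac \<circ> s)"
proof -
  interpret S: valued_monoid "semigroup1 :: 'g option monoid" option_frac
    by (rule valued_monoid_semigroup1)
  have [simp]: "option_frac \<circ> (Some \<circ> s) = frac \<circ> s" by auto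
  have gen: "finite I" "I \<noteq> {}" "\<And>x. x \<in> frac_monoid \<Longrightarrow> \<exists>w\<in>lists I. sum_list (map (frac \<circ> s) w) = x"
    using assms unfolding semigroup_generators_def S.generating_system_iff valued_monoid_semigroup1(2) by auto
  show ?thesis
  proof
    assume *: "branching_semigroup TYPE('g) \<and> admissible_generators I s"
    obtain J :: "nat set" and \<tau> where J: "grading (frac_monoid :: 'g fraction_group set) J \<tau>"
    proof (cases "\<exists>e :: 'g. is_identity e")
      case True
      then have "\<not> branching_monoid (adjoin_identity :: 'g option monoid)"
        using not_branching_adjoin by blast
      with * obtain e :: 'g where e: "is_identity e" "branching_monoid (monoid_of_identity e)"
        unfolding branching_semigroup_def by blast
      interpret valued_monoid "monoid_of_identity e" frac by (rule valued_monoid_identity(1)[OF e(1)])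
      show ?thesis
        using e(2) that unfolding branching_monoid_def branching_iff_grading valued_monoid_identity(2)[OF e(1)]
        by blast
    next
      case False
      interpret valued_monoid "adjoin_identity :: 'g option monoid" option_frac
        by (rule valued_monoid_adjoin(1)[OF False])
      have "branching_monoid (adjoin_identity :: 'g option monoid)"
        using * False unfolding branching_semigroup_def by blast
      then show ?thesis
        using that unfolding branching_monoid_def branching_iff_grading valued_monoid_adjoin(2)[OF False]
        by blast
    qed
    have "frac ` s ` I = \<tau> ` J"
      using * grading_irreducible[OF J] by (simp add: admissible_generators_def)
    then have "\<exists>j\<in>J. \<tau> j = frac (s i)" if "i \<in> I" for i
      using that by (metis imageE imageI)
    \<comment> \<open>The map \<open>f\<close> may fail to be injective, for \<open>s\<close> may
      repeat generators; it preserves lengths and sums of words all the same.\<close>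
    then obtain f where f: "\<And>i. i \<in> I \<Longrightarrow> f i \<in> J" "\<And>i. i \<in> I \<Longrightarrow> \<tau> (f i) = frac (s i)"
      by metis
    have map: "map f w \<in> lists J" "sum_list (map \<tau> (map f w)) = sum_list (map (frac \<circ> s) w)"
      if "w \<in> lists I" for w
      using that f by (auto intro!: arg_cong[where f = sum_list])
    have "length v = length w"
      if "v \<in> lists I" "w \<in> lists I" "sum_list (map (frac \<circ> s) v) = sum_list (map (frac \<circ> s) w)" for v w
    proof -
      have "length (map f v) = length (map f w)"
        using that by (intro grading_length[OF J]) (simp_all only: map)
      then show ?thesis by simp
    qed
    moreover have "(frac \<circ> s) ` I \<subseteq> frac_monoid" by auto
    ultimately show "grading frac_monoid I (frac \<circ> s)"
      unfolding grading_def using gen by blast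
  next
    assume gr: "grading frac_monoid I (frac \<circ> s)"
    have "frac ` s ` I = frac ` {x. irreducible_element x}"
      using grading_irreducible[OF gr] by (simp add: image_comp)
    then have adm: "admissible_generators I s"
      unfolding admissible_generators_def by (simp add: inj_image_eq_iff inj_on_def)
    obtain h where h: "bij_betw h {0..<card I} I"
      using ex_bij_betw_nat_finite[OF gen(1)] by blast
    have gr': "grading frac_monoid {0..<card I} (frac \<circ> (s \<circ> h))"
      using grading_reindex[OF gr h] by (simp add: comp_assoc)
    have "branching_semigroup TYPE('g)"
    proof (cases "\<exists>e :: 'g. is_identity e")
      case True
      then obtain e :: 'g where e: "is_identity e" by blast
      interpret valued_monoid "monoid_of_identity e" frac by (rule valued_monoid_identity(1)[OF e])
      have "(s \<circ> h) ` {0..<card I} \<subseteq> carrier (monoid_of_identity e)" by (simp add: monoid_of_identity_def)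
      with gr' have "branching_monoid (monoid_of_identity e)"
        unfolding branching_monoid_def branching_iff_grading valued_monoid_identity(2)[OF e]
        using monoid_monoid_of_identity[OF e] by blast
      with e show ?thesis unfolding branching_semigroup_def by blast
    next
      case False
      interpret valued_monoid "adjoin_identity :: 'g option monoid" option_frac
        by (rule valued_monoid_adjoin(1)[OF False])
      have "grading frac_monoid {0..<card I} (option_frac \<circ> (Some \<circ> s \<circ> h))"
        using gr' by (simp add: o_def)
      moreover have "(Some \<circ> s \<circ> h) ` {0..<card I} \<subseteq> carrier (adjoin_identity :: 'g option monoid)"
        by (simp add: adjoin_identity_def)
      ultimately have "branching_monoid (adjoin_identity :: 'g option monoid)"
        unfolding branching_monoid_def branching_iff_grading valued_monoid_adjoin(2)[OF False]
        using monoid_adjoin_identity by blast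
      then show ?thesis unfolding branching_semigroup_def by blast
    qed
    with adm show "branching_semigroup TYPE('g) \<and> admissible_generators I s" by blast
  qed
qed

theorem theorem2:
  fixes I :: "'i set"
    and s :: "'i \<Rightarrow> 'g :: {ab_semigroup_add, cancel_semigroup_add}"
  assumes "semigroup_generators I s"
  shows "\<exists>d h.
    (if branching_semigroup TYPE('g) \<and> admissible_generators I s
     then d + 1 = group_rank TYPE('g fraction_group)
     else d = group_rank TYPE('g fraction_group)) \<and>
    homeomorphic_map (absolute_topology I s) (subtopology (Euclidean_space d) (closed_disk d)) h \<and>
    h ` absolute_main_part I s = disk_interior d"
proof -
  let ?M = "semigroup1 :: 'g option monoid"
  define \<sigma> where "\<sigma> = frac \<circ> s"
  interpret S: valued_monoid ?M option_frac
    by (rule valued_monoid_semigroup1)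
  have os: "option_frac \<circ> (Some \<circ> s) = \<sigma>" by (auto simp: \<sigma>_def)
  have gen: "finite I" "I \<noteq> {}" "(Some \<circ> s) ` I \<subseteq> carrier ?M"
    "\<And>x. x \<in> frac_monoid \<Longrightarrow> \<exists>w\<in>lists I. sum_list (map \<sigma> w) = x"
    using assms unfolding semigroup_generators_def S.generating_system_iff valued_monoid_semigroup1(2) os
    by auto
  obtain i0 where i0: "i0 \<in> I" using gen(2) by blast
  interpret generated_group I \<sigma> i0
  proof
    show "finite I" "i0 \<in> I" by (fact gen(1) i0)+
    fix z :: "'g fraction_group"
    obtain a b where z: "z = frac a - frac b" using frac_diff_surj by blast
    obtain v where "v \<in> lists I" "sum_list (map \<sigma> v) = frac a" using gen(4)[of "frac a"] by auto
    moreover obtain w where "w \<in> lists I" "sum_list (map \<sigma> w) = frac b" using gen(4)[of "frac b"] by auto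
    ultimately show "\<exists>v\<in>lists I. \<exists>w\<in>lists I. z = sum_list (map \<sigma> v) - sum_list (map \<sigma> w)"
      using z by metis
  qed
  note paths = S.mem_paths_to_iff[OF gen(3), unfolded os]
  \<comment> \<open>\<open>option_frac\<close> is injective on the vertices, so two paths end at the
    same vertex iff their marks have the same sum in the group of fractions.\<close>
  have central: "central_measures I s = exch"
  proof -
    have "(\<forall>v\<in>carrier ?M. \<forall>n>0. \<forall>w\<in>paths_to ?M I (Some \<circ> s) v. \<forall>w'\<in>paths_to ?M I (Some \<circ> s) v.
          length w = n \<and> length w' = n \<longrightarrow> measure \<nu> (cylinder I w) = measure \<nu> (cylinder I w')) \<longleftrightarrow>
        (\<forall>v w. homogeneous_relation v w \<longrightarrow> measure \<nu> (cylinder I v) = measure \<nu> (cylinder I w))"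
      (is "?L \<longleftrightarrow> ?R") for \<nu>
    proof
      assume L: ?L
      show ?R
      proof (intro allI impI)
        fix v w assume vw: "homogeneous_relation v w"
        show "measure \<nu> (cylinder I v) = measure \<nu> (cylinder I w)"
        \<comment> \<open>Centrality speaks of positive lengths only. For length 0 both words are
          empty.\<close>
        proof (cases "v = []")
          case True
          with vw show ?thesis by (simp add: homogeneous_relation_def)
        next
          case False
          let ?x = "path_end ?M (Some \<circ> s) w"
          have v: "v \<in> lists I" and w: "w \<in> lists I" and len: "length v = length w"
            and eq: "sum_list (map \<sigma> v) = sum_list (map \<sigma> w)"
            using vw by (auto simp: homogeneous_relation_def)
          have x: "?x \<in> carrier ?M" using S.path_end_closed[OF gen(3) w] .
          have "option_frac ?x = sum_list (map \<sigma> w)" by (simp only: S.val_path_end os)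
          then have pv: "v \<in> paths_to ?M I (Some \<circ> s) ?x" and pw: "w \<in> paths_to ?M I (Some \<circ> s) ?x"
            using v w eq by (auto simp only: paths[OF x])
          have "length v > 0" using False by simp
          from L[rule_format, OF x this pv pw] len show ?thesis by simp
        qed
      qed
    next
      assume R: ?R
      show ?L
      proof (intro ballI allI impI)
        fix x n v w
        assume "x \<in> carrier ?M" "v \<in> paths_to ?M I (Some \<circ> s) x" "w \<in> paths_to ?M I (Some \<circ> s) x"
          "length v = n \<and> length w = n"
        then have "homogeneous_relation v w"
          unfolding homogeneous_relation_def by (auto simp only: paths)
        with R show "measure \<nu> (cylinder I v) = measure \<nu> (cylinder I w)" by blast
      qed
    qed
    then show ?thesis unfolding central_measures_def exch_def by simp
  qed
  have absolute: "absolute I s = ergodic"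
    unfolding absolute_def ergodic_def central ..
  \<comment> \<open>Generation is given, so of \<open>grading\<close> only the condition on lengths
    is at stake, and that is \<open>graded\<close>.\<close>
  have graded: "branching_semigroup TYPE('g) \<and> admissible_generators I s \<longleftrightarrow> graded"
  proof -
    have A: "\<sigma> ` I \<subseteq> frac_monoid" by (auto simp: \<sigma>_def)
    have B: "\<forall>x\<in>frac_monoid. \<exists>w\<in>lists I. sum_list (map \<sigma> w) = x" using gen(4) by (rule ballI)
    have "grading frac_monoid I \<sigma> \<longleftrightarrow> graded"
    proof
      assume graded
      then show "grading frac_monoid I \<sigma>"
        unfolding grading_def graded_def by (intro conjI gen(1,2) A B)
    next
      assume "grading frac_monoid I \<sigma>"
      then show graded unfolding grading_def graded_def by (elim conjE)
    qed
    then show ?thesis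
      unfolding branching_admissible_iff[OF assms] \<sigma>_def .
  qed
  obtain d F where d: "if graded then d + 1 = group_rank TYPE('g fraction_group)
      else d = group_rank TYPE('g fraction_group)"
    and F: "continuous_on variety F" "inj_on F variety" "F ` variety = closed_disk d"
    and int: "\<And>p. p \<in> variety \<Longrightarrow> F p \<in> disk_interior d \<longleftrightarrow> (\<forall>i\<in>I. 0 < p i)"
    by (rule variety_parametrization) blast
  have "homeomorphic_map (absolute_topology I s) (subtopology (Euclidean_space d) (closed_disk d)) (F \<circ> marginal)"
    unfolding absolute_topology_def absolute by (rule ergodic_homeomorphic[OF i0 F])
  moreover have "(F \<circ> marginal) ` absolute_main_part I s = disk_interior d"
  proof
    show "(F \<circ> marginal) ` absolute_main_part I s \<subseteq> disk_interior d"
    proof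
      fix y assume "y \<in> (F \<circ> marginal) ` absolute_main_part I s"
      then obtain \<nu> where \<nu>: "\<nu> \<in> ergodic" "\<forall>w\<in>lists I. measure \<nu> (cylinder I w) \<noteq> 0" "y = F (marginal \<nu>)"
        by (auto simp: absolute_main_part_def absolute)
      then show "y \<in> disk_interior d"
        using nondegenerate_iff[OF \<nu>(1)] int[OF marginal_variety[OF \<nu>(1)]] by blast
    qed
    show "disk_interior d \<subseteq> (F \<circ> marginal) ` absolute_main_part I s"
    proof
      fix y assume y: "y \<in> disk_interior d"
      then have "y \<in> F ` variety"
        unfolding F(3) by (auto simp: disk_interior_eq closed_disk_def)
      then obtain p where p: "p \<in> variety" "y = F p" by blast
      note b = bernoulli_ergodic[OF p(1)] marginal_bernoulli[OF p(1)]
      have "\<forall>w\<in>lists I. measure (bernoulli I p) (cylinder I w) \<noteq> 0"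
        using nondegenerate_iff[OF b(1)] b(2) int[OF p(1)] p(2) y by simp
      then have "bernoulli I p \<in> absolute_main_part I s"
        using b(1) by (simp add: absolute_main_part_def absolute)
      then show "y \<in> (F \<circ> marginal) ` absolute_main_part I s"
        using b(2) p(2) by (intro image_eqI[of _ _ "bernoulli I p"]) auto
    qed
  qed
  ultimately show ?thesis using d graded by metis
qed

end
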